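(* Let $r>1$ be an integer, let $q,p$ be nonzero complex numbers with $|p|<1$, and let $n\in\mathbb N_0$. Then the following identity is valid in the algebra $\mathbb C_{q,p}[X_1,\dots,X_r;a_1,\dots,a_r]$ of elliptic commuting variables: $$(X_1+\cdots+X_r)^n=\sum_{k_1+\cdots+k_r=n}\begin{bmatrix}n\\k_1,\dots,k_r\end{bmatrix}_{a_1,\dots,a_r;q,p}X_1^{k_1}\cdots X_r^{k_r},$$ where the sum runs over non-negative integers $k_1,\dots,k_r$ with $k_1+\cdots+k_r=n$ and the coefficients are the elliptic multinomial coefficients.
   Context: Notation. For $x\in\mathbb C^\times=\mathbb C\setminus\{0\}$ and nonzero complex $p$ with $|p|<1$, let $(x;p)_\infty=\prod_{k\ge0}(1-xp^k)$ and let $\theta(x)=\theta(x;p)=(x;p)_\infty(p/x;p)_\infty$ be the modified Jacobi theta function; $\theta(x_1,\dots,x_m)=\prod_{i=1}^m\theta(x_i)$. For an integer $k\ge 0$, $(a;q,p)_k=\prod_{i=0}^{k-1}\theta(aq^i;p)$ (equal to $1$ for $k=0$). Field of coefficients. Write $q=e^{2\pi\sqrt{-1}\sigma}$, $p=e^{2\pi\sqrt{-1}\tau}$ with complex $\sigma,\tau$. $\mathbb E_{q,p}(a_1,\dots,a_r)$ denotes the field of totally elliptic functions over $\mathbb C$ in the complex variables $\log_q a_1,\dots,\log_q a_r$, i.e. functions that are meromorphic and doubly periodic in each of these variables, with equal periods $\sigma^{-1}$ and $\tau\sigma^{-1}$. Elliptic weights. For indeterminates $a,b$ and integers $s,t$,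 $$w_{a,b;q,p}(s,t)=\frac{\theta(aq^{s+2t},bq^{2s+t-2},aq^{t-s-1}/b)}{\theta(aq^{s+2t-2},bq^{2s+t},aq^{t-s+1}/b)}\,q.$$ The algebra. Let $X_1,\dots,X_r,a_1,\dots,a_r$ be $2r$ noncommuting variables, where $a_1,\dots,a_r$ commute with each other. $\mathbb C_{q,p}[X_1,\dots,X_r;a_1,\dots,a_r]$ is the associative unital algebra over $\mathbb C$ generated by $X_1,\dots,X_r$ (with the elements of $\mathbb E_{q,p}(a_1,\dots,a_r)$ belonging to the algebra as coefficients), satisfying the relations $$X_jX_i=w_{a_i,a_j;q,p}(1,1)\,X_iX_j\quad (1\le i<j\le r),$$ $$X_i\,f(a_1,\dots,a_r)=f(a_1q^2,\dots,a_{i-1}q^2,a_iq,a_{i+1}q^2,\dots,a_rq^2)\,X_i\quad(1\le i\le r)$$ for all $f\in\mathbb E_{q,p}(a_1,\dots,a_r)$. Elliptic multinomial coefficients. For non-negative integers $k_1,\dots,k_r$, with $K_i=\sum_{\nu=1}^i k_\nu$ for $i=0,\dots,r$, $$\begin{bmatrix}k_1+\cdots+k_r\\k_1,\dots,k_r\end{bmatrix}_{a_1,\dots,a_r;q,p}=\frac{(q;q,p)_{k_1+\cdots+k_r}}{\prod_{i=1}^r(q;q,p)_{k_i}}\prod_{i=1}^r\frac{(a_iq^{1+K_r-k_i};q,p)_{k_i}}{(a_iq^{1+2K_{i-1}};q,p)_{k_i}}\prod_{1\le i<j\le r}\frac{(a_iq^{1-k_i}/a_j;q,p)_{k_j}}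{(a_iq/a_j;q,p)_{k_j}}.$$
   Formalization: It is additionally assumed that (q;q,p)_n is nonzero, i.e. q^m is not an integer power of p for 1 ≤ m ≤ n; otherwise some elliptic multinomial coefficients have a zero denominator and are undefined (e.g. q = 1, n = 1). *)

theory Defs
  imports "HOL-Analysis.Analysis" "HOL-Algebra.QuotRing" "HOL-Library.Poly_Mapping"
begin

section \<open>Theta functions, elliptic weights, elliptic multinomial coefficients\<close>

definition theta :: "complex \<Rightarrow> complex \<Rightarrow> complex" where
  "theta p x = prodinf (\<lambda>k. 1 - x * p ^ k) * prodinf (\<lambda>k. 1 - (p / x) * p ^ k)"

definition ell_poch :: "complex \<Rightarrow> complex \<Rightarrow> complex \<Rightarrow> nat \<Rightarrow> complex" where
  "ell_poch q p a k = (\<Prod>i<k. theta p (a * q ^ i))"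

definition ell_weight :: "complex \<Rightarrow> complex \<Rightarrow> complex \<Rightarrow> complex \<Rightarrow> int \<Rightarrow> int \<Rightarrow> complex" where
  "ell_weight q p a b s t =
     (theta p (a * q powi (s + 2 * t)) * theta p (b * q powi (2 * s + t - 2))
        * theta p (a * q powi (t - s - 1) / b))
     / (theta p (a * q powi (s + 2 * t - 2)) * theta p (b * q powi (2 * s + t))
        * theta p (a * q powi (t - s + 1) / b)) * q"

text \<open>The indices \<open>1, \<dots>, r\<close> are the elements of a finite linearly ordered type \<open>'r\<close>, so
  \<open>K\<^sub>i\<close>, \<open>K\<^sub>i\<^sub>-\<^sub>1\<close> and \<open>K\<^sub>r\<close> are \<open>sum k {..i}\<close>, \<open>sum k {..<i}\<close> and \<open>sum k UNIV\<close>.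
  If \<open>q\<^sup>m\<close> is an integer power of \<open>p\<close> for some \<open>1 \<le> m \<le> k\<^sub>i\<close>, then \<open>ell_poch q p q (k i)\<close> vanishes and
  the coefficient is undefined in the mathematics (here the quotient is \<open>0\<close>).\<close>

definition ell_multinomial ::
    "complex \<Rightarrow> complex \<Rightarrow> ('r::{finite,linorder} \<Rightarrow> complex) \<Rightarrow> ('r \<Rightarrow> nat) \<Rightarrow> complex" where
  "ell_multinomial q p a k =
     ell_poch q p q (sum k UNIV) / (\<Prod>i\<in>UNIV. ell_poch q p q (k i))
     * (\<Prod>i\<in>UNIV. ell_poch q p (a i * q powi (1 + int (sum k UNIV) - int (k i))) (k i)
                   / ell_poch q p (a i * q powi (1 + 2 * int (sum k {..<i}))) (k i))
     * (\<Prod>(i,j)\<in>{(i,j). i < j}. ell_poch q p (a i * q powi (1 - int (k i)) / a j) (k j)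
                                / ell_poch q p (a i * q / a j) (k j))"


section \<open>The field of totally elliptic functions\<close>

text \<open>A meromorphic function of several variables has no value at its poles and points of
  indeterminacy. Functions are therefore taken modulo equality on a dense open set, with
  pointwise operations.\<close>

definition generically_on :: "'a::topological_space set \<Rightarrow> ('a \<Rightarrow> bool) \<Rightarrow> bool" where
  "generically_on U P \<longleftrightarrow> U \<subseteq> closure (interior {x \<in> U. P x})"

lemma generically_on_mono:
  assumes "generically_on U P" and "\<And>x. x \<in> U \<Longrightarrow> P x \<Longrightarrow> Q x"
  shows "generically_on U Q"
proof -
  have "{x \<in> U. P x} \<subseteq> {x \<in> U. Q x}" using assms(2) by auto
  then show ?thesis using assms(1) unfolding generically_on_def
    by (meson closure_mono interior_mono order_trans)
qed

lemma generically_on_always: "open U \<Longrightarrow> (\<And>x. x \<in> U \<Longrightarrow> P x) \<Longrightarrow> generically_on U P"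
proof -
  assume U: "open U" and P: "\<And>x. x \<in> U \<Longrightarrow> P x"
  have "{x \<in> U. P x} = U" using P by auto
  then show ?thesis using U by (simp add: generically_on_def interior_open closure_subset)
qed

lemma generically_on_conj:
  assumes "generically_on U P" and "generically_on U Q"
  shows "generically_on U (\<lambda>x. P x \<and> Q x)"
proof -
  let ?A = "interior {x \<in> U. P x}" and ?B = "interior {x \<in> U. Q x}"
  have "U \<subseteq> closure (?A \<inter> ?B)"
  proof
    fix x assume x: "x \<in> U"
    show "x \<in> closure (?A \<inter> ?B)"
    proof (rule ccontr)
      let ?W = "- closure (?A \<inter> ?B)"
      assume "x \<notin> closure (?A \<inter> ?B)"
      moreover have "x \<in> closure ?A"
        using x assms(1) unfolding generically_on_def by blast
      ultimately have "?W \<inter> ?A \<noteq> {}"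
        using open_Int_closure_eq_empty[of ?W ?A] by blast
      then obtain y where y: "y \<in> ?W \<inter> ?A" by blast
      then have "y \<in> U" using interior_subset[of "{x \<in> U. P x}"] by blast
      then have "y \<in> closure ?B" using assms(2) unfolding generically_on_def by blast
      then have "(?W \<inter> ?A) \<inter> ?B \<noteq> {}"
        using y open_Int_closure_eq_empty[of "?W \<inter> ?A" ?B] by blast
      then show False using closure_subset[of "?A \<inter> ?B"] by blast
    qed
  qed
  moreover have "?A \<inter> ?B = interior {x \<in> U. P x \<and> Q x}"
    by (subst interior_Int[symmetric]) (rule arg_cong[of _ _ interior], auto)
  ultimately show ?thesis by (simp add: generically_on_def)
qed

lemma generically_on_open_subset:
  assumes "generically_on U P" and "open V" and "V \<subseteq> U"
  shows "generically_on V P"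
proof -
  have "V \<subseteq> closure (V \<inter> interior {x \<in> U. P x})"
    using assms open_Int_closure_subset[of V "interior {x \<in> U. P x}"]
    unfolding generically_on_def by blast
  moreover have "V \<inter> interior {x \<in> U. P x} \<subseteq> interior {x \<in> V. P x}"
    using assms by (intro interior_maximal) (auto dest: interior_subset[THEN subsetD])
  ultimately show ?thesis unfolding generically_on_def by (meson closure_mono order_trans)
qed

lemma generically_on_translate:
  fixes P :: "'a::real_normed_vector \<Rightarrow> bool"
  assumes "generically_on UNIV P"
  shows "generically_on UNIV (\<lambda>x. P (x + v))"
proof -
  have "{x. P (x + v)} = (+) (- v) ` {x. P x}"
    by (auto simp: image_iff algebra_simps)
  then have "closure (interior {x. P (x + v)}) = (+) (- v) ` closure (interior {x. P x})"
    by (simp only: interior_translation closure_translation)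
  also have "\<dots> = UNIV"
    using assms by (auto simp: generically_on_def top.extremum_unique)
  finally show ?thesis by (simp add: generically_on_def)
qed

quotient_type 'r gfun =
  "complex ^ 'r \<Rightarrow> complex" / "\<lambda>f g. generically_on UNIV (\<lambda>x. f x = g x)"
proof (rule equivpI)
  show "reflp (\<lambda>f g. generically_on UNIV (\<lambda>x. (f::complex ^ 'r \<Rightarrow> complex) x = g x))"
    by (auto intro!: reflpI generically_on_always)
  show "symp (\<lambda>f g. generically_on UNIV (\<lambda>x. (f::complex ^ 'r \<Rightarrow> complex) x = g x))"
    by (auto intro!: sympI elim: generically_on_mono)
  show "transp (\<lambda>f g. generically_on UNIV (\<lambda>x. (f::complex ^ 'r \<Rightarrow> complex) x = g x))"
    by (rule transpI, drule (1) generically_on_conj) (erule generically_on_mono, simp)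
qed

instantiation gfun :: (finite) comm_ring_1
begin

lift_definition zero_gfun :: "'a gfun" is "\<lambda>x. 0" .
lift_definition one_gfun :: "'a gfun" is "\<lambda>x. 1" .
lift_definition uminus_gfun :: "'a gfun \<Rightarrow> 'a gfun" is "\<lambda>f x. - f x"
  by (erule generically_on_mono) simp
lift_definition plus_gfun :: "'a gfun \<Rightarrow> 'a gfun \<Rightarrow> 'a gfun" is "\<lambda>f g x. f x + g x"
  by (drule (1) generically_on_conj) (erule generically_on_mono, simp)
lift_definition minus_gfun :: "'a gfun \<Rightarrow> 'a gfun \<Rightarrow> 'a gfun" is "\<lambda>f g x. f x - g x"
  by (drule (1) generically_on_conj) (erule generically_on_mono, simp)
lift_definition times_gfun :: "'a gfun \<Rightarrow> 'a gfun \<Rightarrow> 'a gfun" is "\<lambda>f g x. f x * g x"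
  by (drule (1) generically_on_conj) (erule generically_on_mono, simp)

instance
proof
  show "(0::'a gfun) \<noteq> 1"
    by transfer (simp add: generically_on_def)
qed (transfer; rule generically_on_always; simp add: algebra_simps)+

end

lift_definition const_gfun :: "complex \<Rightarrow> 'r::finite gfun" is "\<lambda>c x. c" .

lift_definition translate :: "complex ^ 'r \<Rightarrow> 'r::finite gfun \<Rightarrow> 'r gfun" is "\<lambda>v f x. f (x + v)"
  by (rule generically_on_translate)

text \<open>Holomorphic in several variables: differentiable with complex-linear derivative.
  (The derivative in the library notion is only real-linear.)\<close>

definition holomorphic_sv_on :: "(complex ^ 'r \<Rightarrow> complex) \<Rightarrow> (complex ^ 'r::finite) set \<Rightarrow> bool" where
  "holomorphic_sv_on f U \<longleftrightarrow>
     (\<forall>z\<in>U. \<exists>D. (f has_derivative D) (at z) \<and> (\<forall>c v. D (c *s v) = c * D v))"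

text \<open>Meromorphic: locally a quotient of holomorphic functions, the denominator not vanishing
  identically near any point.\<close>

lift_definition is_meromorphic :: "'r::finite gfun \<Rightarrow> bool" is
  "\<lambda>f. \<forall>z. \<exists>U g h. open U \<and> z \<in> U \<and> holomorphic_sv_on g U \<and> holomorphic_sv_on h U \<and>
         generically_on U (\<lambda>x. h x \<noteq> 0 \<and> f x = g x / h x)"
proof -
  have imp: "\<forall>z. \<exists>U g h. open U \<and> z \<in> U \<and> holomorphic_sv_on g U \<and> holomorphic_sv_on h U \<and>
         generically_on U (\<lambda>x. h x \<noteq> 0 \<and> f' x = g x / h x)"
    if eq: "generically_on UNIV (\<lambda>x. f x = f' x)"
    and mero: "\<forall>z. \<exists>U g h. open U \<and> z \<in> U \<and> holomorphic_sv_on g U \<and> holomorphic_sv_on h U \<and>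
         generically_on U (\<lambda>x. h x \<noteq> 0 \<and> f x = g x / h x)"
    for f f' :: "complex ^ 'r \<Rightarrow> complex"
  proof
    fix z
    from mero obtain U g h where *: "open U" "z \<in> U" "holomorphic_sv_on g U"
      "holomorphic_sv_on h U" "generically_on U (\<lambda>x. h x \<noteq> 0 \<and> f x = g x / h x)" by blast
    have "generically_on U (\<lambda>x. f x = f' x)"
      by (rule generically_on_open_subset[OF eq *(1)]) simp
    from generically_on_conj[OF *(5) this]
    have "generically_on U (\<lambda>x. h x \<noteq> 0 \<and> f' x = g x / h x)"
      by (rule generically_on_mono) auto
    with * show "\<exists>U g h. open U \<and> z \<in> U \<and> holomorphic_sv_on g U \<and> holomorphic_sv_on h U \<and>
         generically_on U (\<lambda>x. h x \<noteq> 0 \<and> f' x = g x / h x)" by blast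
  qed
  fix f f' :: "complex ^ 'r \<Rightarrow> complex"
  assume eq: "generically_on UNIV (\<lambda>x. f x = f' x)"
  then have "generically_on UNIV (\<lambda>x. f' x = f x)" by (rule generically_on_mono) simp
  from imp[OF eq] imp[OF this] show "?thesis f f'" by (rule iffI)
qed

text \<open>The argument \<open>x\<close> of a function below has components \<open>x $ i = log\<^sub>q a\<^sub>i\<close>, where
  \<open>q = exp (2\<pi>\<i>\<sigma>)\<close>; so \<open>a\<^sub>i = exp (2\<pi>\<i>\<sigma> x $ i)\<close>, and \<open>a\<^sub>i \<mapsto> q\<^sup>m a\<^sub>i\<close> is \<open>x $ i \<mapsto> x $ i + m\<close>.\<close>

definition avar :: "complex \<Rightarrow> complex ^ 'r \<Rightarrow> 'r::finite \<Rightarrow> complex" where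
  "avar \<sigma> x i = exp (2 * of_real pi * \<i> * \<sigma> * x $ i)"

definition totally_elliptic :: "complex \<Rightarrow> complex \<Rightarrow> 'r::finite gfun set" where
  "totally_elliptic \<sigma> \<tau> = {f. is_meromorphic f \<and>
     (\<forall>i. translate (axis i (1 / \<sigma>)) f = f \<and> translate (axis i (\<tau> / \<sigma>)) f = f)}"

definition weight_fun :: "complex \<Rightarrow> complex \<Rightarrow> 'r \<Rightarrow> 'r \<Rightarrow> int \<Rightarrow> int \<Rightarrow> 'r::finite gfun" where
  "weight_fun \<sigma> \<tau> i j s t = abs_gfun (\<lambda>x.
     ell_weight (exp (2 * of_real pi * \<i> * \<sigma>)) (exp (2 * of_real pi * \<i> * \<tau>))
       (avar \<sigma> x i) (avar \<sigma> x j) s t)"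

definition multinomial_fun :: "complex \<Rightarrow> complex \<Rightarrow> ('r \<Rightarrow> nat) \<Rightarrow> 'r::{finite,linorder} gfun" where
  "multinomial_fun \<sigma> \<tau> k = abs_gfun (\<lambda>x.
     ell_multinomial (exp (2 * of_real pi * \<i> * \<sigma>)) (exp (2 * of_real pi * \<i> * \<tau>)) (avar \<sigma> x) k)"


section \<open>The algebra of elliptic commuting variables\<close>

text \<open>Words form a monoid under concatenation, so \<open>'g list \<Rightarrow>\<^sub>0 complex\<close> with its convolution
  product is the free unital algebra on \<open>'g\<close>.\<close>

instantiation list :: (type) monoid_add
begin
definition zero_list :: "'a list" where "zero_list = []"
definition plus_list :: "'a list \<Rightarrow> 'a list \<Rightarrow> 'a list" where "plus_list = (@)"
instance by standard (simp_all add: zero_list_def plus_list_def)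
end

definition free_algebra :: "'g set \<Rightarrow> ('g list \<Rightarrow>\<^sub>0 complex) ring" where
  "free_algebra G = \<lparr>carrier = {P. \<forall>w \<in> Poly_Mapping.keys P. set w \<subseteq> G},
     monoid.mult = (*), one = 1, zero = 0, add = (+)\<rparr>"

text \<open>The generators are \<open>Inl i\<close>, standing for \<open>X\<^sub>i\<close>, and \<open>Inr f\<close>, standing for the coefficient
  \<open>f\<close>.\<close>

type_synonym 'r gen = "'r + 'r gfun"

definition Xv :: "'r \<Rightarrow> 'r::finite gen list \<Rightarrow>\<^sub>0 complex" where
  "Xv i = Poly_Mapping.single [Inl i] 1"

definition Cf :: "'r gfun \<Rightarrow> 'r::finite gen list \<Rightarrow>\<^sub>0 complex" where
  "Cf f = Poly_Mapping.single [Inr f] 1"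

definition generators :: "complex \<Rightarrow> complex \<Rightarrow> 'r::finite gen set" where
  "generators \<sigma> \<tau> = range Inl \<union> Inr ` totally_elliptic \<sigma> \<tau>"

text \<open>The first three families make the totally elliptic functions a \<open>\<complex>\<close>-algebra of
  coefficients.\<close>

definition relators :: "complex \<Rightarrow> complex \<Rightarrow> ('r::{finite,linorder} gen list \<Rightarrow>\<^sub>0 complex) set" where
  "relators \<sigma> \<tau> =
     {Cf (f + g) - (Cf f + Cf g) | f g. f \<in> totally_elliptic \<sigma> \<tau> \<and> g \<in> totally_elliptic \<sigma> \<tau>}
   \<union> {Cf (f * g) - Cf f * Cf g | f g. f \<in> totally_elliptic \<sigma> \<tau> \<and> g \<in> totally_elliptic \<sigma> \<tau>}
   \<union> {Cf (const_gfun c) - Poly_Mapping.single [] c | c. True}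
   \<union> {Xv j * Xv i - Cf (weight_fun \<sigma> \<tau> i j 1 1) * Xv i * Xv j | i j. i < j}
   \<union> {Xv i * Cf f - Cf (translate (\<chi> l. if l = i then 1 else 2) f) * Xv i | i f.
        f \<in> totally_elliptic \<sigma> \<tau>}"

definition relation_ideal ::
    "complex \<Rightarrow> complex \<Rightarrow> ('r::{finite,linorder} gen list \<Rightarrow>\<^sub>0 complex) set" where
  "relation_ideal \<sigma> \<tau> = genideal (free_algebra (generators \<sigma> \<tau>)) (relators \<sigma> \<tau>)"

definition elliptic_algebra ::
    "complex \<Rightarrow> complex \<Rightarrow> ('r::{finite,linorder} gen list \<Rightarrow>\<^sub>0 complex) set ring" where
  "elliptic_algebra \<sigma> \<tau> = free_algebra (generators \<sigma> \<tau>) Quot relation_ideal \<sigma> \<tau>"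

definition X_elt ::
    "complex \<Rightarrow> complex \<Rightarrow> 'r \<Rightarrow> ('r::{finite,linorder} gen list \<Rightarrow>\<^sub>0 complex) set" where
  "X_elt \<sigma> \<tau> i = relation_ideal \<sigma> \<tau> +>\<^bsub>free_algebra (generators \<sigma> \<tau>)\<^esub> Xv i"

definition coef_elt ::
    "complex \<Rightarrow> complex \<Rightarrow> 'r gfun \<Rightarrow> ('r::{finite,linorder} gen list \<Rightarrow>\<^sub>0 complex) set" where
  "coef_elt \<sigma> \<tau> f = relation_ideal \<sigma> \<tau> +>\<^bsub>free_algebra (generators \<sigma> \<tau>)\<^esub> Cf f"

text \<open>\<open>X\<^sub>1\<^bsup>k\<^sub>1\<^esup> \<cdots> X\<^sub>r\<^bsup>k\<^sub>r\<^esup>\<close>, in increasing order of the indices.\<close>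

definition X_monomial ::
    "complex \<Rightarrow> complex \<Rightarrow> ('r \<Rightarrow> nat) \<Rightarrow> ('r::{finite,linorder} gen list \<Rightarrow>\<^sub>0 complex) set" where
  "X_monomial \<sigma> \<tau> k =
     foldr (\<lambda>i m. (X_elt \<sigma> \<tau> i [^]\<^bsub>elliptic_algebra \<sigma> \<tau>\<^esub> k i) \<otimes>\<^bsub>elliptic_algebra \<sigma> \<tau>\<^esub> m)
       (sorted_list_of_set UNIV) \<one>\<^bsub>elliptic_algebra \<sigma> \<tau>\<^esub>"

end

theory Submission
  imports Defs "HOL-Complex_Analysis.Complex_Analysis"
begin

text \<open>Let \<open>X\<close> be the sum of the variables. Multiplying \<open>X\<^sub>1\<^bsup>k\<^sub>1\<^esup> \<cdots> X\<^sub>r\<^bsup>k\<^sub>r\<^esup>\<close> by \<open>X\<^sub>i\<close> from the left and moving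
\<open>X\<^sub>i\<close> to its place costs a product of elliptic weights, and moving \<open>X\<^sub>i\<close> past a coefficient shifts
its arguments by powers of \<open>q\<close>. Since \<open>X\<^sup>n\<^sup>+\<^sup>1 = X X\<^sup>n\<close>, the theorem follows from a recursion that expresses the
coefficient \<open>M\<^sub>k\<close> of \<open>X\<^sup>k\<close> by the shifted coefficients \<open>M\<close> at \<open>k - e\<^sub>i\<close>, one summand for every \<open>i\<close> with \<open>k\<^sub>i > 0\<close>.

For the elliptic multinomial coefficients every summand of this recursion is a multiple of \<open>M\<^sub>k\<close>. The
weights telescope, and, with \<open>n = k\<^sub>1 + \<cdots> + k\<^sub>r\<close>, the \<open>i\<close>-th multiple is
\[ \frac{\theta(q^{k_i})}{\theta(q^n)} \frac{\theta(a_i q)}{\theta(a_i q^{1+n-k_i})}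
   \prod_{l \neq i} \frac{\theta(a_l q^{1+n})\, \theta(a_i q^{k_l}/a_l)}{\theta(a_l q^{1+n-k_l})\, \theta(a_i/a_l)}. \]
This expression is symmetric in the indices, although the algebra and the coefficients
depend on their order. The recursion says that these multiples add up to 1, which is an instance
of the elliptic partial fraction identity
\[ \sum_i \frac{\prod_j \theta(z_i/b_j)}{\prod_{j \neq i} \theta(z_i/z_j)} = 0
   \quad\mbox{if}\quad \prod_i z_i = \prod_i b_i. \]
The partial fraction identity follows by induction on the number of points from the addition formula
of Weierstrass (\<open>Weierstrass_addition\<close>, \<open>theta_partial_fractions\<close>), and the addition formula
follows from Liouville's theorem: the quotient of two theta functions with the same multiplier is constant if
the zeros of the denominator are simple and the numerator vanishes there.

Two points concern the setting. The recursion is an identity of meromorphic functions, so it has to be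
proved for generic arguments only, where no denominator vanishes. And the
coefficients must belong to the algebra, that is, be totally elliptic; by the recursion it is enough to
check this for the weights (\<open>multinomial_fun_totally_elliptic\<close>).\<close>

section \<open>The theta function and its zeros\<close>

locale theta_nome =
  fixes p :: complex
  assumes p_nz: "p \<noteq> 0" and p_less: "norm p < 1"
begin

definition p_poch :: "complex \<Rightarrow> complex" where
  "p_poch x = prodinf (\<lambda>k. 1 - x * p ^ k)"

lemma theta_eq_p_poch: "theta p x = p_poch x * p_poch (p / x)"
  by (simp add: theta_def p_poch_def)

lemma convergent_p_poch: "convergent_prod (\<lambda>k. 1 - x * p ^ k)"
proof (rule abs_convergent_prod_imp_convergent_prod)
  have "summable (\<lambda>k. norm x * norm p ^ k)"
    by (intro summable_mult summable_geometric) (use p_less in simp)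
  then show "abs_convergent_prod (\<lambda>k. 1 - x * p ^ k)"
    by (simp add: abs_convergent_prod_conv_summable norm_mult norm_power)
qed

lemma p_poch_holomorphic: "p_poch holomorphic_on UNIV"
proof (rule holomorphic_uniform_sequence[where f = "\<lambda>N x. \<Prod>k<N. 1 - x * p ^ k"])
  show "(\<lambda>x. \<Prod>k<N. 1 - x * p ^ k) holomorphic_on UNIV" for N
    by (intro holomorphic_intros)
  show "\<exists>d>0. cball x d \<subseteq> UNIV \<and>
      uniform_limit (cball x d) (\<lambda>N x. \<Prod>k<N. 1 - x * p ^ k) p_poch sequentially" for x
  proof (intro exI conjI)
    let ?B = "norm x + 1"
    have "uniformly_convergent_on (cball x 1) (\<lambda>N y. \<Sum>k<N. norm ((1 - y * p ^ k) - 1))"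
    proof (rule Weierstrass_m_test')
      show "norm (norm ((1 - y * p ^ k) - 1)) \<le> ?B * norm p ^ k" if "y \<in> cball x 1" for k y
      proof -
        have "norm y \<le> ?B"
          using that norm_triangle_sub[of y x] by (simp add: dist_norm norm_minus_commute)
        then show ?thesis by (simp add: norm_mult norm_power mult_right_mono)
      qed
      show "summable (\<lambda>k. ?B * norm p ^ k)"
        by (intro summable_mult summable_geometric) (use p_less in simp)
    qed
    then have "uniformly_convergent_on (cball x 1) (\<lambda>N y. \<Prod>k<N. 1 - y * p ^ k)"
      by (intro uniformly_convergent_on_prod') (auto intro!: continuous_intros)
    then have "uniform_limit (cball x 1) (\<lambda>N y. \<Prod>k<N. 1 - y * p ^ k)
        (\<lambda>y. lim (\<lambda>N. \<Prod>k<N. 1 - y * p ^ k)) sequentially"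
      by (simp add: uniformly_convergent_uniform_limit_iff)
    moreover have "lim (\<lambda>N. \<Prod>k<N. 1 - y * p ^ k) = p_poch y" for y
    proof -
      have "(\<lambda>N. \<Prod>k<N. 1 - y * p ^ k) \<longlonglongrightarrow> p_poch y"
        unfolding p_poch_def using convergent_prod_LIMSEQ[OF convergent_p_poch[of y]]
        by (simp add: LIMSEQ_lessThan_iff_atMost)
      then show ?thesis by (rule limI)
    qed
    ultimately show "uniform_limit (cball x 1) (\<lambda>N y. \<Prod>k<N. 1 - y * p ^ k) p_poch sequentially"
      by simp
  qed auto
qed auto

text \<open>Splitting off the first factor; the quasi-periodicity and the inversion formula of
  the theta function both reduce to this.\<close>

lemma p_poch_rec: "p_poch x = (1 - x) * p_poch (p * x)"
proof -
  have "(\<lambda>k. 1 - x * p ^ k) has_prod ((\<Prod>k<1. 1 - x * p ^ k) * prodinf (\<lambda>k. 1 - x * p ^ (k + 1)))"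
    by (rule has_prod_ignore_initial_segment'[OF convergent_p_poch])
  then have "p_poch x = (\<Prod>k<1. 1 - x * p ^ k) * prodinf (\<lambda>k. 1 - x * p ^ (k + 1))"
    unfolding p_poch_def using has_prod_unique by metis
  then show ?thesis by (simp add: p_poch_def algebra_simps)
qed

lemma p_poch_eq_0_iff: "p_poch x = 0 \<longleftrightarrow> (\<exists>k. x * p ^ k = 1)"
proof
  assume "p_poch x = 0"
  then show "\<exists>k. x * p ^ k = 1"
    using prodinf_nonzero[OF convergent_p_poch[of x]] unfolding p_poch_def by (metis eq_iff_diff_eq_0)
next
  assume "\<exists>k. x * p ^ k = 1"
  then obtain k where "x * p ^ k = 1" ..
  then show "p_poch x = 0"
  proof (induction k arbitrary: x)
    case 0
    then show ?case using p_poch_rec[of 1] by simp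
  next
    case (Suc k)
    have "p_poch (p * x) = 0" by (rule Suc.IH) (use Suc.prems in \<open>simp add: mult_ac\<close>)
    then show ?case using p_poch_rec[of x] by simp
  qed
qed

lemma theta_inverse: "x \<noteq> 0 \<Longrightarrow> theta p (1 / x) = - theta p x / x"
  unfolding theta_eq_p_poch by (subst p_poch_rec[of x], subst p_poch_rec[of "1/x"]) (simp add: field_simps)

lemma theta_p_mult: "x \<noteq> 0 \<Longrightarrow> theta p (p * x) = - theta p x / x"
  using p_nz unfolding theta_eq_p_poch
  by (subst p_poch_rec[of x], subst (2) p_poch_rec) (simp add: field_simps)

lemma theta_p_div: "x \<noteq> 0 \<Longrightarrow> theta p (x / p) = - (x / p) * theta p x"
  using theta_p_mult[of "x / p"] p_nz by (simp add: field_simps)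

lemma theta_one [simp]: "theta p 1 = 0"
  using p_poch_eq_0_iff[of 1] by (auto simp: theta_eq_p_poch intro!: exI[of _ 0])

lemma theta_swap: "x \<noteq> 0 \<Longrightarrow> y \<noteq> 0 \<Longrightarrow> theta p (x / y) = - (x / y) * theta p (y / x)"
  using theta_inverse[of "x / y"] by (simp add: field_simps)

lemma theta_eq_0_iff:
  assumes "x \<noteq> 0"
  shows "theta p x = 0 \<longleftrightarrow> (\<exists>m. x = p powi m)"
proof
  assume "theta p x = 0"
  then consider k where "x * p ^ k = 1" | k where "p / x * p ^ k = 1"
    by (auto simp: theta_eq_p_poch p_poch_eq_0_iff)
  then show "\<exists>m. x = p powi m"
  proof cases
    case 1
    then have "x = p powi (- int k)"
      using p_nz by (simp add: power_int_minus field_simps)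
    then show ?thesis ..
  next
    case 2
    then have "x = p powi (int (Suc k))"
      using p_nz assms unfolding power_int_of_nat by (simp add: field_simps)
    then show ?thesis ..
  qed
next
  assume "\<exists>m. x = p powi m"
  then obtain m where m: "x = p powi m" ..
  show "theta p x = 0"
  proof (cases "m \<ge> 1")
    case True
    have "p / x * p ^ (nat (m - 1)) = p powi 1 / p powi m * p powi (int (nat (m - 1)))"
      using m by (simp only: power_int_of_nat) simp
    also have "\<dots> = p powi (1 - m + (m - 1))"
      using p_nz True by (simp add: power_int_diff power_int_add)
    also have "\<dots> = 1" by simp
    finally have "p / x * p ^ (nat (m - 1)) = 1" .
    then have "p_poch (p / x) = 0" unfolding p_poch_eq_0_iff by blast
    then show ?thesis by (simp add: theta_eq_p_poch)
  next
    case False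
    have "x * p ^ (nat (- m)) = p powi m * p powi (int (nat (- m)))"
      using m by (simp only: power_int_of_nat)
    also have "\<dots> = p powi (m + (- m))"
      using p_nz False by (simp add: power_int_minus)
    also have "\<dots> = 1" by simp
    finally have "x * p ^ (nat (- m)) = 1" .
    then have "p_poch x = 0" unfolding p_poch_eq_0_iff by blast
    then show ?thesis by (simp add: theta_eq_p_poch)
  qed
qed

lemma theta_holomorphic: "theta p holomorphic_on (- {0})"
proof -
  have "(\<lambda>x. p_poch x * p_poch (p / x)) holomorphic_on (- {0})"
    by (intro holomorphic_intros holomorphic_on_subset[OF p_poch_holomorphic]
        holomorphic_on_compose_gen[OF _ p_poch_holomorphic, unfolded o_def]) auto
  then show ?thesis by (simp add: theta_eq_p_poch[abs_def])
qed

lemma theta_holomorphic_compose [holomorphic_intros]: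
  assumes "f holomorphic_on A" and "\<And>x. x \<in> A \<Longrightarrow> f x \<noteq> 0"
  shows "(\<lambda>x. theta p (f x)) holomorphic_on A"
  by (rule holomorphic_on_compose_gen[OF assms(1) theta_holomorphic, unfolded o_def])
    (use assms(2) in auto)

lemma theta_continuous [continuous_intros]:
  assumes "isCont f x" "f x \<noteq> 0"
  shows "isCont (\<lambda>x. theta p (f x)) x"
proof -
  have "isCont (theta p) (f x)"
    using holomorphic_on_imp_continuous_on[OF theta_holomorphic] assms(2)
    by (simp add: continuous_on_eq_continuous_at[OF open_Compl[OF closed_singleton]])
  from isCont_o2[OF assms(1) this] show ?thesis .
qed

lemma connected_punctured: "connected (- {0 :: complex})"
  by (rule connected_punctured_universe) simp

text \<open>The zeros of the theta function are isolated, since it does not vanish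
  identically.\<close>

lemma theta_eventually_nonzero:
  assumes "x \<noteq> 0"
  shows "eventually (\<lambda>y. theta p y \<noteq> 0 \<and> y \<noteq> 0) (at x)"
proof -
  \<comment> \<open>A point strictly between the circles through 1 and p is not a power of p.\<close>
  define b where "b = complex_of_real (sqrt (norm p))"
  have b: "b \<noteq> 0" using p_nz by (simp add: b_def)
  have nb: "norm b ^ 2 = norm p" by (simp add: b_def)
  have "theta p b \<noteq> 0"
  proof
    assume "theta p b = 0"
    then obtain m where "b = p powi m" using theta_eq_0_iff[OF b] by blast
    then have "norm p powi (2 * m) = norm p powi 1"
      using nb by (metis norm_power_int power_int_1_right power_int_mult power_int_numeral mult.commute)
    then have "2 * m = 1"
      using p_nz p_less by (metis norm_ge_zero less_irrefl power_int_strict_decreasing linorder_neqE_linordered_idom zero_less_norm_iff)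
    then show False by presburger
  qed
  from non_zero_neighbour_alt[OF theta_holomorphic _ connected_punctured _ _ this, of x]
  show ?thesis using assms b by auto
qed

text \<open>The zeros are simple. At the point 1 this is visible in the product;
  quasi-periodicity carries it to all the other powers of \<open>p\<close>.\<close>

lemma theta_deriv_nonzero:
  assumes "x \<noteq> 0" "theta p x = 0"
  shows "deriv (theta p) x \<noteq> 0"
proof -
  have D: "(theta p has_field_derivative deriv (theta p) y) (at y)" if "y \<noteq> 0" for y
    by (rule holomorphic_derivI[OF theta_holomorphic]) (use that in auto)
  have at1: "deriv (theta p) 1 \<noteq> 0"
  proof -
    have th: "theta p = (\<lambda>y. (1 - y) * (p_poch (p * y) * p_poch (p / y)))"
    proof (rule ext)
      fix y show "theta p y = (1 - y) * (p_poch (p * y) * p_poch (p / y))"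
        unfolding theta_eq_p_poch by (subst p_poch_rec[of y]) (simp only: mult.assoc)
    qed
    have "p_poch p \<noteq> 0"
    proof
      assume "p_poch p = 0"
      then obtain k where "p ^ Suc k = 1" using p_poch_eq_0_iff by auto
      moreover have "norm p ^ Suc k < norm p ^ 0"
        by (rule power_strict_decreasing) (use p_less p_nz in auto)
      ultimately show False by (metis norm_one norm_power power_0 less_irrefl)
    qed
    have "(\<lambda>y. p_poch (p * y) * p_poch (p / y)) holomorphic_on (- {0})"
      by (intro holomorphic_intros
          holomorphic_on_compose_gen[OF _ p_poch_holomorphic, unfolded o_def]) auto
    from holomorphic_derivI[OF this, of 1]
    obtain D where D: "((\<lambda>y. p_poch (p * y) * p_poch (p / y)) has_field_derivative D) (at 1)" by auto
    have "(theta p has_field_derivative (- (p_poch p * p_poch p))) (at 1)"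
      unfolding th by (rule derivative_eq_intros D refl | simp)+
    then show ?thesis using \<open>p_poch p \<noteq> 0\<close> by (simp add: DERIV_imp_deriv)
  qed
  have step: "p * deriv (theta p) (p * y) = - deriv (theta p) y / y"
    if "y \<noteq> 0" "theta p y = 0" for y
  proof -
    have "((\<lambda>x. theta p (p * x)) has_field_derivative (deriv (theta p) (p * y) * p)) (at y)"
      by (rule DERIV_chain2[OF D]) (use that p_nz in \<open>auto intro!: derivative_eq_intros\<close>)
    \<comment> \<open>At a zero \<open>y\<close> of the theta function only the derivative of
      the numerator contributes.\<close>
    moreover have "((\<lambda>x. - theta p x / x) has_field_derivative (- deriv (theta p) y / y)) (at y)"
      by (rule derivative_eq_intros D refl | use that in \<open>simp\<close>)+
    moreover have "((\<lambda>x. theta p (p * x)) has_field_derivative d) (at y) \<longleftrightarrow>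
        ((\<lambda>x. - theta p x / x) has_field_derivative d) (at y)" for d
    proof (rule DERIV_cong_ev[OF refl _ refl])
      show "\<forall>\<^sub>F x in nhds y. theta p (p * x) = - theta p x / x"
        using t1_space_nhds[OF that(1)] by (auto elim!: eventually_mono simp: theta_p_mult)
    qed
    ultimately show ?thesis using DERIV_unique by (metis mult.commute)
  qed
  have z: "theta p (p powi m) = 0" for m using theta_eq_0_iff[of "p powi m"] p_nz by auto
  have iff: "deriv (theta p) (p powi (m + 1)) = 0 \<longleftrightarrow> deriv (theta p) (p powi m) = 0" for m
    using step[of "p powi m"] z p_nz by (auto simp: power_int_add mult.commute)
  from assms obtain m where m: "x = p powi m" using theta_eq_0_iff by blast
  have "deriv (theta p) (p powi m) \<noteq> 0"
  proof (induction m rule: int_induct[where k = 0])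
    case base
    then show ?case using at1 by simp
  next
    case (step1 i)
    then show ?case using iff[of i] by simp
  next
    case (step2 i)
    then show ?case using iff[of "i - 1"] by simp
  qed
  then show ?thesis using m by simp
qed

section \<open>The addition formula of Weierstrass\<close>

text \<open>The annulus between the circles through \<open>p\<close> and 1 contains a
  fundamental domain for multiplication by \<open>p\<close>.\<close>

lemma annulus_representative:
  assumes "x \<noteq> 0"
  obtains m where "norm p \<le> norm (p powi m * x)" "norm (p powi m * x) \<le> 1"
proof -
  define m where "m = - \<lfloor>ln (norm x) / ln (norm p)\<rfloor>"
  have lnp: "ln (norm p) < 0" using p_nz p_less by simp
  have "norm (p powi m * x) = exp (of_int m * ln (norm p) + ln (norm x))"
    using p_nz assms by (simp add: norm_mult norm_power_int exp_add flip: exp_power_int)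
  moreover have "of_int m * ln (norm p) + ln (norm x) \<le> 0"
  proof -
    have "0 \<le> ln (norm x) / ln (norm p) + of_int m" unfolding m_def by simp
    then show ?thesis using lnp by (simp add: field_simps)
  qed
  moreover have "ln (norm p) \<le> of_int m * ln (norm p) + ln (norm x)"
  proof -
    have "ln (norm x) / ln (norm p) + of_int m \<le> 1" unfolding m_def
      using floor_correct[of "ln (norm x) / ln (norm p)"] by linarith
    then show ?thesis using lnp by (simp add: field_simps)
  qed
  ultimately have "norm (p powi m * x) \<le> 1" "exp (ln (norm p)) \<le> norm (p powi m * x)" by auto
  then show ?thesis using p_nz by (intro that[of m]) auto
qed

text \<open>Liouville: a function on the punctured plane that is invariant under multiplication
  by \<open>p\<close> is determined by its values on a compact annulus, hence bounded, and its
  composition with \<open>exp\<close> is entire.\<close>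

lemma invariant_holomorphic_constant:
  assumes hol: "h holomorphic_on (- {0})" and inv: "\<And>x. x \<noteq> 0 \<Longrightarrow> h (p * x) = h x"
    and "x \<noteq> 0" "y \<noteq> 0"
  shows "h x = h y"
proof -
  have inv_int: "h (p powi m * x) = h x" if "x \<noteq> 0" for x m
  proof (induction m rule: int_induct[where k = 0])
    case (step1 i)
    then show ?case using inv[of "p powi i * x"] p_nz that
      by (simp add: power_int_add_1 mult_ac)
  next
    case (step2 i)
    then show ?case using inv[of "p powi (i - 1) * x"] p_nz that power_int_add_1[of p "i - 1"]
      by (simp add: mult_ac)
  qed simp
  let ?K = "cball 0 1 - ball (0::complex) (norm p)"
  have "compact ?K" by (intro compact_diff compact_cball open_ball)
  moreover have "continuous_on ?K h"
    by (rule continuous_on_subset[OF holomorphic_on_imp_continuous_on[OF hol]]) (use p_nz in auto)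
  ultimately have "bounded (h ` ?K)" by (intro compact_imp_bounded compact_continuous_image)
  then obtain B where B: "\<forall>z\<in>?K. norm (h z) \<le> B" by (meson bounded_iff imageI)
  have bnd: "norm (h z) \<le> B" if z: "z \<noteq> 0" for z
  proof -
    obtain m where "norm p \<le> norm (p powi m * z)" "norm (p powi m * z) \<le> 1"
      using annulus_representative[OF z] by blast
    then have "norm (h (p powi m * z)) \<le> B" by (intro B[rule_format]) simp
    then show ?thesis using inv_int[OF z] by simp
  qed
  have "(\<lambda>w. h (exp w)) holomorphic_on UNIV"
    by (rule holomorphic_on_compose_gen[OF holomorphic_on_exp hol, unfolded o_def]) auto
  moreover have "bounded (range (\<lambda>w. h (exp w)))" using bnd by (auto simp: bounded_iff intro!: exI[of _ B])
  ultimately have "(\<lambda>w. h (exp w)) constant_on UNIV" by (rule Liouville_theorem)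
  then have "h (exp (Ln x)) = h (exp (Ln y))" unfolding constant_on_def by auto
  then show ?thesis using assms by simp
qed

text \<open>The quotient of \<open>f\<close> and \<open>g\<close> is invariant under
  multiplication by \<open>p\<close>, because the multipliers cancel, and it has only removable
  singularities, because the zeros of \<open>g\<close> are simple and \<open>f\<close> vanishes
  there. So it is constant.\<close>

lemma proportional_if_vanishing:
  assumes f: "f holomorphic_on (- {0})" and g: "g holomorphic_on (- {0})"
    and fp: "\<And>x. x \<noteq> 0 \<Longrightarrow> f (p * x) = M x * f x"
    and gp: "\<And>x. x \<noteq> 0 \<Longrightarrow> g (p * x) = M x * g x"
    and M: "\<And>x. x \<noteq> 0 \<Longrightarrow> M x \<noteq> 0"
    and zeros: "\<And>x. x \<noteq> 0 \<Longrightarrow> g x = 0 \<Longrightarrow> f x = 0 \<and> deriv g x \<noteq> 0"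
  shows "\<exists>C. \<forall>x. x \<noteq> 0 \<longrightarrow> f x = C * g x"
proof -
  \<comment> \<open>The quotient, extended to the zeros of \<open>g\<close> by de l'Hospital's
    rule.\<close>
  define h where "h x = (if g x = 0 then deriv f x / deriv g x else f x / g x)" for x
  have Df: "(f has_field_derivative deriv f x) (at x)" and Dg: "(g has_field_derivative deriv g x) (at x)"
    if "x \<noteq> 0" for x
    using that by (auto intro!: holomorphic_derivI[OF f] holomorphic_derivI[OF g])
  have lim: "(\<lambda>y. f y / g y) \<midarrow>x\<rightarrow> h x" if x: "x \<noteq> 0" for x
  proof (cases "g x = 0")
    case True
    show ?thesis
      by (rule lhopital_complex_simple[OF Df[OF x] Dg[OF x]]) (use zeros[OF x True] True in \<open>auto simp: h_def\<close>)
  next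
    case False
    have "isCont (\<lambda>y. f y / g y) x"
      using DERIV_isCont[OF Df[OF x]] DERIV_isCont[OF Dg[OF x]] False by (intro continuous_intros)
    then show ?thesis using False by (simp add: h_def isCont_def)
  qed
  have ev: "eventually (\<lambda>y. g y \<noteq> 0 \<and> y \<noteq> 0) (at x)" if x: "x \<noteq> 0" for x
  proof -
    have "\<exists>b. b \<noteq> 0 \<and> g b \<noteq> 0"
    proof (rule ccontr)
      assume "\<not> ?thesis"
      then have z: "g y = 0" if "y \<noteq> 0" for y using that by blast
      then have "deriv g x \<noteq> 0" using zeros x by blast
      moreover have "(g has_field_derivative 0) (at x)"
      proof (rule DERIV_cong_ev[OF refl _ refl, THEN iffD2])
        show "\<forall>\<^sub>F y in nhds x. g y = 0"
          using t1_space_nhds[OF x] by (auto elim!: eventually_mono simp: z)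
      qed simp
      ultimately show False using Dg[OF x] DERIV_unique by blast
    qed
    then obtain b where "b \<noteq> 0" "g b \<noteq> 0" by blast
    then show ?thesis
      using non_zero_neighbour_alt[OF g _ connected_punctured _ _ \<open>g b \<noteq> 0\<close>, of x] x by auto
  qed
  have h_near: "h \<midarrow>x\<rightarrow> h x" if x: "x \<noteq> 0" for x
  proof (rule Lim_transform_eventually[OF lim[OF x]])
    show "\<forall>\<^sub>F y in at x. f y / g y = h y" using ev[OF x] by eventually_elim (simp add: h_def)
  qed
  have h_diff: "h field_differentiable (at x)" if x: "x \<noteq> 0" for x
  proof -
    from ev[OF x] obtain r where "r > 0" "\<forall>y. y \<noteq> x \<and> dist y x < r \<longrightarrow> g y \<noteq> 0 \<and> y \<noteq> 0"
      unfolding eventually_at by auto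
    then have r: "r > 0" "\<And>y. y \<in> ball x r - {x} \<Longrightarrow> g y \<noteq> 0 \<and> y \<noteq> 0"
      by (auto simp: dist_commute)
    have "h holomorphic_on ball x r"
    proof (rule no_isolated_singularity'[where K = "{x}"])
      show "(h \<longlongrightarrow> h z) (at z within ball x r)" if "z \<in> {x}" for z
        using that h_near[OF x] tendsto_within_subset by (metis singletonD subset_UNIV)
      have "(\<lambda>y. f y / g y) holomorphic_on (ball x r - {x})"
        by (intro holomorphic_intros holomorphic_on_subset[OF f] holomorphic_on_subset[OF g])
          (use r r(2)[of 0] x in auto)
      then show "h holomorphic_on ball x r - {x}"
        by (rule holomorphic_transform) (use r in \<open>auto simp: h_def\<close>)
    qed auto
    then show ?thesis using r(1) by (simp add: holomorphic_on_imp_differentiable_at)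
  qed
  have hol: "h holomorphic_on (- {0})"
    using h_diff by (auto simp: holomorphic_on_def intro: field_differentiable_at_within)
  have inv: "h (p * x) = h x" if x: "x \<noteq> 0" for x
  proof (rule tendsto_unique[of "at x"])
    have "isCont h (p * x)" using h_near[of "p * x"] p_nz x by (simp add: isCont_def)
    then have "isCont (\<lambda>y. h (p * y)) x"
      by (intro isCont_o2[where f = "\<lambda>y. p * y" and g = h and a = x] continuous_intros)
    then show "((\<lambda>y. h (p * y)) \<longlongrightarrow> h (p * x)) (at x)" by (simp add: isCont_def)
    show "((\<lambda>y. h (p * y)) \<longlongrightarrow> h x) (at x)"
    proof (rule Lim_transform_eventually[OF h_near[OF x]])
      show "\<forall>\<^sub>F y in at x. h y = h (p * y)" using ev[OF x]
        by eventually_elim (simp add: h_def fp gp M)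
    qed
  qed simp
  show ?thesis
  proof (intro exI allI impI)
    fix x :: complex assume x: "x \<noteq> 0"
    have "h x = h 1" by (rule invariant_holomorphic_constant[OF hol inv x]) auto
    then show "f x = h 1 * g x"
      using zeros[OF x] unfolding h_def[of x] by (cases "g x = 0") (auto simp: field_simps)
  qed
qed

lemma theta_simple_zero_compose:
  assumes "x \<noteq> 0" "c \<noteq> 0" "theta p (x * c) = 0"
    and G: "(G has_field_derivative G') (at x)" "G x \<noteq> 0"
  shows "deriv (\<lambda>y. theta p (y * c) * G y) x \<noteq> 0"
proof -
  have D: "(theta p has_field_derivative deriv (theta p) (x * c)) (at (x * c))"
    by (rule holomorphic_derivI[OF theta_holomorphic]) (use assms in auto)
  have "((\<lambda>y. theta p (y * c)) has_field_derivative (deriv (theta p) (x * c) * c)) (at x)"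
    by (rule DERIV_chain2[where f = "theta p" and g = "\<lambda>y. y * c", OF D]) (auto intro!: derivative_eq_intros)
  from DERIV_mult[OF this G(1)] assms
  have "((\<lambda>y. theta p (y * c) * G y) has_field_derivative (deriv (theta p) (x * c) * c * G x)) (at x)"
    by simp
  then show ?thesis using theta_deriv_nonzero[of "x * c"] assms by (simp add: DERIV_imp_deriv)
qed

text \<open>The building block of the addition formula. As a function of \<open>x\<close> it is
  a theta function of degree two, which has the zeros \<open>y\<close> and \<open>1 / y\<close>
  up to powers of \<open>p\<close>.\<close>

definition theta2 :: "complex \<Rightarrow> complex \<Rightarrow> complex" where
  "theta2 x y = theta p (x * y) * theta p (x / y)"

lemma theta2_same [simp]: "x \<noteq> 0 \<Longrightarrow> theta2 x x = 0"
  by (simp add: theta2_def)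

lemma theta2_swap: "x \<noteq> 0 \<Longrightarrow> y \<noteq> 0 \<Longrightarrow> theta2 y x = - (y / x) * theta2 x y"
  using theta_swap[of y x] by (simp add: theta2_def mult_ac)

lemma theta2_p_mult:
  assumes "x \<noteq> 0" "y \<noteq> 0"
  shows "theta2 (p * x) y = 1 / x\<^sup>2 * theta2 x y"
proof -
  have "theta2 (p * x) y = theta p (p * (x * y)) * theta p (p * (x / y))"
    by (simp add: theta2_def mult_ac)
  also have "\<dots> = 1 / x\<^sup>2 * theta2 x y"
    using assms by (subst theta_p_mult, simp)+ (simp add: theta2_def power2_eq_square)
  finally show ?thesis .
qed

lemma theta2_inverse:
  assumes "x \<noteq> 0" "y \<noteq> 0"
  shows "theta2 (1 / x) y = 1 / x\<^sup>2 * theta2 x y"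
proof -
  have "theta2 (1 / x) y = theta p (1 / (x / y)) * theta p (1 / (x * y))"
    by (simp add: theta2_def)
  also have "\<dots> = 1 / x\<^sup>2 * theta2 x y"
    using assms by (subst theta_inverse, simp)+ (simp add: theta2_def power2_eq_square)
  finally show ?thesis .
qed

lemma theta2_holomorphic:
  "y \<noteq> 0 \<Longrightarrow> (\<lambda>x. theta2 x y) holomorphic_on (- {0})"
  unfolding theta2_def by (intro holomorphic_intros) auto

text \<open>The difference of both sides is a theta function of degree two in \<open>x\<close>
  that vanishes at \<open>v\<close> and \<open>1 / v\<close>. If these are different modulo
  powers of \<open>p\<close>, it is a multiple of \<open>theta2 x v\<close>, and as it also
  vanishes at \<open>x = u\<close>, the factor is 0.\<close>

lemma Weierstrass_addition_generic:
  assumes nz: "x \<noteq> 0" "y \<noteq> 0" "u \<noteq> 0" "v \<noteq> 0"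
    and gen: "theta p (v * v) \<noteq> 0" "theta2 u v \<noteq> 0"
  shows "theta2 x y * theta2 u v - theta2 x v * theta2 u y = (u / y) * theta2 y v * theta2 x u"
proof -
  define E where "E x = theta2 x y * theta2 u v - theta2 x v * theta2 u y
      - (u / y) * theta2 y v * theta2 x u" for x
  have E_hol: "E holomorphic_on (- {0})"
    unfolding E_def[abs_def] by (intro holomorphic_intros theta2_holomorphic nz)
  have E_p: "E (p * x) = 1 / x\<^sup>2 * E x" if "x \<noteq> 0" for x
    using that nz by (simp add: E_def theta2_p_mult algebra_simps)
  have E_inv: "E (1 / x) = 1 / x\<^sup>2 * E x" if "x \<noteq> 0" for x
    using that nz by (simp add: E_def theta2_inverse algebra_simps)
  have E_v: "E v = 0"
    using nz by (simp add: E_def theta2_swap[of u v] theta2_swap[of y v])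
  then have E_v': "E (1 / v) = 0" using E_inv nz by simp
  have E_int: "E (p powi m * x) = 0" if "x \<noteq> 0" "E x = 0" for m x
  proof (induction m rule: int_induct[where k = 0])
    case (step1 i)
    then show ?case using E_p[of "p powi i * x"] p_nz that
      by (simp add: power_int_add_1 mult_ac)
  next
    case (step2 i)
    then show ?case using E_p[of "p powi (i - 1) * x"] p_nz that power_int_add_1[of p "i - 1"]
      by (simp add: mult_ac)
  qed (use that in simp)
  have zeros: "E x = 0 \<and> deriv (\<lambda>x. theta2 x v) x \<noteq> 0" if x: "x \<noteq> 0" "theta2 x v = 0" for x
  proof -
    have D: "((\<lambda>y. theta p (y * c)) has_field_derivative deriv (\<lambda>y. theta p (y * c)) x) (at x)"
      if "c \<noteq> 0" for c
      by (rule holomorphic_derivI[of _ "- {0}"]) (use x that in \<open>auto intro!: holomorphic_intros\<close>)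
    from x(2) consider "theta p (x * v) = 0" | "theta p (x * (1 / v)) = 0" by (auto simp: theta2_def)
    then show ?thesis
    proof cases
      case 1
      then obtain m where m: "x * v = p powi m" using theta_eq_0_iff x nz by auto
      then have xm: "x = p powi m * (1 / v)" using nz by (simp add: field_simps)
      have "theta p (x * (1 / v)) \<noteq> 0"
      proof
        assume "theta p (x * (1 / v)) = 0"
        then obtain k where k: "x * (1 / v) = p powi k" using theta_eq_0_iff x nz by auto
        have "v * v = (x * v) / (x * (1 / v))" using x nz by simp
        also have "\<dots> = p powi (m - k)"
          using p_nz by (simp only: m k) (simp add: power_int_diff)
        finally have "\<exists>n. v * v = p powi n" ..
        then show False using gen(1) theta_eq_0_iff[of "v * v"] nz by (metis mult_eq_0_iff)
      qed
      then have "deriv (\<lambda>y. theta p (y * v) * theta p (y * (1 / v))) x \<noteq> 0"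
        by (intro theta_simple_zero_compose[OF x(1) nz(4) 1 D]) (use nz in auto)
      moreover have "E x = 0" unfolding xm by (rule E_int) (use nz E_v' in auto)
      ultimately show ?thesis by (simp add: theta2_def)
    next
      case 2
      then obtain m where m: "x * (1 / v) = p powi m" using theta_eq_0_iff[of "x * (1 / v)"] x nz by auto
      then have xm: "x = p powi m * v" using nz by (simp add: field_simps)
      have "theta p (x * v) \<noteq> 0"
      proof
        assume "theta p (x * v) = 0"
        then obtain k where k: "x * v = p powi k" using theta_eq_0_iff x nz by auto
        have "v * v = (x * v) / (x * (1 / v))" using x nz by simp
        also have "\<dots> = p powi (k - m)"
          using p_nz by (simp only: m k) (simp add: power_int_diff)
        finally have "\<exists>n. v * v = p powi n" ..
        then show False using gen(1) theta_eq_0_iff[of "v * v"] nz by (metis mult_eq_0_iff)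
      qed
      then have "deriv (\<lambda>y. theta p (y * (1 / v)) * theta p (y * v)) x \<noteq> 0"
        by (intro theta_simple_zero_compose[OF x(1) _ 2 D]) (use nz in auto)
      moreover have "E x = 0" unfolding xm by (rule E_int) (use nz E_v in auto)
      ultimately show ?thesis by (simp add: theta2_def mult.commute)
    qed
  qed
  obtain C where C: "\<And>x. x \<noteq> 0 \<Longrightarrow> E x = C * theta2 x v"
    using proportional_if_vanishing[OF E_hol theta2_holomorphic[OF nz(4)] E_p _ _ zeros]
    using theta2_p_mult nz by fastforce
  have "E u = 0" using nz by (simp add: E_def)
  then have "C = 0" using C[OF nz(3)] gen(2) by simp
  then show ?thesis using C[OF nz(1)] by (simp add: E_def)
qed

lemma theta_eventually_nonzero_compose:
  assumes "isCont f x" "f x \<noteq> 0" "\<And>y. y \<noteq> x \<Longrightarrow> y \<noteq> 0 \<Longrightarrow> norm (y - x) < e \<Longrightarrow> f y \<noteq> f x" "e > 0" "x \<noteq> 0"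
  shows "eventually (\<lambda>y. theta p (f y) \<noteq> 0) (at x)"
proof -
  have "filterlim f (at (f x)) (at x)"
    unfolding filterlim_at
  proof
    have "\<forall>\<^sub>F y in at x. y \<noteq> 0" by (rule eventually_neq_at_within)
    moreover have "\<forall>\<^sub>F y in at x. norm (y - x) < e" using assms(4)
      by (auto simp: eventually_at dist_norm)
    moreover have "\<forall>\<^sub>F y in at x. y \<noteq> x" by (rule eventually_neq_at_within)
    ultimately show "\<forall>\<^sub>F y in at x. f y \<in> UNIV \<and> f y \<noteq> f x"
      by eventually_elim (use assms(3) in auto)
    show "f \<midarrow>x\<rightarrow> f x" using assms(1) by (simp add: isCont_def)
  qed
  from eventually_compose_filterlim[OF theta_eventually_nonzero[OF assms(2)] this]
  show ?thesis by eventually_elim simp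
qed

text \<open>Both sides are continuous in \<open>v\<close>, so the genericity conditions on
  \<open>v\<close> can be removed by passing to a limit.\<close>

lemma Weierstrass_addition:
  assumes nz: "x \<noteq> 0" "y \<noteq> 0" "u \<noteq> 0" "v \<noteq> 0"
  shows "theta2 x y * theta2 u v - theta2 x v * theta2 u y = (u / y) * theta2 y v * theta2 x u"
proof -
  define F where "F w = theta2 x y * theta2 u w - theta2 x w * theta2 u y - (u / y) * theta2 y w * theta2 x u" for w
  have "isCont F v"
    unfolding F_def[abs_def] theta2_def by (intro continuous_intros) (use nz in auto)
  then have "F \<midarrow>v\<rightarrow> F v" by (simp add: isCont_def)
  moreover have "F \<midarrow>v\<rightarrow> 0"
  proof (rule Lim_transform_eventually[OF tendsto_const])
    have "\<forall>\<^sub>F w in at v. theta p (w * w) \<noteq> 0"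
    proof (rule theta_eventually_nonzero_compose[where e = "norm v"])
      show "w * w \<noteq> v * v" if "w \<noteq> v" "norm (w - v) < norm v" for w
      proof
        assume "w * w = v * v"
        then have "w = - v" using that(1) by (simp add: square_eq_iff)
        then have "norm (w - v) = 2 * norm v" by (metis minus_diff_eq mult_2 norm_minus_cancel
            norm_mult norm_numeral diff_minus_eq_add add.commute)
        then show False using that(2) nz by simp
      qed
    qed (use nz in \<open>auto intro!: continuous_intros\<close>)
    moreover have "\<forall>\<^sub>F w in at v. theta p (u * w) \<noteq> 0"
      by (rule theta_eventually_nonzero_compose[where e = 1]) (use nz in \<open>auto intro!: continuous_intros\<close>)
    moreover have "\<forall>\<^sub>F w in at v. theta p (u / w) \<noteq> 0"
      by (rule theta_eventually_nonzero_compose[where e = 1]) (use nz in \<open>auto intro!: continuous_intros\<close>)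
    moreover have "\<forall>\<^sub>F w in at v. w \<noteq> 0"
      using nz by (intro eventually_neq_at_within)
    ultimately show "\<forall>\<^sub>F w in at v. 0 = F w"
    proof eventually_elim
      case (elim w)
      show ?case using Weierstrass_addition_generic[of x y u w] nz elim
        by (simp add: F_def theta2_def)
    qed
  qed
  ultimately have "F v = 0" using tendsto_unique trivial_limit_at by blast
  then show ?thesis by (simp add: F_def)
qed

section \<open>Elliptic partial fractions\<close>

text \<open>For fixed \<open>P\<close> the products \<open>\<theta>(z / b) \<theta>(z b /
  P)\<close> span, for varying \<open>b\<close>, a space of dimension two; the values \<open>b =
  z1\<close> and \<open>b = z2\<close> give a basis unless the factor on the left vanishes. The
  coefficients do not depend on \<open>z\<close>. This is the addition formula after scaling all
  the variables by a square root of \<open>P\<close>.\<close>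

lemma theta_three_term:
  assumes nz: "P \<noteq> 0" "b \<noteq> 0" "z1 \<noteq> 0" "z2 \<noteq> 0"
  shows "\<exists>\<alpha> \<mu>. \<forall>z. z \<noteq> 0 \<longrightarrow>
    theta p (z1 / z2) * theta p (z1 * z2 / P) * (theta p (z / b) * theta p (z * b / P)) =
    \<alpha> * (theta p (z / z1) * theta p (z * z1 / P)) + \<mu> * (theta p (z / z2) * theta p (z * z2 / P))"
proof -
  \<comment> \<open>After division by \<open>\<rho>\<close> the products in question are values
    of \<open>theta2\<close>.\<close>
  define \<rho> where "\<rho> = csqrt P"
  have \<rho>: "\<rho> * \<rho> = P" "\<rho> \<noteq> 0" using nz by (auto simp: \<rho>_def simp flip: power2_eq_square)
  have F: "theta2 (x / \<rho>) (y / \<rho>) = theta p (x / y) * theta p (x * y / P)" for x y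
    using \<rho>(2) by (simp add: theta2_def flip: \<rho>(1))
  show ?thesis
  proof (intro exI allI impI)
    fix z :: complex assume "z \<noteq> 0"
    then show "theta p (z1 / z2) * theta p (z1 * z2 / P) * (theta p (z / b) * theta p (z * b / P)) =
      (z1 / b * theta2 (b / \<rho>) (z2 / \<rho>)) * (theta p (z / z1) * theta p (z * z1 / P))
      + theta2 (z1 / \<rho>) (b / \<rho>) * (theta p (z / z2) * theta p (z * z2 / P))"
      using Weierstrass_addition[of "z / \<rho>" "b / \<rho>" "z1 / \<rho>" "z2 / \<rho>"] nz \<rho>(2)
      by (simp add: F algebra_simps)
  qed
qed

definition partial_fraction_sum :: "('i \<Rightarrow> complex) \<Rightarrow> 'i set \<Rightarrow> ('i \<Rightarrow> complex) \<Rightarrow> complex" where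
  "partial_fraction_sum z I b =
     (\<Sum>i\<in>I. (\<Prod>j\<in>I. theta p (z i / b j)) / (\<Prod>j\<in>I - {i}. theta p (z i / z j)))"

text \<open>For two points the balancing condition makes the two summands opposite to each
  other.\<close>

lemma partial_fraction_sum_pair:
  assumes "k \<noteq> l" and nz: "z k \<noteq> 0" "z l \<noteq> 0" "b k \<noteq> 0" "b l \<noteq> 0"
    and dist: "theta p (z k / z l) \<noteq> 0" and P: "z k * z l = b k * b l"
  shows "partial_fraction_sum z {k, l} b = 0"
proof -
  have bl: "b l = z k * z l / b k" using P nz by (simp add: field_simps)
  have 1: "z k / b l = b k / z l" "z l / b l = b k / z k" using nz by (simp_all add: bl)
  have 2: "theta p (b k / z l) = - (b k / z l) * theta p (z l / b k)"
    "theta p (b k / z k) = - (b k / z k) * theta p (z k / b k)"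
    "theta p (z l / z k) = - (z l / z k) * theta p (z k / z l)"
    by (intro theta_swap nz)+
  have "{k, l} - {k} = {l}" "{k, l} - {l} = {k}" using assms(1) by auto
  then show ?thesis
    using assms(1) nz dist by (simp add: partial_fraction_sum_def 1 2)
qed

text \<open>If one of the parameters \<open>b\<close> is equal to the point \<open>z m\<close>,
  then the summand of \<open>m\<close> vanishes and the factor \<open>\<theta>(z i / z
  m)\<close> cancels in the others: what remains is a sum with one point less.\<close>

lemma partial_fraction_sum_remove:
  assumes fin: "finite I" and mo: "m \<in> I" "o' \<in> I" "m \<noteq> o'"
    and nz: "\<And>i. i \<in> I \<Longrightarrow> z i \<noteq> 0"
    and dist: "\<And>i j. i \<in> I \<Longrightarrow> j \<in> I \<Longrightarrow> i \<noteq> j \<Longrightarrow> theta p (z i / z j) \<noteq> 0"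
  shows "(\<Sum>i\<in>I. (\<Prod>j\<in>I - {m, o'}. theta p (z i / b j)) / (\<Prod>j\<in>I - {i}. theta p (z i / z j))
             * (theta p (z i / z m) * theta p (z i * z m / P)))
       = partial_fraction_sum z (I - {m}) (b(o' := P / z m))"
proof -
  have "(\<Sum>i\<in>I. (\<Prod>j\<in>I - {m, o'}. theta p (z i / b j)) / (\<Prod>j\<in>I - {i}. theta p (z i / z j))
             * (theta p (z i / z m) * theta p (z i * z m / P)))
     = (\<Sum>i\<in>I - {m}. (\<Prod>j\<in>I - {m, o'}. theta p (z i / b j)) / (\<Prod>j\<in>I - {i}. theta p (z i / z j))
             * (theta p (z i / z m) * theta p (z i * z m / P)))"
    using fin mo nz by (subst sum.remove[of I m]) auto
  also have "\<dots> = partial_fraction_sum z (I - {m}) (b(o' := P / z m))"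
    unfolding partial_fraction_sum_def
  proof (rule sum.cong[OF refl])
    fix i assume i: "i \<in> I - {m}"
    have "(\<Prod>j\<in>I - {i}. theta p (z i / z j)) = theta p (z i / z m) * (\<Prod>j\<in>I - {i} - {m}. theta p (z i / z j))"
      using fin mo i by (subst prod.remove[of _ m]) auto
    moreover have "I - {i} - {m} = I - {m} - {i}" by auto
    moreover have "theta p (z i / z m) \<noteq> 0" using dist i mo by auto
    moreover have "(\<Prod>j\<in>I - {m}. theta p (z i / (b(o' := P / z m)) j)) =
        theta p (z i * z m / P) * (\<Prod>j\<in>I - {m, o'}. theta p (z i / b j))"
    proof -
      have "I - {m} - {o'} = I - {m, o'}" by auto
      then show ?thesis using fin mo by (subst prod.remove[of _ o']) auto
    qed
    ultimately show "(\<Prod>j\<in>I - {m, o'}. theta p (z i / b j)) / (\<Prod>j\<in>I - {i}. theta p (z i / z j))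
             * (theta p (z i / z m) * theta p (z i * z m / P)) =
          (\<Prod>j\<in>I - {m}. theta p (z i / (b(o' := P / z m)) j)) / (\<Prod>j\<in>I - {m} - {i}. theta p (z i / z j))"
      by simp
  qed
  finally show ?thesis .
qed

text \<open>With \<open>P = b k * b l\<close> held fixed, the sum is linear in the products
  \<open>\<theta>(z i / b k) \<theta>(z i b k / P)\<close>. So it is a linear combination of its
  values at \<open>b k = z k\<close> and \<open>b k = z l\<close>, which are sums with one point
  less.\<close>

lemma partial_fraction_sum_step:
  assumes fin: "finite I" and kl: "k \<in> I" "l \<in> I" "k \<noteq> l"
    and nz: "\<And>i. i \<in> I \<Longrightarrow> z i \<noteq> 0" "\<And>i. i \<in> I \<Longrightarrow> b i \<noteq> 0"
    and dist: "\<And>i j. i \<in> I \<Longrightarrow> j \<in> I \<Longrightarrow> i \<noteq> j \<Longrightarrow> theta p (z i / z j) \<noteq> 0"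
    and gen: "theta p (z k * z l / (b k * b l)) \<noteq> 0"
    and IH: "partial_fraction_sum z (I - {k}) (b(l := b k * b l / z k)) = 0"
      "partial_fraction_sum z (I - {l}) (b(k := b k * b l / z l)) = 0"
  shows "partial_fraction_sum z I b = 0"
proof -
  define P where "P = b k * b l"
  have P: "P \<noteq> 0" using nz kl by (simp add: P_def)
  define A where "A i = (\<Prod>j\<in>I - {k, l}. theta p (z i / b j)) / (\<Prod>j\<in>I - {i}. theta p (z i / z j))" for i
  define D where "D = theta p (z k / z l) * theta p (z k * z l / P)"
  have D: "D \<noteq> 0" using gen dist kl by (simp add: D_def P_def)
  obtain \<alpha> \<mu> where lin: "\<And>x. x \<noteq> 0 \<Longrightarrow> D * (theta p (x / b k) * theta p (x * b k / P)) =
    \<alpha> * (theta p (x / z k) * theta p (x * z k / P)) + \<mu> * (theta p (x / z l) * theta p (x * z l / P))"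
    using theta_three_term[of P "b k" "z k" "z l"] P nz kl unfolding D_def by blast
  have "partial_fraction_sum z I b = (\<Sum>i\<in>I. A i * (theta p (z i / b k) * theta p (z i * b k / P)))"
    unfolding partial_fraction_sum_def
  proof (rule sum.cong[OF refl])
    fix i assume "i \<in> I"
    have "I - {k} - {l} = I - {k, l}" by auto
    then have "(\<Prod>j\<in>I. theta p (z i / b j)) =
        theta p (z i / b k) * (theta p (z i / b l) * (\<Prod>j\<in>I - {k, l}. theta p (z i / b j)))"
      using fin kl by (subst prod.remove[of _ k], simp, simp, subst prod.remove[of _ l]) auto
    moreover have "z i * b k / P = z i / b l" using nz kl by (simp add: P_def)
    ultimately show "(\<Prod>j\<in>I. theta p (z i / b j)) / (\<Prod>j\<in>I - {i}. theta p (z i / z j)) =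
        A i * (theta p (z i / b k) * theta p (z i * b k / P))"
      by (simp add: A_def)
  qed
  then have "D * partial_fraction_sum z I b =
      (\<Sum>i\<in>I. A i * (D * (theta p (z i / b k) * theta p (z i * b k / P))))"
    by (simp add: sum_distrib_left mult_ac)
  also have "\<dots> = (\<Sum>i\<in>I. \<alpha> * (A i * (theta p (z i / z k) * theta p (z i * z k / P)))
        + \<mu> * (A i * (theta p (z i / z l) * theta p (z i * z l / P))))"
  proof (rule sum.cong[OF refl])
    fix i assume "i \<in> I"
    from lin[OF nz(1)[OF this]]
    show "A i * (D * (theta p (z i / b k) * theta p (z i * b k / P))) =
        \<alpha> * (A i * (theta p (z i / z k) * theta p (z i * z k / P)))
        + \<mu> * (A i * (theta p (z i / z l) * theta p (z i * z l / P)))"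
      by (simp add: algebra_simps)
  qed
  also have "\<dots> = \<alpha> * (\<Sum>i\<in>I. A i * (theta p (z i / z k) * theta p (z i * z k / P)))
        + \<mu> * (\<Sum>i\<in>I. A i * (theta p (z i / z l) * theta p (z i * z l / P)))"
    by (simp only: sum.distrib sum_distrib_left)
  also have "(\<Sum>i\<in>I. A i * (theta p (z i / z k) * theta p (z i * z k / P))) = 0"
    using partial_fraction_sum_remove[where z = z, OF fin kl nz(1) dist, where b = b and P = P] IH(1)
    by (simp add: A_def P_def)
  also have "(\<Sum>i\<in>I. A i * (theta p (z i / z l) * theta p (z i * z l / P))) = 0"
    using partial_fraction_sum_remove[where z = z, OF fin kl(2,1) kl(3)[symmetric] nz(1) dist, where b = b and P = P] IH(2)
    by (simp add: A_def P_def insert_commute)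
  finally show ?thesis using D by simp
qed

text \<open>Induction on the number of points. The reduction to fewer points requires that a
  certain theta value does not vanish; with at least three points, this can be achieved by a
  small perturbation of two of the parameters, and the general case is a limit.\<close>

theorem theta_partial_fractions:
  assumes "finite I"
    and "\<And>i. i \<in> I \<Longrightarrow> z i \<noteq> 0" "\<And>i. i \<in> I \<Longrightarrow> b i \<noteq> 0"
    and "\<And>i j. i \<in> I \<Longrightarrow> j \<in> I \<Longrightarrow> i \<noteq> j \<Longrightarrow> theta p (z i / z j) \<noteq> 0"
    and "prod z I = prod b I"
  shows "partial_fraction_sum z I b = 0"
  using assms
proof (induction "card I" arbitrary: I b rule: less_induct)
  case less
  note fin = less.prems(1) and nz = less.prems(2,3) and dist = less.prems(4) and bal = less.prems(5)
  consider "I = {}" | k where "I = {k}" | k l where "k \<noteq> l" "I = {k, l}"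
    | k l m where "k \<in> I" "l \<in> I" "m \<in> I" "k \<noteq> l" "k \<noteq> m" "l \<noteq> m"
  proof (cases "I = {} \<or> (\<exists>k. I = {k}) \<or> (\<exists>k l. k \<noteq> l \<and> I = {k, l})")
    case True
    then show thesis using that(1-3) by blast
  next
    case False
    then obtain k where k: "k \<in> I" by blast
    then obtain l where l: "l \<in> I" "k \<noteq> l" using False by blast
    then obtain m where "m \<in> I" "k \<noteq> m" "l \<noteq> m" using False k by blast
    then show thesis using that(4) k l by blast
  qed
  then show ?case
  proof cases
    case 1
    then show ?thesis by (simp add: partial_fraction_sum_def)
  next
    case (2 k)
    then show ?thesis using bal nz by (simp add: partial_fraction_sum_def)
  next
    case (3 k l)
    then show ?thesis using bal nz dist by (auto intro!: partial_fraction_sum_pair)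
  next
    case (4 k l m)
    have generic: "partial_fraction_sum z I c = 0"
      if c: "\<And>i. i \<in> I \<Longrightarrow> c i \<noteq> 0" "prod z I = prod c I" "theta p (z k * z l / (c k * c l)) \<noteq> 0" for c
    proof -
      have sub: "partial_fraction_sum z (I - {x}) (c(y := c x * c y / z x)) = 0"
        if xy: "x \<in> I" "y \<in> I" "x \<noteq> y" for x y
      proof (rule less.hyps)
        show "card (I - {x}) < card I" by (rule card_Diff1_less[OF fin xy(1)])
        have "prod (c(y := c x * c y / z x)) (I - {x}) = c x * c y / z x * prod c (I - {x} - {y})"
          using fin xy by (subst prod.remove[of _ y]) (auto intro!: prod.cong)
        also have "c y * prod c (I - {x} - {y}) = prod c (I - {x})"
          using fin xy by (subst prod.remove[of "I - {x}" y]) auto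
        then have "c x * c y / z x * prod c (I - {x} - {y}) = c x * prod c (I - {x}) / z x"
          by (metis (no_types, lifting) mult.assoc times_divide_eq_left)
        also have "\<dots> = prod z I / z x" using fin xy c(2) by (simp add: prod.remove[of I x])
        also have "\<dots> = prod z (I - {x})" using fin xy nz(1) by (simp add: prod.remove[of I x])
        finally show "prod z (I - {x}) = prod (c(y := c x * c y / z x)) (I - {x})" ..
      qed (use fin nz c(1) dist xy in \<open>auto\<close>)
      show ?thesis
        by (rule partial_fraction_sum_step[OF fin 4(1,2,4) nz(1) c(1) dist c(3)])
          (use sub[of k l] sub[of l k] 4 in \<open>auto simp: mult.commute\<close>)
    qed
    \<comment> \<open>The perturbation keeps the product of the parameters but changes \<open>b
      k * b l\<close>.\<close>
    define c where "c t = b(k := b k * t, m := b m / t)" for t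
    have nz4: "b k \<noteq> 0" "b l \<noteq> 0" "b m \<noteq> 0" "z k \<noteq> 0" "z l \<noteq> 0" using nz 4 by auto
    have c1: "c 1 = b" by (auto simp: c_def)
    have "isCont (\<lambda>t. partial_fraction_sum z I (c t)) 1"
    proof -
      have cont: "isCont (\<lambda>t. c t j) 1" for j
        unfolding c_def by (cases "j = k"; cases "j = m") (auto intro!: continuous_intros)
      have "c 1 j \<noteq> 0" if "j \<in> I" for j using that nz by (simp add: c1)
      moreover have "(\<Prod>j\<in>I - {i}. theta p (z i / z j)) \<noteq> 0" if "i \<in> I" for i
        using fin dist that by (auto simp: prod_zero_iff)
      ultimately show ?thesis
        unfolding partial_fraction_sum_def using nz
        by (intro continuous_intros cont) auto
    qed
    then have "(\<lambda>t. partial_fraction_sum z I (c t)) \<midarrow>1\<rightarrow> partial_fraction_sum z I b"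
      by (simp add: isCont_def c1)
    moreover have "(\<lambda>t. partial_fraction_sum z I (c t)) \<midarrow>1\<rightarrow> 0"
    proof (rule Lim_transform_eventually[OF tendsto_const])
      have "\<forall>\<^sub>F t in at 1. theta p (z k * z l / (b k * t * b l)) \<noteq> 0"
        by (rule theta_eventually_nonzero_compose[where e = 1]) (use nz4 in \<open>auto intro!: continuous_intros\<close>)
      moreover have "\<forall>\<^sub>F t in at 1. t \<noteq> (0 :: complex)"
        by (rule eventually_neq_at_within)
      ultimately show "\<forall>\<^sub>F t in at 1. 0 = partial_fraction_sum z I (c t)"
      proof eventually_elim
        case (elim t)
        have "partial_fraction_sum z I (c t) = 0"
        proof (rule generic)
          have "I - {k} - {m} = I - {m} - {k}" by auto
          then have "prod (c t) I = c t k * (c t m * prod (c t) (I - {k} - {m}))"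
            using fin 4 by (subst prod.remove[of _ k], simp, simp, subst prod.remove[of _ m]) auto
          also have "prod (c t) (I - {k} - {m}) = prod b (I - {k} - {m})"
            by (intro prod.cong) (auto simp: c_def)
          also have "c t k * (c t m * prod b (I - {k} - {m})) = b k * (b m * prod b (I - {k} - {m}))"
            using elim 4 by (simp add: c_def)
          also have "\<dots> = prod b I"
            using fin 4 by (subst (2) prod.remove[of _ k], simp, simp, subst (2) prod.remove[of _ m]) auto
          finally show "prod z I = prod (c t) I" using bal by simp
          show "theta p (z k * z l / (c t k * c t l)) \<noteq> 0" using elim 4 by (simp add: c_def)
          show "c t i \<noteq> 0" if "i \<in> I" for i using nz that elim 4 by (simp add: c_def)
        qed
        then show ?case by simp
      qed
    qed
    ultimately show ?thesis using tendsto_unique trivial_limit_at by blast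
  qed
qed

text \<open>The identity behind the recursion of the multinomial coefficients, in the form of
  weights that add up to 1. It is the partial fraction identity for the points \<open>y
  i\<close> together with one further point; the summand of the further point yields the
  right-hand side.\<close>

corollary theta_weights_sum:
  assumes fin: "finite I" and nz: "\<And>i. i \<in> I \<Longrightarrow> y i \<noteq> 0" "\<And>i. i \<in> I \<Longrightarrow> c i \<noteq> 0"
    and dist: "\<And>i j. i \<in> I \<Longrightarrow> j \<in> I \<Longrightarrow> i \<noteq> j \<Longrightarrow> theta p (y i / y j) \<noteq> 0"
    and Q: "Q = prod c I" and Q_gen: "theta p Q \<noteq> 0"
    and gen: "\<And>i. i \<in> I \<Longrightarrow> theta p (y i * Q) \<noteq> 0" "\<And>i. i \<in> I \<Longrightarrow> theta p (y i * Q / c i) \<noteq> 0"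
  shows "(\<Sum>i\<in>I. theta p (c i) / theta p Q * (theta p (y i) / theta p (y i * Q / c i))
     * (\<Prod>l\<in>I - {i}. theta p (y l * Q) / theta p (y l * Q / c l)
          * (theta p (y i * c l / y l) / theta p (y i / y l)))) = 1"
proof -
  \<comment> \<open>The further point is \<open>1 / Q\<close>, and the parameter 1 makes the
    numerators contain \<open>\<theta>(y i)\<close>.\<close>
  define z where "z = case_option (1 / Q) y"
  define b where "b = case_option 1 (\<lambda>i. y i / c i)"
  define J where "J = insert None (Some ` I)"
  have Qnz: "Q \<noteq> 0" using Q nz fin by simp
  have prod_J: "prod f J = f None * (\<Prod>i\<in>I. f (Some i))" for f :: "_ \<Rightarrow> complex"
    using fin by (simp add: J_def prod.reindex)
  have J_None: "J - {None} = Some ` I" by (auto simp: J_def)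
  have J_Some: "J - {Some i} = insert None (Some ` (I - {i}))" for i by (auto simp: J_def)
  have inv: "theta p (1 / Q / y i) = - theta p (y i * Q) / (y i * Q)" if "i \<in> I" for i
    using theta_inverse[of "y i * Q"] nz that Qnz by (simp add: mult.commute)
  define R where "R = (\<Prod>l\<in>I. theta p (y l * Q) / theta p (y l * Q / c l))"
  have R: "R \<noteq> 0" using fin gen by (simp add: R_def)
  define t where "t i = theta p (y i) * (\<Prod>l\<in>I. theta p (y i * c l / y l))
      / (theta p (y i * Q) * (\<Prod>l\<in>I - {i}. theta p (y i / y l)))" for i
  have "partial_fraction_sum z J b = 0"
  proof (rule theta_partial_fractions)
    show "finite J" using fin by (simp add: J_def)
    show "z i \<noteq> 0" "b i \<noteq> 0" if "i \<in> J" for i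
      using that nz Qnz by (auto simp: J_def z_def b_def)
    show "theta p (z i / z j) \<noteq> 0" if "i \<in> J" "j \<in> J" "i \<noteq> j" for i j
    proof (cases i; cases j)
      fix x assume x: "i = None" "j = Some x"
      then have "x \<in> I" using that by (auto simp: J_def)
      then show ?thesis using gen(1)[of x] nz(1)[of x] Qnz inv[of x] by (simp add: x z_def)
    next
      fix x assume x: "i = Some x" "j = None"
      then have "x \<in> I" using that by (auto simp: J_def)
      then show ?thesis using gen(1)[of x] by (simp add: x z_def)
    next
      fix x x' assume x: "i = Some x" "j = Some x'"
      then have "x \<in> I" "x' \<in> I" "x \<noteq> x'" using that by (auto simp: J_def)
      then show ?thesis using dist[of x x'] by (simp add: x z_def)
    qed (use that in auto)
    show "prod z J = prod b J"
      using Q Qnz by (simp add: prod_J z_def b_def prod_dividef)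
  qed
  moreover have "partial_fraction_sum z J b =
      (\<Prod>j\<in>J. theta p (1 / Q / b j)) / (\<Prod>j\<in>I. theta p (1 / Q / y j)) + (\<Sum>i\<in>I. t i)"
  proof -
    have "partial_fraction_sum z J b =
       (\<Prod>j\<in>J. theta p (z None / b j)) / (\<Prod>j\<in>J - {None}. theta p (z None / z j))
       + (\<Sum>i\<in>I. (\<Prod>j\<in>J. theta p (z (Some i) / b j)) / (\<Prod>j\<in>J - {Some i}. theta p (z (Some i) / z j)))"
      unfolding partial_fraction_sum_def using fin
      by (subst J_def, subst sum.insert) (auto simp: sum.reindex J_def)
    also have "(\<Prod>j\<in>J - {None}. theta p (z None / z j)) = (\<Prod>j\<in>I. theta p (1 / Q / y j))"
      by (simp add: J_None prod.reindex z_def)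
    also have "(\<Sum>i\<in>I. (\<Prod>j\<in>J. theta p (z (Some i) / b j)) / (\<Prod>j\<in>J - {Some i}. theta p (z (Some i) / z j)))
        = (\<Sum>i\<in>I. t i)"
      by (intro sum.cong refl) (use fin in \<open>simp add: prod_J J_Some prod.reindex z_def b_def t_def\<close>)
    finally show ?thesis by (simp add: z_def)
  qed
  moreover have "(\<Prod>j\<in>J. theta p (1 / Q / b j)) / (\<Prod>j\<in>I. theta p (1 / Q / y j)) = - theta p Q / R"
  proof -
    have 1: "theta p (1 / Q / (y i / c i)) = - theta p (y i * Q / c i) / (y i * Q) * c i" if "i \<in> I" for i
      using theta_inverse[of "y i * Q / c i"] nz that Qnz by (simp add: mult_ac)
    have "(\<Prod>j\<in>J. theta p (1 / Q / b j)) / (\<Prod>j\<in>I. theta p (1 / Q / y j))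
       = theta p (1 / Q) * (\<Prod>i\<in>I. theta p (1 / Q / (y i / c i)) / theta p (1 / Q / y i))"
      by (simp add: prod_J b_def prod_dividef)
    also have "(\<Prod>i\<in>I. theta p (1 / Q / (y i / c i)) / theta p (1 / Q / y i)) =
        (\<Prod>i\<in>I. c i / (theta p (y i * Q) / theta p (y i * Q / c i)))"
    proof (rule prod.cong[OF refl])
      fix i assume i: "i \<in> I"
      show "theta p (1 / Q / (y i / c i)) / theta p (1 / Q / y i) =
          c i / (theta p (y i * Q) / theta p (y i * Q / c i))"
        unfolding 1[OF i] inv[OF i] using nz[OF i] Qnz by simp
    qed
    also have "\<dots> = Q / R" by (simp only: prod_dividef R_def Q[symmetric])
    also have "theta p (1 / Q) * (Q / R) = - theta p Q / R" using Qnz by (simp add: theta_inverse)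
    finally show ?thesis .
  qed
  ultimately have "(\<Sum>i\<in>I. t i) = theta p Q / R" by (simp only: add_eq_0_iff) simp
  then have S: "(\<Sum>i\<in>I. t i) * (R / theta p Q) = 1" using R Q_gen by simp
  have "theta p (c i) / theta p Q * (theta p (y i) / theta p (y i * Q / c i))
     * (\<Prod>l\<in>I - {i}. theta p (y l * Q) / theta p (y l * Q / c l)
          * (theta p (y i * c l / y l) / theta p (y i / y l))) = t i * (R / theta p Q)"
    if i: "i \<in> I" for i
  proof -
    have "R = theta p (y i * Q) / theta p (y i * Q / c i)
        * (\<Prod>l\<in>I - {i}. theta p (y l * Q) / theta p (y l * Q / c l))"
      using fin i by (simp add: R_def prod.remove)
    moreover have "(\<Prod>l\<in>I. theta p (y i * c l / y l)) = theta p (c i) * (\<Prod>l\<in>I - {i}. theta p (y i * c l / y l))"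
      using fin i nz by (simp add: prod.remove)
    ultimately show ?thesis
      using gen(1)[OF i] by (simp add: t_def prod.distrib prod_dividef mult_ac)
  qed
  then show ?thesis using S by (simp only: sum_distrib_right cong: sum.cong)
qed

end

section \<open>Generic arguments and telescoping weights\<close>

lemma prod_ordered_pairs_split:
  fixes R :: "'r::{finite,linorder} \<Rightarrow> 'r \<Rightarrow> 'a::comm_monoid_mult"
  assumes "\<And>l m. l < m \<Longrightarrow> l \<noteq> i \<Longrightarrow> m \<noteq> i \<Longrightarrow> R l m = 1"
  shows "(\<Prod>(l,m)\<in>{(l,m). l < m}. R l m) = (\<Prod>l\<in>{..<i}. R l i) * (\<Prod>m\<in>{i<..}. R i m)"
proof -
  have "(\<Prod>(l,m)\<in>{(l,m). l < m}. R l m) =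
      (\<Prod>(l,m)\<in>(\<lambda>l. (l, i)) ` {..<i} \<union> (\<lambda>m. (i, m)) ` {i<..}. R l m)"
    by (rule prod.mono_neutral_right) (use assms in auto)
  also have "\<dots> = (\<Prod>(l,m)\<in>(\<lambda>l. (l, i)) ` {..<i}. R l m) * (\<Prod>(l,m)\<in>(\<lambda>m. (i, m)) ` {i<..}. R l m)"
    by (rule prod.union_disjoint) auto
  also have "\<dots> = (\<Prod>l\<in>{..<i}. R l i) * (\<Prod>m\<in>{i<..}. R i m)"
    by (simp add: prod.reindex inj_on_def)
  finally show ?thesis .
qed

lemma prod_below_above:
  fixes f :: "'r::{finite,linorder} \<Rightarrow> 'a::comm_monoid_mult"
  shows "(\<Prod>l\<in>{..<i}. f l) * (\<Prod>l\<in>{i<..}. f l) = (\<Prod>l\<in>UNIV - {i}. f l)"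
proof -
  have "UNIV - {i} = {..<i} \<union> {i<..}" by auto
  moreover have "{..<i} \<inter> {i<..} = {}" by auto
  ultimately show ?thesis by (simp add: prod.union_disjoint)
qed

locale elliptic_nome = theta_nome +
  fixes q :: complex
  assumes q_nz: "q \<noteq> 0"
begin

lemma ell_poch_0 [simp]: "ell_poch q p x 0 = 1"
  by (simp add: ell_poch_def)

lemma ell_poch_Suc: "ell_poch q p x (Suc k) = ell_poch q p x k * theta p (x * q ^ k)"
  by (simp add: ell_poch_def)

lemma ell_poch_Suc_left: "ell_poch q p x (Suc k) = theta p x * ell_poch q p (x * q) k"
  unfolding ell_poch_def by (subst prod.lessThan_Suc_shift) (simp add: mult_ac)

lemma ell_poch_q_shift:
  "theta p x \<noteq> 0 \<Longrightarrow> ell_poch q p (x * q) k = ell_poch q p x k * (theta p (x * q ^ k) / theta p x)"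
  using ell_poch_Suc[of x k] ell_poch_Suc_left[of x k] by (simp add: field_simps)

lemma ell_poch_q_shift_pred:
  "theta p x \<noteq> 0 \<Longrightarrow> k > 0 \<Longrightarrow> ell_poch q p (x * q) (k - 1) = ell_poch q p x k / theta p x"
  using ell_poch_Suc_left[of x "k - 1"] by simp

text \<open>These theta values occur as denominators that do not depend on the arguments
  \<open>a\<^sub>i\<close>, so their vanishing cannot be excluded by genericity of the
  arguments.\<close>

lemma ell_poch_theta_nonzero:
  assumes "ell_poch q p q n \<noteq> 0" "1 \<le> m" "m \<le> n"
  shows "theta p (q ^ m) \<noteq> 0"
proof
  assume "theta p (q ^ m) = 0"
  moreover have "q * q ^ (m - 1) = q ^ m" using assms(2) by (cases m) auto
  ultimately have "theta p (q * q ^ (m - 1)) = 0" by simp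
  moreover have "m - 1 < n" using assms by simp
  ultimately show False using assms(1) unfolding ell_poch_def by (auto simp: prod_zero_iff)
qed

definition qshift :: "'r \<Rightarrow> ('r \<Rightarrow> complex) \<Rightarrow> 'r \<Rightarrow> complex" where
  "qshift i a = (\<lambda>l. a l * q ^ (if l = i then 1 else 2))"

text \<open>Arguments at which none of the theta functions in question vanishes. The bound
  \<open>N\<close> on the exponents keeps the number of conditions finite, so that they hold on
  a dense open set.\<close>

definition generic :: "nat \<Rightarrow> ('r \<Rightarrow> complex) \<Rightarrow> bool" where
  "generic N a \<longleftrightarrow> (\<forall>i. a i \<noteq> 0) \<and>
     (\<forall>i m. \<bar>m\<bar> \<le> int N \<longrightarrow> theta p (a i * q powi m) \<noteq> 0) \<and>
     (\<forall>i j m. i \<noteq> j \<longrightarrow> \<bar>m\<bar> \<le> int N \<longrightarrow> theta p (a i * q powi m / a j) \<noteq> 0)"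

lemma genericD:
  assumes "generic N a"
  shows "a i \<noteq> 0" "\<bar>m\<bar> \<le> int N \<Longrightarrow> theta p (a i * q powi m) \<noteq> 0"
    "i \<noteq> j \<Longrightarrow> \<bar>m\<bar> \<le> int N \<Longrightarrow> theta p (a i * q powi m / a j) \<noteq> 0"
  using assms by (simp_all add: generic_def)

text \<open>The coefficient that arises when a variable with parameter \<open>y\<close> passes
  the \<open>m\<close>-th power of a variable with parameter \<open>x\<close>. Each of the
  \<open>m\<close> weights is shifted by the letters that it has to cross.\<close>

definition swap_weight :: "complex \<Rightarrow> complex \<Rightarrow> nat \<Rightarrow> complex" where
  "swap_weight x y m = (\<Prod>s<m. ell_weight q p (x * q ^ s) (y * q ^ (2 * s)) 1 1)"

text \<open>The value of \<open>swap_weight\<close> after telescoping, apart from a quotient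
  that does not involve \<open>x\<close>. Here \<open>x\<close> and \<open>y\<close> are shifted
  by \<open>q\<^sup>2\<^sup>s\<close>, which accounts for \<open>s\<close> letters of smaller
  index in front.\<close>

definition swap_factor :: "complex \<Rightarrow> complex \<Rightarrow> nat \<Rightarrow> nat \<Rightarrow> complex" where
  "swap_factor x y s m = q ^ m *
     (theta p (x * q powi (2 * int s + int m + 1)) * theta p (x * q powi (2 * int s + int m + 2))
       / (theta p (x * q powi (2 * int s + 1)) * theta p (x * q powi (2 * int s + 2)))) *
     (theta p (x * q powi (- int m) / y) * theta p (x * q powi (1 - int m) / y)
       / (theta p (x * q / y) * theta p (x / y)))"

lemma qpow_collect:
  "x * q powi m * q ^ n = x * q powi (m + int n)" "x * q ^ n * q powi m = x * q powi (int n + m)"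
  "x * q powi m * q = x * q powi (m + 1)" "x * q * q powi m = x * q powi (1 + m)"
  using q_nz by (simp_all add: power_int_add)

lemma qpow_cancel: "x * q powi m / (y * q ^ n) = x * q powi (m - int n) / y"
proof -
  have "x * q powi m = x * q powi (m - int n) * q ^ n" by (simp add: qpow_collect)
  then show ?thesis using q_nz by (simp only:) simp
qed

lemma ell_weight_shifted:
  assumes "y \<noteq> 0"
  shows "ell_weight q p (x * q ^ s) (y * q ^ (2 * s)) 1 1 =
    theta p (x * q powi (int s + 3)) * theta p (y * q powi (2 * int s + 1)) * theta p (x * q powi (- 1 - int s) / y)
    / (theta p (x * q powi (int s + 1)) * theta p (y * q powi (2 * int s + 3)) * theta p (x * q powi (1 - int s) / y)) * q"
proof -
  have 1: "x * q ^ s * q powi m = x * q powi (int s + m)" "y * q ^ (2 * s) * q powi m = y * q powi (2 * int s + m)" for m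
    using qpow_collect(2)[of y "2 * s"] by (simp_all add: qpow_collect)
  have 2: "x * q powi m / (y * q ^ (2 * s)) = x * q powi (m - 2 * int s) / y" for m
    using qpow_cancel[of x m y "2 * s"] by simp
  show ?thesis
    unfolding ell_weight_def 1 2 by (simp add: algebra_simps)
qed

lemma swap_weight_eq:
  assumes "y \<noteq> 0"
    and nz: "\<And>j. 1 \<le> j \<Longrightarrow> j \<le> int m + 2 \<Longrightarrow> theta p (x * q powi j) \<noteq> 0"
      "\<And>j. 1 \<le> j \<Longrightarrow> j \<le> 2 * int m + 1 \<Longrightarrow> theta p (y * q powi j) \<noteq> 0"
      "\<And>j. - int m \<le> j \<Longrightarrow> j \<le> 1 \<Longrightarrow> theta p (x * q powi j / y) \<noteq> 0"
  shows "swap_weight x y m = swap_factor x y 0 m * (theta p (y * q) / theta p (y * q powi (2 * int m + 1)))"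
  using nz
proof (induction m)
  case 0
  from 0(1)[of 1] 0(1)[of 2] 0(2)[of 1] 0(3)[of 1] 0(3)[of 0]
  show ?case by (simp add: swap_weight_def swap_factor_def)
next
  case (Suc m)
  have IH: "swap_weight x y m = swap_factor x y 0 m * (theta p (y * q) / theta p (y * q powi (2 * int m + 1)))"
    by (rule Suc.IH; rule Suc.prems; simp)
  have nz: "theta p (x * q powi (int m + 1)) \<noteq> 0" "theta p (y * q powi (2 * int m + 1)) \<noteq> 0"
    "theta p (x * q powi (1 - int m) / y) \<noteq> 0"
    by (rule Suc.prems; simp)+
  have "swap_weight x y (Suc m) = swap_weight x y m * ell_weight q p (x * q ^ m) (y * q ^ (2 * m)) 1 1"
    by (simp add: swap_weight_def)
  also have "\<dots> = swap_factor x y 0 (Suc m) * (theta p (y * q) / theta p (y * q powi (2 * int (Suc m) + 1)))"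
    unfolding IH ell_weight_shifted[OF assms(1)] swap_factor_def
    using nz by (simp add: algebra_simps)
  finally show ?case .
qed

lemma swap_factor_shift:
  "swap_factor (x * q ^ (2 * r)) (y * q ^ (2 * r)) s m = swap_factor x y (r + s) m"
proof -
  have 1: "x * q ^ (2 * r) * q powi j = x * q powi (2 * int r + j)" for j
    using qpow_collect(2)[of x "2 * r"] by simp
  have 2: "x * q powi (2 * int r + j) / (y * q ^ (2 * r)) = x * q powi j / y" for j
    using qpow_cancel[of x "2 * int r + j" y "2 * r"] by simp
  have 3: "x * q ^ (2 * r) * q / (y * q ^ (2 * r)) = x * q / y" "x * q ^ (2 * r) / (y * q ^ (2 * r)) = x / y"
    using q_nz by simp_all
  show ?thesis unfolding swap_factor_def 1 2 3 by (simp add: algebra_simps)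
qed

text \<open>The coefficient that arises when \<open>X\<^sub>i\<close> is moved from the left end
  of a monomial with exponents \<open>k\<close> and the given order of letters to the block of
  letters \<open>X\<^sub>i\<close>.\<close>

fun insertion_coeff :: "'r \<Rightarrow> ('r \<Rightarrow> nat) \<Rightarrow> 'r list \<Rightarrow> ('r \<Rightarrow> complex) \<Rightarrow> complex" where
  "insertion_coeff i k [] a = 1"
| "insertion_coeff i k (l # ls) a = (if l = i then 1 else
     swap_weight (a l) (a i) (k l) * insertion_coeff i k ls ((qshift l ^^ k l) a))"

lemma qshift_funpow: "(qshift i ^^ s) a l = a l * q ^ ((if l = i then 1 else 2) * s)"
  by (induction s) (simp_all add: qshift_def power_add mult_ac)

text \<open>The quotients that involve no argument but \<open>a i\<close> telescope along the
  list. The number \<open>s\<close> of letters that have already been crossed is a parameter of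
  the induction.\<close>

lemma insertion_coeff_sorted:
  fixes k :: "'r::{finite,linorder} \<Rightarrow> nat"
  assumes "generic N a" "sorted_wrt (<) ls" "i \<in> set ls"
    and "\<And>j. j \<in> set ls \<Longrightarrow> b j = a j * q ^ (2 * s)"
    and "2 * (s + sum k (set ls)) + 3 \<le> N"
  shows "insertion_coeff i k ls b =
    (\<Prod>l\<in>{l \<in> set ls. l < i}. swap_factor (a l) (a i) (s + sum k {m \<in> set ls. m < l}) (k l)) *
    (theta p (a i * q powi (2 * int s + 1))
      / theta p (a i * q powi (2 * int (s + sum k {m \<in> set ls. m < i}) + 1)))"
  using assms(2-5)
proof (induction ls arbitrary: b s)
  case Nil
  then show ?case by simp
next
  case (Cons l ls)
  note gen = genericD[OF assms(1)]
  have sumk: "sum k (set (l # ls)) = k l + sum k (set ls)" using Cons.prems(1) by (subst set_simps, subst sum.insert) auto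
  show ?case
  proof (cases "l = i")
    case True
    then have E: "{m \<in> set (l # ls). m < i} = {}" using Cons.prems(1) by auto
    have "theta p (a i * q powi (2 * int s + 1)) \<noteq> 0"
      by (rule gen(2)) (use Cons.prems(4) in simp)
    then show ?thesis unfolding E using True by simp
  next
    case False
    then have li: "i \<in> set ls" "l < i" using Cons.prems(1,2) by auto
    define s' where "s' = s + k l"
    define b' where "b' = (qshift l ^^ k l) b"
    have b'_eq: "b' j = a j * q ^ (2 * s')" if "j \<in> set ls" for j
    proof -
      have "j \<noteq> l" using that Cons.prems(1) by auto
      then show ?thesis using Cons.prems(3)[of j] that
        by (simp add: b'_def qshift_funpow s'_def power_add distrib_left mult_ac)
    qed
    have bound: "2 * (s' + sum k (set ls)) + 3 \<le> N" using Cons.prems(4) sumk by (simp add: s'_def)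
    have IH: "insertion_coeff i k ls b' =
      (\<Prod>l\<in>{l \<in> set ls. l < i}. swap_factor (a l) (a i) (s' + sum k {m \<in> set ls. m < l}) (k l)) *
      (theta p (a i * q powi (2 * int s' + 1))
        / theta p (a i * q powi (2 * int (s' + sum k {m \<in> set ls. m < i}) + 1)))"
      by (rule Cons.IH) (use Cons.prems(1) li b'_eq bound in auto)
    have below: "{m \<in> set (l # ls). m < x} = insert l {m \<in> set ls. m < x}" if "x \<in> set ls" for x
      using that Cons.prems(1) by auto
    have K: "s + sum k {m \<in> set (l # ls). m < x} = s' + sum k {m \<in> set ls. m < x}" if "x \<in> set ls" for x
      unfolding below[OF that] s'_def using Cons.prems(1) by (subst sum.insert) auto
    have "{m \<in> set (l # ls). m < l} = {}" using Cons.prems(1) by auto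
    then have K0: "sum k {m \<in> set (l # ls). m < l} = 0" by (simp only: sum.empty)
    have e: "a j * q ^ (2 * s) * q powi m = a j * q powi (2 * int s + m)" for j m
      using qpow_collect(2)[of "a j" "2 * s"] by simp
    have e1: "a i * q ^ (2 * s) * q = a i * q powi (2 * int s + 1)" using e[of i 1] by simp
    have e': "a l * q ^ (2 * s) * q powi m / (a i * q ^ (2 * s)) = a l * q powi m / a i" for m
      using q_nz by simp
    have "swap_weight (b l) (b i) (k l) = swap_factor (a l * q ^ (2 * s)) (a i * q ^ (2 * s)) 0 (k l) *
        (theta p (a i * q ^ (2 * s) * q) / theta p (a i * q ^ (2 * s) * q powi (2 * int (k l) + 1)))"
      unfolding Cons.prems(3)[OF Cons.prems(2)] Cons.prems(3)[OF list.set_intros(1)]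
    proof (rule swap_weight_eq)
      show "a i * q ^ (2 * s) \<noteq> 0" using gen(1) q_nz by simp
      show "theta p (a l * q ^ (2 * s) * q powi j) \<noteq> 0" if "1 \<le> j" "j \<le> int (k l) + 2" for j
        unfolding e by (rule gen(2)) (use that Cons.prems(4) sumk in simp)
      show "theta p (a i * q ^ (2 * s) * q powi j) \<noteq> 0" if "1 \<le> j" "j \<le> 2 * int (k l) + 1" for j
        unfolding e by (rule gen(2)) (use that Cons.prems(4) sumk in simp)
      show "theta p (a l * q ^ (2 * s) * q powi j / (a i * q ^ (2 * s))) \<noteq> 0" if "- int (k l) \<le> j" "j \<le> 1" for j
        unfolding e' by (rule gen(3)[OF False]) (use that Cons.prems(4) sumk in simp)
    qed
    also have "\<dots> = swap_factor (a l) (a i) s (k l) *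
        (theta p (a i * q powi (2 * int s + 1)) / theta p (a i * q powi (2 * int s' + 1)))"
      unfolding swap_factor_shift e1 e s'_def by (simp add: algebra_simps)
    finally have W: "swap_weight (b l) (b i) (k l) = \<dots>" .
    have nz: "theta p (a i * q powi (2 * int s' + 1)) \<noteq> 0"
      by (rule gen(2)) (use bound in simp)
    have "(\<Prod>x\<in>{x \<in> set (l # ls). x < i}. swap_factor (a x) (a i) (s + sum k {m \<in> set (l # ls). m < x}) (k x))
      = swap_factor (a l) (a i) s (k l) *
        (\<Prod>x\<in>{x \<in> set ls. x < i}. swap_factor (a x) (a i) (s + sum k {m \<in> set (l # ls). m < x}) (k x))"
      unfolding below[OF li(1)] using Cons.prems(1) by (subst prod.insert) (auto simp: K0 simp del: set_simps)
    also have "(\<Prod>x\<in>{x \<in> set ls. x < i}. swap_factor (a x) (a i) (s + sum k {m \<in> set (l # ls). m < x}) (k x))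
      = (\<Prod>x\<in>{x \<in> set ls. x < i}. swap_factor (a x) (a i) (s' + sum k {m \<in> set ls. m < x}) (k x))"
      by (intro prod.cong refl) (simp only: K mem_Collect_eq)
    finally show ?thesis
      using False nz by (simp add: IH W K[OF li(1)] flip: b'_def del: set_simps)
  qed
qed

lemma insertion_coeff_eq:
  fixes k :: "'r::{finite,linorder} \<Rightarrow> nat"
  assumes "generic N a" "2 * sum k UNIV + 3 \<le> N"
  shows "insertion_coeff i k (sorted_list_of_set UNIV) a =
    (\<Prod>l\<in>{..<i}. swap_factor (a l) (a i) (sum k {..<l}) (k l)) *
    (theta p (a i * q) / theta p (a i * q powi (2 * int (sum k {..<i}) + 1)))"
  using insertion_coeff_sorted[OF assms(1), of "sorted_list_of_set UNIV" i a 0 k] assms(2)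
  by (simp add: lessThan_def)

end

context elliptic_nome
begin

section \<open>The recursion for the elliptic multinomial coefficients\<close>

text \<open>A summand of the recursion as a multiple of the coefficient. All three products in
  the definition of the multinomial coefficient change by few factors only, because passing to
  \<open>k - e\<^sub>i\<close> and to shifted arguments at the same time keeps most arguments of
  the theta functions fixed; the rest cancels against the telescoped weights.\<close>

lemma ell_multinomial_lower:
  fixes k :: "'r::{finite,linorder} \<Rightarrow> nat"
  assumes gen: "generic N a" and N: "2 * sum k UNIV + 3 \<le> N" and ki: "k i > 0"
    and th: "\<And>m. 1 \<le> m \<Longrightarrow> m \<le> sum k UNIV \<Longrightarrow> theta p (q ^ m) \<noteq> 0"
  defines "n \<equiv> sum k UNIV" and "k' \<equiv> k(i := k i - 1)"
  shows "ell_multinomial q p (qshift i a) k' * insertion_coeff i k' (sorted_list_of_set UNIV) a =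
    ell_multinomial q p a k *
     (theta p (q ^ k i) / theta p (q ^ n) *
      (theta p (a i * q) / theta p (a i * q powi (1 + int n - int (k i)))) *
      (\<Prod>l\<in>UNIV - {i}. theta p (a l * q powi (1 + int n)) / theta p (a l * q powi (1 + int n - int (k l)))
         * (theta p (a i * q ^ k l / a l) / theta p (a i / a l))))"
proof -
  note gen1 = genericD(1)[OF gen] and gen2 = genericD(2)[OF gen] and gen3 = genericD(3)[OF gen]
  define a' where "a' = qshift i a"
  define K where "K l = sum k {..<l}" for l
  have kK: "K l + k l \<le> n" for l
  proof -
    have "K l + k l = sum k (insert l {..<l})" unfolding K_def by (subst sum.insert) auto
    also have "\<dots> \<le> n" unfolding n_def by (rule sum_mono2) auto
    finally show ?thesis .
  qed
  have n1: "n \<ge> 1" using ki kK[of i] by simp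
  have nk: "n = k i + sum k (UNIV - {i})" unfolding n_def by (simp add: sum.remove)
  have rest: "sum k' (B - {i}) = sum k (B - {i})" for B
    by (rule sum.cong) (auto simp: k'_def)
  have n': "sum k' UNIV = n - 1" using ki nk rest[of UNIV] sum.remove[of UNIV i k']
    by (simp add: k'_def)
  have k'_other: "k' l = k l" if "l \<noteq> i" for l using that by (simp add: k'_def)
  have k'_i: "k' i = k i - 1" by (simp add: k'_def)
  have K'_le: "sum k' {..<l} = K l" if "l \<le> i" for l
    unfolding K_def using that by (intro sum.cong) (auto simp: k'_def)
  have K'_gt: "int (sum k' {..<l}) = int (K l) - 1" if "i < l" for l
  proof -
    have "K l = k i + sum k ({..<l} - {i})" using that by (simp add: K_def sum.remove)
    moreover have "sum k' {..<l} = (k i - 1) + sum k ({..<l} - {i})"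
      using that rest[of "{..<l}"] sum.remove[of "{..<l}" i k'] by (simp add: k'_def)
    ultimately show ?thesis using ki by simp
  qed
  have a'_other: "a' l = a l * q ^ 2" if "l \<noteq> i" for l using that by (simp add: a'_def qshift_def)
  have a'_i: "a' i = a i * q" by (simp add: a'_def qshift_def)

  define \<rho> where "\<rho> = theta p (q ^ k i) / theta p (q ^ n)"
  have pref: "ell_poch q p q (sum k' UNIV) / (\<Prod>l\<in>UNIV. ell_poch q p q (k' l)) =
      ell_poch q p q n / (\<Prod>l\<in>UNIV. ell_poch q p q (k l)) * \<rho>"
  proof -
    have 1: "ell_poch q p q m = ell_poch q p q (m - 1) * theta p (q ^ m)" if "m > 0" for m
      using ell_poch_Suc[of q "m - 1"] that by (cases m) auto
    have 2: "(\<Prod>l\<in>UNIV. ell_poch q p q (k' l)) =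
        ell_poch q p q (k i - 1) * (\<Prod>l\<in>UNIV - {i}. ell_poch q p q (k l))"
    proof -
      have "(\<Prod>l\<in>UNIV - {i}. ell_poch q p q (k' l)) = (\<Prod>l\<in>UNIV - {i}. ell_poch q p q (k l))"
        by (rule prod.cong) (auto simp: k'_other)
      then show ?thesis using prod.remove[of UNIV i "\<lambda>l. ell_poch q p q (k' l)"] by (simp add: k'_i)
    qed
    have 3: "(\<Prod>l\<in>UNIV. ell_poch q p q (k l)) =
        ell_poch q p q (k i - 1) * theta p (q ^ k i) * (\<Prod>l\<in>UNIV - {i}. ell_poch q p q (k l))"
      by (simp add: prod.remove[of UNIV i] 1[OF ki])
    have "theta p (q ^ k i) \<noteq> 0" "theta p (q ^ n) \<noteq> 0"
      using th[of "k i"] th[of n] ki kK[of i] n1 by (auto simp: n_def)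
    then show ?thesis unfolding n' 2 3 \<rho>_def using 1[of n] n1 by simp
  qed

  define f1 where "f1 l = ell_poch q p (a l * q powi (1 + int n - int (k l))) (k l)" for l
  define f1' where "f1' l = ell_poch q p (a' l * q powi (1 + int (sum k' UNIV) - int (k' l))) (k' l)" for l
  \<comment> \<open>The factors by which the numerators, the denominators and the pairs change
    are \<open>r1\<close>, \<open>r2\<close> and \<open>R\<close>.\<close>
  define r1 where "r1 l = (if l = i then 1 else theta p (a l * q powi (1 + int n)))
      / theta p (a l * q powi (1 + int n - int (k l)))" for l
  have F1: "f1' l = f1 l * r1 l" for l
  proof -
    have nz: "theta p (a l * q powi (1 + int n - int (k l))) \<noteq> 0"
      by (rule gen2) (use kK[of l] N in \<open>simp add: n_def del: of_nat_sum\<close>)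
    show ?thesis
    proof (cases "l = i")
      case True
      have "a' i * q powi (1 + int (n - 1) - int (k i - 1)) = a i * q powi (1 + int n - int (k i)) * q"
        unfolding a'_i qpow_collect using n1 ki by (simp add: algebra_simps)
      then show ?thesis using nz ki ell_poch_q_shift_pred[OF nz, of "k i"]
        by (simp add: f1'_def f1_def r1_def n' k'_i True)
    next
      case False
      have A: "a' l * q powi (1 + int (n - 1) - int (k l)) = a l * q powi (1 + int n - int (k l)) * q"
        unfolding a'_other[OF False] qpow_collect using n1 by (simp add: algebra_simps)
      have B: "a l * q powi (1 + int n - int (k l)) * q ^ k l = a l * q powi (1 + int n)"
        unfolding qpow_collect by simp
      show ?thesis
        unfolding f1'_def n' k'_other[OF False] A ell_poch_q_shift[OF nz] B f1_def r1_def
        using False by simp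
    qed
  qed

  define f2 where "f2 l = ell_poch q p (a l * q powi (1 + 2 * int (K l))) (k l)" for l
  define f2' where "f2' l = ell_poch q p (a' l * q powi (1 + 2 * int (sum k' {..<l}))) (k' l)" for l
  define t where "t l j = theta p (a l * q powi (2 * int (K l) + j))" for l j
  define r2 where "r2 l = (if l < i then t l (int (k l) + 1) * t l (int (k l) + 2) / (t l 1 * t l 2)
      else if l = i then 1 / t l 1 else 1)" for l
  have F2: "f2' l = f2 l * r2 l" for l
  proof -
    have nz: "t l 1 \<noteq> 0" "t l 2 \<noteq> 0"
      unfolding t_def by (rule gen2; use kK[of l] N in \<open>simp add: n_def del: of_nat_sum\<close>)+
    have x: "theta p (a l * q powi (1 + 2 * int (K l))) = t l 1"
      "theta p (a l * q powi (1 + 2 * int (K l)) * q) = t l 2"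
      unfolding t_def qpow_collect by (simp_all add: algebra_simps)
    consider "l < i" | "l = i" | "i < l" by fastforce
    then show ?thesis
    proof cases
      case 1
      have e: "a' l * q powi (1 + 2 * int (sum k' {..<l})) = a l * q powi (1 + 2 * int (K l)) * q * q"
        using 1 by (simp add: a'_other K'_le power2_eq_square mult_ac)
      have y: "theta p (a l * q powi (1 + 2 * int (K l)) * q ^ k l) = t l (int (k l) + 1)"
        "theta p (a l * q powi (1 + 2 * int (K l)) * q * q ^ k l) = t l (int (k l) + 2)"
        unfolding t_def qpow_collect by (simp_all add: algebra_simps)
      show ?thesis
        using 1 nz unfolding f2'_def f2_def r2_def e
        by (simp add: k'_other ell_poch_q_shift x y del: of_nat_sum)
    next
      case 2
      have e: "a' i * q powi (1 + 2 * int (sum k' {..<i})) = a i * q powi (1 + 2 * int (K i)) * q"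
        by (simp add: a'_i K'_le mult_ac)
      show ?thesis
        using nz ki x(1) unfolding 2 f2'_def f2_def r2_def e
        using ell_poch_q_shift_pred[of "a i * q powi (1 + 2 * int (K i))" "k i"] by (simp add: k'_i)
    next
      case 3
      have "a' l * q powi (1 + 2 * int (sum k' {..<l})) = a l * q powi (1 + 2 * int (K l))"
        using 3 unfolding K'_gt[OF 3] by (simp add: a'_other qpow_collect)
      then show ?thesis
        using 3 by (simp add: f2'_def f2_def r2_def k'_other less_imp_neq[symmetric] less_not_sym del: of_nat_sum)
    qed
  qed

  define G where "G l m = ell_poch q p (a l * q powi (1 - int (k l)) / a m) (k m)
      / ell_poch q p (a l * q / a m) (k m)" for l m
  define G' where "G' l m = ell_poch q p (a' l * q powi (1 - int (k' l)) / a' m) (k' m)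
      / ell_poch q p (a' l * q / a' m) (k' m)" for l m
  define R where "R l m = (if m = i then theta p (a l * q / a i) / theta p (a l * q powi (1 - int (k l)) / a i)
      else if l = i then theta p (a i * q ^ k m / a m) / theta p (a i / a m) else 1)" for l m
  have RR: "G' l m = G l m * R l m" if "l < m" for l m
  proof -
    have lm: "l \<noteq> m" using that by simp
    have nz: "theta p (a l * q powi (1 - int (k l)) / a m) \<noteq> 0" "theta p (a l * q powi 1 / a m) \<noteq> 0"
      "theta p (a l * q powi 0 / a m) \<noteq> 0" "theta p (a l * q powi (int (k m)) / a m) \<noteq> 0"
      by (rule gen3[OF lm]; use kK[of l] kK[of m] N in \<open>simp add: n_def del: of_nat_sum\<close>)+
    consider "m = i" | "l = i" "m \<noteq> i" | "l \<noteq> i" "m \<noteq> i" by blast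
    then show ?thesis
    proof cases
      case 1
      then have l: "l \<noteq> i" using lm by simp
      have 2: "a' l * q powi (1 - int (k' l)) / a' i = a l * q powi (1 - int (k l)) / a i * q"
        "a' l * q / a' i = a l * q / a i * q"
        using q_nz by (simp_all add: a'_other[OF l] a'_i k'_other[OF l] power2_eq_square field_simps)
      have w: "theta p (a l * q / a i) \<noteq> 0" using nz(2) 1 by simp
      show ?thesis
        unfolding G'_def G_def R_def 1 2 k'_i
          ell_poch_q_shift_pred[OF nz(1)[unfolded 1] ki] ell_poch_q_shift_pred[OF w ki]
        by simp
    next
      case 2
      have 3: "a' i * q powi (1 - int (k' i)) / a' m = a i * q powi (1 - int (k i)) / a m"
      proof -
        have "a' i * q powi (1 - int (k' i)) = a i * q powi (1 - int (k i)) * q ^ 2"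
          unfolding a'_i qpow_collect k'_i using ki by (simp add: algebra_simps)
        then show ?thesis using q_nz by (simp add: a'_other[OF 2(2)])
      qed
      have 4: "a' i * q / a' m = a i / a m"
        using q_nz by (simp add: a'_i a'_other[OF 2(2)] power2_eq_square)
      have 5: "ell_poch q p (a i * q / a m) (k m) = ell_poch q p (a i / a m) (k m)
          * (theta p (a i * q ^ k m / a m) / theta p (a i / a m))"
        using ell_poch_q_shift[of "a i / a m" "k m"] nz(3) 2(1) by simp
      show ?thesis unfolding G'_def G_def R_def 2(1) 3 4 5 k'_other[OF 2(2)]
        using nz 2 by simp
    next
      case 3
      have "a' l * x / a' m = a l * x / a m" for x
        using q_nz by (simp add: a'_other 3)
      then show ?thesis using 3 by (simp add: G'_def G_def R_def k'_other)
    qed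
  qed

  have lower: "ell_multinomial q p a' k' = ell_multinomial q p a k * (\<rho> * (prod r1 UNIV / prod r2 UNIV) *
      ((\<Prod>l\<in>{..<i}. R l i) * (\<Prod>m\<in>{i<..}. R i m)))"
  proof -
    have "(\<Prod>l\<in>UNIV. f1' l / f2' l) = (\<Prod>l\<in>UNIV. f1 l / f2 l) * (prod r1 UNIV / prod r2 UNIV)"
      by (simp add: F1 F2 prod.distrib prod_dividef)
    moreover have "(\<Prod>(l,m)\<in>{(l,m). l < m}. G' l m) =
        (\<Prod>(l,m)\<in>{(l,m). l < m}. G l m) * (\<Prod>(l,m)\<in>{(l,m). l < m}. R l m)"
      unfolding prod.distrib[symmetric] by (rule prod.cong) (auto simp: RR)
    moreover have "(\<Prod>(l,m)\<in>{(l,m). l < m}. R l m) = (\<Prod>l\<in>{..<i}. R l i) * (\<Prod>m\<in>{i<..}. R i m)"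
      by (rule prod_ordered_pairs_split) (simp add: R_def)
    ultimately show ?thesis
      unfolding ell_multinomial_def pref f1_def f1'_def f2_def f2'_def G_def G'_def n_def K_def
      by (simp only: mult_ac)
  qed

  have insertion: "insertion_coeff i k' (sorted_list_of_set UNIV) a =
    (\<Prod>l\<in>{..<i}. swap_factor (a l) (a i) (K l) (k l)) * (theta p (a i * q) / t i 1)"
  proof -
    have "2 * sum k' UNIV + 3 \<le> N" using N n' by (simp add: n_def)
    moreover have "(\<Prod>l\<in>{..<i}. swap_factor (a l) (a i) (sum k' {..<l}) (k' l)) =
        (\<Prod>l\<in>{..<i}. swap_factor (a l) (a i) (K l) (k l))"
    proof (rule prod.cong[OF refl])
      fix l assume "l \<in> {..<i}"
      then have l: "l \<le> i" "l \<noteq> i" by auto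
      show "swap_factor (a l) (a i) (sum k' {..<l}) (k' l) = swap_factor (a l) (a i) (K l) (k l)"
        by (simp only: K'_le[OF l(1)] k'_other[OF l(2)])
    qed
    ultimately show ?thesis
      using insertion_coeff_eq[OF gen, of k' i] unfolding K'_le[OF order_refl] t_def by simp
  qed

  \<comment> \<open>For \<open>l < i\<close> the factors from the pairs and from the weights
    combine to the same expression that comes from the pairs alone for \<open>l > i\<close>.
    This restores the symmetry in the indices.\<close>
  define S where "S l = theta p (a i * q ^ k l / a l) / theta p (a i / a l)" for l
  have S_below: "swap_factor (a l) (a i) (K l) (k l) / r2 l * R l i = S l" if l: "l < i" for l
  proof -
    have nz: "theta p (a l * q powi (1 - int (k l)) / a i) \<noteq> 0" "theta p (a l * q powi 1 / a i) \<noteq> 0"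
      using l by (intro gen3; use kK[of l] N in \<open>simp add: n_def del: of_nat_sum\<close>)+
    have tnz: "t l 1 \<noteq> 0" "t l 2 \<noteq> 0" "t l (int (k l) + 1) \<noteq> 0" "t l (int (k l) + 2) \<noteq> 0"
      unfolding t_def by (rule gen2; use kK[of l] N in \<open>simp add: n_def del: of_nat_sum\<close>)+
    have "swap_factor (a l) (a i) (K l) (k l) = q ^ k l * r2 l *
        (theta p (a l * q powi (- int (k l)) / a i) * theta p (a l * q powi (1 - int (k l)) / a i)
       / (theta p (a l * q / a i) * theta p (a l / a i)))"
      using l by (simp add: swap_factor_def r2_def t_def add.assoc)
    moreover have "r2 l \<noteq> 0" using tnz l by (simp add: r2_def)
    ultimately have 1: "swap_factor (a l) (a i) (K l) (k l) / r2 l * R l i =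
        q ^ k l * theta p (a l * q powi (- int (k l)) / a i) / theta p (a l / a i)"
      using nz by (simp add: R_def)
    have 2: "a l * q powi (- int (k l)) / a i = a l / (a i * q ^ k l)"
      by (simp add: power_int_minus field_simps)
    have "theta p (a l / (a i * q ^ k l)) = - (a l / (a i * q ^ k l)) * theta p (a i * q ^ k l / a l)"
      "theta p (a l / a i) = - (a l / a i) * theta p (a i / a l)"
      by (rule theta_swap; use gen1 q_nz in simp)+
    then show ?thesis unfolding 1 2 S_def using gen1[of l] gen1[of i] q_nz by simp
  qed
  have S_above: "R i m = S m" if "i < m" for m using that by (simp add: R_def S_def)

  have r2_prod: "prod r2 UNIV = (\<Prod>l\<in>{..<i}. r2 l) / t i 1"
  proof -
    have "(\<Prod>l\<in>{i<..}. r2 l) = 1" by (rule prod.neutral) (auto simp: r2_def)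
    then show ?thesis
      using prod.remove[of UNIV i r2] prod_below_above[where f = r2 and i = i] by (simp add: r2_def)
  qed
  have ti: "t i 1 \<noteq> 0"
    unfolding t_def by (rule gen2; use kK[of i] N in \<open>simp add: n_def del: of_nat_sum\<close>)
  have "(\<Prod>l\<in>{..<i}. swap_factor (a l) (a i) (K l) (k l) / r2 l * R l i) = (\<Prod>l\<in>{..<i}. S l)"
    by (rule prod.cong[OF refl], rule S_below) simp
  then have below: "(\<Prod>l\<in>{..<i}. swap_factor (a l) (a i) (K l) (k l)) / (\<Prod>l\<in>{..<i}. r2 l) * (\<Prod>l\<in>{..<i}. R l i)
      = (\<Prod>l\<in>{..<i}. S l)"
    by (simp add: prod.distrib prod_dividef)
  have above: "(\<Prod>m\<in>{i<..}. R i m) = (\<Prod>l\<in>{i<..}. S l)"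
    by (rule prod.cong) (auto simp: S_above)
  have "ell_multinomial q p a' k' * insertion_coeff i k' (sorted_list_of_set UNIV) a =
     ell_multinomial q p a k * (\<rho> * prod r1 UNIV * theta p (a i * q) *
      ((\<Prod>l\<in>{..<i}. swap_factor (a l) (a i) (K l) (k l)) / (\<Prod>l\<in>{..<i}. r2 l) * (\<Prod>l\<in>{..<i}. R l i)
        * (\<Prod>m\<in>{i<..}. R i m)))"
    unfolding lower insertion r2_prod using ti by simp
  also have "\<dots> = ell_multinomial q p a k * (\<rho> * prod r1 UNIV * theta p (a i * q) * (\<Prod>l\<in>UNIV - {i}. S l))"
    unfolding below above prod_below_above ..
  also have "prod r1 UNIV = (1 / theta p (a i * q powi (1 + int n - int (k i)))) *
      (\<Prod>l\<in>UNIV - {i}. theta p (a l * q powi (1 + int n)) / theta p (a l * q powi (1 + int n - int (k l))))"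
    by (subst prod.remove[of UNIV i]) (auto simp: r1_def intro!: prod.cong)
  finally show ?thesis
    unfolding a'_def \<rho>_def S_def prod.distrib by (simp add: mult_ac)
qed

theorem ell_multinomial_recursion:
  fixes k :: "'r::{finite,linorder} \<Rightarrow> nat"
  assumes gen: "generic N a" and N: "2 * sum k UNIV + 3 \<le> N"
    and th: "\<And>m. 1 \<le> m \<Longrightarrow> m \<le> sum k UNIV \<Longrightarrow> theta p (q ^ m) \<noteq> 0"
    and pos: "sum k UNIV > 0"
  shows "ell_multinomial q p a k = (\<Sum>i\<in>{i. k i > 0}.
    ell_multinomial q p (qshift i a) (k(i := k i - 1))
      * insertion_coeff i (k(i := k i - 1)) (sorted_list_of_set UNIV) a)"
proof -
  define n where "n = sum k UNIV"
  define u where "u i = theta p (q ^ k i) / theta p (q ^ n) *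
      (theta p (a i * q) / theta p (a i * q powi (1 + int n - int (k i)))) *
      (\<Prod>l\<in>UNIV - {i}. theta p (a l * q powi (1 + int n)) / theta p (a l * q powi (1 + int n - int (k l)))
         * (theta p (a i * q ^ k l / a l) / theta p (a i / a l)))" for i
  note gen1 = genericD(1)[OF gen] and gen2 = genericD(2)[OF gen] and gen3 = genericD(3)[OF gen]
  have kn: "k i \<le> n" for i unfolding n_def by (rule member_le_sum) auto
  have e1: "a i * q * q ^ n = a i * q powi (1 + int n)" for i
    using qpow_collect(1)[of "a i" 1 n] by simp
  have e2': "a i * q powi (1 + int n) / q ^ k i = a i * q powi (1 + int n - int (k i))" for i
    using qpow_cancel[of "a i" "1 + int n" 1 "k i"] by simp
  have e2: "a i * q * q ^ n / q ^ k i = a i * q powi (1 + int n - int (k i))" for i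
    by (simp add: e1 e2')
  have e3: "a i * q * x / (a l * q) = a i * x / a l" "a i * q / (a l * q) = a i / a l" for i l x using q_nz by simp_all
  have "(\<Sum>i\<in>UNIV. theta p (q ^ k i) / theta p (q ^ n) * (theta p (a i * q) / theta p (a i * q * q ^ n / q ^ k i))
     * (\<Prod>l\<in>UNIV - {i}. theta p (a l * q * q ^ n) / theta p (a l * q * q ^ n / q ^ k l)
          * (theta p (a i * q * q ^ k l / (a l * q)) / theta p (a i * q / (a l * q))))) = 1"
  proof (rule theta_weights_sum)
    show "q ^ n = (\<Prod>i\<in>UNIV. q ^ k i)" by (simp add: n_def power_sum)
    show "theta p (q ^ n) \<noteq> 0" using th[of n] pos by (simp add: n_def)
    show "a i * q \<noteq> 0" "q ^ k i \<noteq> 0" for i using gen1 q_nz by auto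
    show "theta p (a i * q / (a j * q)) \<noteq> 0" if "i \<noteq> j" for i j
      using gen3[OF that, of 0] q_nz by simp
    show "theta p (a i * q * q ^ n) \<noteq> 0" for i
      unfolding e1 by (rule gen2) (use N in \<open>simp add: n_def del: of_nat_sum\<close>)
    show "theta p (a i * q * q ^ n / q ^ k i) \<noteq> 0" for i
      unfolding e2 by (rule gen2) (use N kn[of i] in \<open>simp add: n_def del: of_nat_sum\<close>)
  qed auto
  then have "(\<Sum>i\<in>UNIV. u i) = 1" unfolding u_def e1 e2' e3 .
  \<comment> \<open>If \<open>k i = 0\<close>, then \<open>u i\<close> contains the factor
    \<open>\<theta>(1) = 0\<close>.\<close>
  moreover have "(\<Sum>i\<in>UNIV. u i) = (\<Sum>i\<in>{i. k i > 0}. u i)"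
    by (rule sum.mono_neutral_right) (auto simp: u_def)
  ultimately have "ell_multinomial q p a k = (\<Sum>i\<in>{i. k i > 0}. ell_multinomial q p a k * u i)"
    by (simp flip: sum_distrib_left)
  also have "\<dots> = (\<Sum>i\<in>{i. k i > 0}.
    ell_multinomial q p (qshift i a) (k(i := k i - 1))
      * insertion_coeff i (k(i := k i - 1)) (sorted_list_of_set UNIV) a)"
    by (rule sum.cong[OF refl], unfold u_def n_def, rule ell_multinomial_lower[OF gen N _ th, symmetric]) auto
  finally show ?thesis .
qed

end

section \<open>The field of totally elliptic functions is closed under its operations\<close>

lemma holomorphic_sv_on_const: "holomorphic_sv_on (\<lambda>x. c) U"
  unfolding holomorphic_sv_on_def by (auto intro!: exI[of _ "\<lambda>_. 0"])

lemma holomorphic_sv_on_add: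
  assumes "holomorphic_sv_on f U" "holomorphic_sv_on g U"
  shows "holomorphic_sv_on (\<lambda>x. f x + g x) U"
  unfolding holomorphic_sv_on_def
proof
  fix z assume "z \<in> U"
  then obtain D E where "(f has_derivative D) (at z)" "\<And>c v. D (c *s v) = c * D v"
    "(g has_derivative E) (at z)" "\<And>c v. E (c *s v) = c * E v"
    using assms unfolding holomorphic_sv_on_def by metis
  then show "\<exists>D. ((\<lambda>x. f x + g x) has_derivative D) (at z) \<and> (\<forall>c v. D (c *s v) = c * D v)"
    by (intro exI[of _ "\<lambda>v. D v + E v"]) (auto intro!: derivative_intros simp: algebra_simps)
qed

lemma holomorphic_sv_on_mult:
  assumes "holomorphic_sv_on f U" "holomorphic_sv_on g U"
  shows "holomorphic_sv_on (\<lambda>x. f x * g x) U"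
  unfolding holomorphic_sv_on_def
proof
  fix z assume "z \<in> U"
  then obtain D E where "(f has_derivative D) (at z)" "\<And>c v. D (c *s v) = c * D v"
    "(g has_derivative E) (at z)" "\<And>c v. E (c *s v) = c * E v"
    using assms unfolding holomorphic_sv_on_def by metis
  then show "\<exists>D. ((\<lambda>x. f x * g x) has_derivative D) (at z) \<and> (\<forall>c v. D (c *s v) = c * D v)"
    by (intro exI[of _ "\<lambda>v. f z * E v + D v * g z"] conjI has_derivative_mult) (simp_all add: algebra_simps)
qed

lemma holomorphic_sv_on_compose:
  assumes "holomorphic_sv_on f U" and "\<And>z. z \<in> U \<Longrightarrow> g field_differentiable at (f z)"
  shows "holomorphic_sv_on (\<lambda>x. g (f x)) U"
  unfolding holomorphic_sv_on_def
proof
  fix z assume z: "z \<in> U"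
  then obtain D where D: "(f has_derivative D) (at z)" "\<And>c v. D (c *s v) = c * D v"
    using assms(1) unfolding holomorphic_sv_on_def by blast
  obtain g' where "(g has_field_derivative g') (at (f z))"
    using assms(2)[OF z] unfolding field_differentiable_def by blast
  then have "((\<lambda>x. g (f x)) has_derivative (\<lambda>v. g' * D v)) (at z)"
    using has_derivative_compose[OF D(1)] by (simp add: has_field_derivative_def)
  then show "\<exists>D. ((\<lambda>x. g (f x)) has_derivative D) (at z) \<and> (\<forall>c v. D (c *s v) = c * D v)"
    by (intro exI[of _ "\<lambda>v. g' * D v"]) (simp add: D(2))
qed

lemma holomorphic_sv_on_nth: "holomorphic_sv_on (\<lambda>x. x $ i) U"
  unfolding holomorphic_sv_on_def
  by (auto intro!: exI[of _ "\<lambda>v. v $ i"] bounded_linear_imp_has_derivative bounded_linear_vec_nth)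

lemma holomorphic_sv_on_translate:
  assumes "holomorphic_sv_on f U"
  shows "holomorphic_sv_on (\<lambda>x. f (x + v)) ((+) (- v) ` U)"
  unfolding holomorphic_sv_on_def
proof
  fix z assume "z \<in> (+) (- v) ` U"
  then have "z + v \<in> U" by auto
  then obtain D where D: "(f has_derivative D) (at (z + v))" "\<And>c v. D (c *s v) = c * D v"
    using assms(1) unfolding holomorphic_sv_on_def by blast
  have "((\<lambda>x. x + v) has_derivative (\<lambda>h. h)) (at z)" by (auto intro!: derivative_eq_intros)
  from has_derivative_compose[OF this D(1)]
  show "\<exists>D. ((\<lambda>x. f (x + v)) has_derivative D) (at z) \<and> (\<forall>c v. D (c *s v) = c * D v)"
    using D(2) by blast
qed

lemma holomorphic_sv_on_subset: "holomorphic_sv_on f U \<Longrightarrow> V \<subseteq> U \<Longrightarrow> holomorphic_sv_on f V"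
  unfolding holomorphic_sv_on_def by blast

text \<open>The common pattern of sums and products of local quotients.\<close>

lemma is_meromorphic_combine:
  fixes f g :: "complex ^ 'r::finite \<Rightarrow> complex"
  assumes hol: "\<And>g1 h1 g2 h2 (U :: (complex ^ 'r) set). holomorphic_sv_on g1 U \<Longrightarrow> holomorphic_sv_on h1 U \<Longrightarrow>
      holomorphic_sv_on g2 U \<Longrightarrow> holomorphic_sv_on h2 U \<Longrightarrow> holomorphic_sv_on (\<lambda>x. G (g1 x) (h1 x) (g2 x) (h2 x)) U"
    and op: "\<And>a b c d. b \<noteq> 0 \<Longrightarrow> d \<noteq> 0 \<Longrightarrow> F (a / b) (c / d) = G a b c d / (b * d)"
    and f: "is_meromorphic (abs_gfun f)" and g: "is_meromorphic (abs_gfun g)"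
  shows "is_meromorphic (abs_gfun (\<lambda>x. F (f x) (g x)))"
  unfolding is_meromorphic.abs_eq
proof
  fix z
  from spec[OF f[unfolded is_meromorphic.abs_eq], of z] obtain U1 g1 h1 where 1: "open U1" "z \<in> U1" "holomorphic_sv_on g1 U1" "holomorphic_sv_on h1 U1"
    "generically_on U1 (\<lambda>x. h1 x \<noteq> 0 \<and> f x = g1 x / h1 x)"
    by blast
  from spec[OF g[unfolded is_meromorphic.abs_eq], of z] obtain U2 g2 h2 where 2: "open U2" "z \<in> U2" "holomorphic_sv_on g2 U2" "holomorphic_sv_on h2 U2"
    "generically_on U2 (\<lambda>x. h2 x \<noteq> 0 \<and> g x = g2 x / h2 x)"
    by blast
  let ?U = "U1 \<inter> U2"
  have U: "open ?U" "z \<in> ?U" using 1 2 by auto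
  have "holomorphic_sv_on g1 ?U" "holomorphic_sv_on h1 ?U" "holomorphic_sv_on g2 ?U" "holomorphic_sv_on h2 ?U"
    using 1 2 by (auto intro: holomorphic_sv_on_subset)
  note parts = this
  have "holomorphic_sv_on (\<lambda>x. G (g1 x) (h1 x) (g2 x) (h2 x)) ?U" by (rule hol[OF parts])
  moreover have "holomorphic_sv_on (\<lambda>x. h1 x * h2 x) ?U"
    by (rule holomorphic_sv_on_mult[OF parts(2,4)])
  moreover have "generically_on ?U (\<lambda>x. h1 x * h2 x \<noteq> 0 \<and>
      F (f x) (g x) = G (g1 x) (h1 x) (g2 x) (h2 x) / (h1 x * h2 x))"
    by (rule generically_on_mono[OF generically_on_conj[OF
        generically_on_open_subset[OF 1(5) U(1)] generically_on_open_subset[OF 2(5) U(1)]]])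
      (auto simp: op)
  ultimately show "\<exists>U g' h'. open U \<and> z \<in> U \<and> holomorphic_sv_on g' U \<and> holomorphic_sv_on h' U \<and>
      generically_on U (\<lambda>x. h' x \<noteq> 0 \<and> F (f x) (g x) = g' x / h' x)"
    using U by blast
qed

lemma gfun_rep:
  obtains f where "F = abs_gfun f"
  using Quotient_abs_rep[OF Quotient_gfun, of F] by metis

lemma is_meromorphic_add: "is_meromorphic F \<Longrightarrow> is_meromorphic G \<Longrightarrow> is_meromorphic (F + G)"
proof -
  assume *: "is_meromorphic F" "is_meromorphic G"
  obtain f where f: "F = abs_gfun f" by (rule gfun_rep)
  obtain g where g: "G = abs_gfun g" by (rule gfun_rep)
  show ?thesis using * unfolding f g plus_gfun.abs_eq
    by (intro is_meromorphic_combine[where G = "\<lambda>a b c d. a * d + c * b" and F = "(+)"])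
      (auto intro!: holomorphic_sv_on_add holomorphic_sv_on_mult simp: field_simps)
qed

lemma is_meromorphic_mult: "is_meromorphic F \<Longrightarrow> is_meromorphic G \<Longrightarrow> is_meromorphic (F * G)"
proof -
  assume *: "is_meromorphic F" "is_meromorphic G"
  obtain f where f: "F = abs_gfun f" by (rule gfun_rep)
  obtain g where g: "G = abs_gfun g" by (rule gfun_rep)
  show ?thesis using * unfolding f g times_gfun.abs_eq
    by (intro is_meromorphic_combine[where G = "\<lambda>a b c d. a * c" and F = "(*)"])
      (auto intro!: holomorphic_sv_on_mult)
qed

lemma is_meromorphic_quotient:
  assumes "holomorphic_sv_on g UNIV" "holomorphic_sv_on h UNIV" "generically_on UNIV (\<lambda>x. h x \<noteq> 0)"
  shows "is_meromorphic (abs_gfun (\<lambda>x. g x / h x))"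
  unfolding is_meromorphic.abs_eq using assms
  by (intro allI exI[of _ UNIV] exI[of _ g] exI[of _ h]) auto

lemma is_meromorphic_const: "is_meromorphic (const_gfun c)"
  using is_meromorphic_quotient[OF holomorphic_sv_on_const[of c] holomorphic_sv_on_const[of 1]]
  by (simp add: const_gfun.abs_eq generically_on_always)

lemma is_meromorphic_translate:
  assumes "is_meromorphic F" shows "is_meromorphic (translate v F)"
proof -
  obtain f where F: "F = abs_gfun f" by (rule gfun_rep)
  show ?thesis unfolding F translate.abs_eq is_meromorphic.abs_eq
  proof
    fix z
    from spec[OF assms[unfolded F is_meromorphic.abs_eq], of "z + v"] obtain U g h where 1: "open U" "z + v \<in> U" "holomorphic_sv_on g U" "holomorphic_sv_on h U"
      "generically_on U (\<lambda>x. h x \<noteq> 0 \<and> f x = g x / h x)"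
      by blast
    let ?V = "(+) (- v) ` U"
    have "open ?V" using 1(1) by (rule open_translation)
    moreover have "z \<in> ?V" using 1(2) by (auto simp: image_iff algebra_simps intro!: bexI[of _ "z + v"])
    moreover have "generically_on ?V (\<lambda>x. h (x + v) \<noteq> 0 \<and> f (x + v) = g (x + v) / h (x + v))"
    proof -
      have "{x \<in> ?V. h (x + v) \<noteq> 0 \<and> f (x + v) = g (x + v) / h (x + v)} =
          (+) (- v) ` {x \<in> U. h x \<noteq> 0 \<and> f x = g x / h x}"
        by (auto simp: image_iff algebra_simps)
      then show ?thesis using 1(5) unfolding generically_on_def
        by (simp only: interior_translation closure_translation) (rule image_mono)
    qed
    ultimately show "\<exists>U g h. open U \<and> z \<in> U \<and> holomorphic_sv_on g U \<and> holomorphic_sv_on h U \<and>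
        generically_on U (\<lambda>x. h x \<noteq> 0 \<and> f (x + v) = g x / h x)"
      using holomorphic_sv_on_translate[OF 1(3), of v] holomorphic_sv_on_translate[OF 1(4), of v] by blast
  qed
qed

lemma translate_add: "translate v (F + G) = translate v F + translate v G"
  by transfer (simp add: generically_on_always)

lemma translate_mult: "translate v (F * G) = translate v F * translate v G"
  by transfer (simp add: generically_on_always)

lemma translate_const: "translate v (const_gfun c) = const_gfun c"
  by transfer (simp add: generically_on_always)

lemma translate_commute: "translate v (translate w F) = translate w (translate v F)"
  by transfer (simp add: generically_on_always ac_simps)

lemma const_gfun_one: "const_gfun 1 = 1"
  by transfer (simp add: generically_on_always)

lemma totally_elliptic_add:
  "f \<in> totally_elliptic \<sigma> \<tau> \<Longrightarrow> g \<in> totally_elliptic \<sigma> \<tau> \<Longrightarrow> f + g \<in> totally_elliptic \<sigma> \<tau>"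
  unfolding totally_elliptic_def by (simp add: is_meromorphic_add translate_add)

lemma totally_elliptic_mult:
  "f \<in> totally_elliptic \<sigma> \<tau> \<Longrightarrow> g \<in> totally_elliptic \<sigma> \<tau> \<Longrightarrow> f * g \<in> totally_elliptic \<sigma> \<tau>"
  unfolding totally_elliptic_def by (simp add: is_meromorphic_mult translate_mult)

lemma totally_elliptic_const: "const_gfun c \<in> totally_elliptic \<sigma> \<tau>"
  unfolding totally_elliptic_def by (simp add: is_meromorphic_const translate_const)

lemma totally_elliptic_one: "1 \<in> totally_elliptic \<sigma> \<tau>"
  using totally_elliptic_const[of 1] by (simp add: const_gfun_one)

lemma totally_elliptic_translate:
  "f \<in> totally_elliptic \<sigma> \<tau> \<Longrightarrow> translate v f \<in> totally_elliptic \<sigma> \<tau>"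
  unfolding totally_elliptic_def
  by (simp add: is_meromorphic_translate) (metis translate_commute)

lemma totally_elliptic_sum:
  fixes f :: "'i \<Rightarrow> 'r::finite gfun"
  assumes "finite A" "\<And>x. x \<in> A \<Longrightarrow> f x \<in> totally_elliptic \<sigma> \<tau>"
  shows "sum f A \<in> totally_elliptic \<sigma> \<tau>"
proof -
  have "(0 :: 'r gfun) = const_gfun 0" by transfer (simp add: generically_on_always)
  then have zero: "(0 :: 'r gfun) \<in> totally_elliptic \<sigma> \<tau>"
    by (rule ssubst) (rule totally_elliptic_const)
  show ?thesis using assms
    by (induction A rule: finite_induct) (auto intro: totally_elliptic_add simp: zero)
qed

lemma totally_elliptic_prod:
  assumes "finite A" "\<And>x. x \<in> A \<Longrightarrow> f x \<in> totally_elliptic \<sigma> \<tau>"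
  shows "prod f A \<in> totally_elliptic \<sigma> \<tau>"
  using assms by (induction A rule: finite_induct) (auto intro: totally_elliptic_mult totally_elliptic_one)

lemma norm_axis: "norm (axis i (t :: complex)) = norm t"
proof -
  have "(\<Sum>j\<in>UNIV. (norm (axis i t $ j))\<^sup>2) = (\<Sum>j\<in>UNIV. if j = i then (norm t)\<^sup>2 else 0)"
    by (intro sum.cong) (auto simp: axis_def)
  then show ?thesis by (simp add: norm_vec_def L2_set_def)
qed

section \<open>Weights and multinomial coefficients as totally elliptic functions\<close>

lemma generically_on_Ball:
  assumes "finite A" "open U" "\<And>a. a \<in> A \<Longrightarrow> generically_on U (P a)"
  shows "generically_on U (\<lambda>x. \<forall>a\<in>A. P a x)"
  using assms(1,3)
proof (induction A rule: finite_induct)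
  case empty
  then show ?case by (simp add: generically_on_always assms(2))
next
  case (insert a A)
  then show ?case using generically_on_conj[of U "P a" "\<lambda>x. \<forall>a\<in>A. P a x"] by simp
qed

definition shift_vec :: "'r \<Rightarrow> complex ^ 'r::finite" where
  "shift_vec i = (\<chi> l. if l = i then 1 else 2)"

locale elliptic_parameters =
  fixes \<sigma> \<tau> p q :: complex
  assumes \<sigma>: "\<sigma> \<noteq> 0"
    and q_eq: "q = exp (2 * of_real pi * \<i> * \<sigma>)"
    and p_eq: "p = exp (2 * of_real pi * \<i> * \<tau>)"
    and p_norm: "norm p < 1"
begin

sublocale elliptic_nome p q
  by standard (use p_norm in \<open>auto simp: p_eq q_eq\<close>)

text \<open>A function of \<open>a\<^sub>1, \<dots>, a\<^sub>r\<close> as a function of their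
  logarithms to the base \<open>q\<close>.\<close>

definition fun_of_avar :: "(('r \<Rightarrow> complex) \<Rightarrow> complex) \<Rightarrow> 'r::finite gfun" where
  "fun_of_avar F = abs_gfun (\<lambda>x. F (avar \<sigma> x))"

lemma avar_nz: "avar \<sigma> x i \<noteq> 0"
  by (simp add: avar_def)

lemma avar_shift_vec: "avar \<sigma> (x + shift_vec i) = qshift i (avar \<sigma> x)"
proof
  fix l
  have "exp (2 * of_real pi * \<i> * \<sigma> * (x $ l + (if l = i then 1 else 2))) =
      exp (2 * of_real pi * \<i> * \<sigma> * x $ l) * q ^ (if l = i then 1 else 2)"
    by (simp add: q_eq algebra_simps power2_eq_square flip: exp_add)
  then show "avar \<sigma> (x + shift_vec i) l = qshift i (avar \<sigma> x) l"
    by (simp add: avar_def qshift_def shift_vec_def)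
qed

lemma avar_period_1: "avar \<sigma> (x + axis l (1 / \<sigma>)) = avar \<sigma> x"
proof
  fix j
  have "exp (2 * of_real pi * \<i> * \<sigma> * (x $ l + 1 / \<sigma>)) = exp (2 * of_real pi * \<i> * \<sigma> * x $ l)"
    using \<sigma> by (simp add: distrib_left exp_add)
  then show "avar \<sigma> (x + axis l (1 / \<sigma>)) j = avar \<sigma> x j"
    by (cases "j = l") (simp_all add: avar_def axis_def)
qed

lemma avar_period_2: "avar \<sigma> (x + axis l (\<tau> / \<sigma>)) = (avar \<sigma> x)(l := p * avar \<sigma> x l)"
proof
  fix j
  have "exp (2 * of_real pi * \<i> * \<sigma> * (x $ l + \<tau> / \<sigma>)) = p * exp (2 * of_real pi * \<i> * \<sigma> * x $ l)"
    using \<sigma> by (simp add: p_eq distrib_left exp_add mult_ac)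
  then show "avar \<sigma> (x + axis l (\<tau> / \<sigma>)) j = ((avar \<sigma> x)(l := p * avar \<sigma> x l)) j"
    by (cases "j = l") (simp_all add: avar_def axis_def)
qed

text \<open>Along the \<open>i\<close>-th coordinate axis the theta function is a nonconstant
  holomorphic function of one variable, so its zeros are isolated there; hence the complement of
  the zero set is dense.\<close>

lemma generically_theta_nonzero:
  fixes \<phi> :: "complex ^ 'r::finite \<Rightarrow> complex"
  assumes c: "c \<noteq> 0" and \<phi>: "continuous_on UNIV \<phi>" "\<And>x t. \<phi> (x + axis i t) = \<phi> x + t"
  shows "generically_on UNIV (\<lambda>x. theta p (c * exp (2 * of_real pi * \<i> * \<sigma> * \<phi> x)) \<noteq> 0)"
proof -
  define \<kappa> where "\<kappa> = 2 * of_real pi * \<i> * \<sigma>"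
  have \<kappa>: "\<kappa> \<noteq> 0" using \<sigma> by (simp add: \<kappa>_def)
  let ?S = "{x. theta p (c * exp (\<kappa> * \<phi> x)) \<noteq> 0}"
  have "continuous_on UNIV (\<lambda>x. theta p (c * exp (\<kappa> * \<phi> x)))"
    by (rule continuous_on_compose2[OF holomorphic_on_imp_continuous_on[OF theta_holomorphic]])
      (use c in \<open>auto intro!: continuous_intros \<phi>(1)\<close>)
  then have "open ?S" by (intro open_Collect_neq continuous_on_const)
  moreover have "x \<in> closure ?S" for x
    unfolding closure_approachable
  proof (intro allI impI)
    fix e :: real assume e: "e > 0"
    obtain b where b: "theta p b \<noteq> 0" "b \<noteq> 0"
      using eventually_happens[OF theta_eventually_nonzero[of 1]] by auto
    \<comment> \<open>On the line through \<open>x\<close> the theta function takes the value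
      \<open>\<theta>(b)\<close>, so it does not vanish identically there.\<close>
    define t0 where "t0 = Ln (b / (c * exp (\<kappa> * \<phi> x))) / \<kappa>"
    let ?g = "\<lambda>t. theta p (c * exp (\<kappa> * (\<phi> x + t)))"
    have "?g holomorphic_on UNIV" using c by (intro holomorphic_intros) auto
    moreover have "c * exp (\<kappa> * (\<phi> x + t0)) = b"
      using b(2) c \<kappa> by (simp add: t0_def distrib_left exp_add)
    then have "?g t0 \<noteq> 0" using b(1) by simp
    ultimately have "\<forall>\<^sub>F t in at 0. ?g t \<noteq> 0 \<and> t \<in> UNIV"
      by (intro non_zero_neighbour_alt[where \<beta> = t0]) auto
    moreover have "\<forall>\<^sub>F t in at (0::complex). norm t < e"
      using e by (auto simp: eventually_at dist_norm)
    ultimately have "\<forall>\<^sub>F t in at 0. ?g t \<noteq> 0 \<and> norm t < e" by eventually_elim simp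
    then obtain t where "?g t \<noteq> 0" "norm t < e" using eventually_happens[of _ "at (0::complex)"] by auto
    then show "\<exists>y\<in>?S. dist y x < e"
      by (intro bexI[of _ "x + axis i t"]) (auto simp: \<phi>(2) dist_norm norm_axis)
  qed
  ultimately show ?thesis
    by (auto simp: generically_on_def interior_open \<kappa>_def)
qed

lemma generically_theta_avar:
  fixes i j :: "'r::finite"
  shows "c \<noteq> 0 \<Longrightarrow> generically_on UNIV (\<lambda>x. theta p (avar \<sigma> x i * c) \<noteq> 0)"
    and "c \<noteq> 0 \<Longrightarrow> i \<noteq> j \<Longrightarrow> generically_on UNIV (\<lambda>x. theta p (avar \<sigma> x i * c / avar \<sigma> x j) \<noteq> 0)"
proof -
  assume c: "c \<noteq> 0"
  show "generically_on UNIV (\<lambda>x. theta p (avar \<sigma> x i * c) \<noteq> 0)"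
    using generically_theta_nonzero[OF c, of "\<lambda>x. x $ i" i]
    by (simp add: avar_def mult.commute continuous_on_component axis_def)
  have eq: "avar \<sigma> x i * c / avar \<sigma> x j = c * exp (2 * of_real pi * \<i> * \<sigma> * (x $ i - x $ j))" for x
    by (simp add: avar_def right_diff_distrib exp_diff)
  assume "i \<noteq> j"
  then show "generically_on UNIV (\<lambda>x. theta p (avar \<sigma> x i * c / avar \<sigma> x j) \<noteq> 0)"
    unfolding eq
    by (intro generically_theta_nonzero[OF c, where i = i])
      (auto simp: continuous_on_component continuous_on_diff axis_def)
qed

lemma generically_generic: "generically_on UNIV (\<lambda>x. generic N (avar \<sigma> x :: 'r::finite \<Rightarrow> complex))"
proof -
  let ?M = "{- int N..int N}"
  have "generically_on UNIV (\<lambda>x. \<forall>im\<in>(UNIV :: 'r set) \<times> ?M. theta p (avar \<sigma> x (fst im) * q powi snd im) \<noteq> 0)"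
    using q_nz by (intro generically_on_Ball generically_theta_avar) auto
  moreover have "generically_on UNIV (\<lambda>x. \<forall>ijm\<in>{(i, j, m). (i :: 'r) \<noteq> j \<and> m \<in> ?M}.
      theta p (avar \<sigma> x (fst ijm) * q powi snd (snd ijm) / avar \<sigma> x (fst (snd ijm))) \<noteq> 0)"
  proof (rule generically_on_Ball)
    show "finite {(i, j, m). (i :: 'r) \<noteq> j \<and> m \<in> ?M}"
      by (rule finite_subset[of _ "UNIV \<times> UNIV \<times> ?M"]) auto
  qed (use q_nz in \<open>auto intro!: generically_theta_avar\<close>)
  ultimately show ?thesis
    by (rule generically_on_mono[OF generically_on_conj]) (auto simp: generic_def avar_nz abs_le_iff)
qed

lemma ell_weight_1_1:
  "ell_weight q p a b 1 1 = (theta p (a * q ^ 3) * theta p (b * q) * theta p (a * (1 / q) / b))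
     / (theta p (a * q) * theta p (b * q ^ 3) * theta p (a * q / b)) * q"
  by (simp add: ell_weight_def power_int_minus divide_inverse)

text \<open>Each parameter occurs in four of the six theta functions, and the four factors from
  quasi-periodicity cancel.\<close>

lemma ell_weight_p_left:
  assumes "a \<noteq> 0" "b \<noteq> 0"
  shows "ell_weight q p (p * a) b 1 1 = ell_weight q p a b 1 1"
proof -
  have "theta p (p * a * x) = - theta p (a * x) / (a * x)"
    "theta p (p * a * x / b) = - theta p (a * x / b) / (a * x / b)" if "x \<noteq> 0" for x
    using theta_p_mult[of "a * x"] theta_p_mult[of "a * x / b"] assms that by (simp_all add: mult_ac)
  note shift = this
  have "q ^ 3 \<noteq> 0" "1 / q \<noteq> 0" using q_nz by auto
  then show ?thesis
    unfolding ell_weight_1_1 shift(1)[OF \<open>q ^ 3 \<noteq> 0\<close>] shift(1)[OF q_nz]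
      shift(2)[OF \<open>1 / q \<noteq> 0\<close>] shift(2)[OF q_nz]
    using assms q_nz by (simp add: eval_nat_numeral mult_ac)
qed

lemma ell_weight_p_right:
  assumes "a \<noteq> 0" "b \<noteq> 0"
  shows "ell_weight q p a (p * b) 1 1 = ell_weight q p a b 1 1"
proof -
  have "theta p (p * b * x) = - theta p (b * x) / (b * x)"
    "theta p (a * x / (p * b)) = - (a * x / b / p) * theta p (a * x / b)" if "x \<noteq> 0" for x
    using theta_p_mult[of "b * x"] theta_p_div[of "a * x / b"] assms that by (simp_all add: mult_ac)
  note shift = this
  have "q ^ 3 \<noteq> 0" "1 / q \<noteq> 0" using q_nz by auto
  then show ?thesis
    unfolding ell_weight_1_1 shift(1)[OF \<open>q ^ 3 \<noteq> 0\<close>] shift(1)[OF q_nz]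
      shift(2)[OF \<open>1 / q \<noteq> 0\<close>] shift(2)[OF q_nz]
    using assms q_nz p_nz by (simp add: eval_nat_numeral mult_ac)
qed

lemma holomorphic_sv_on_theta:
  assumes "\<And>x. f x \<noteq> 0" "holomorphic_sv_on f UNIV"
  shows "holomorphic_sv_on (\<lambda>x. theta p (f x)) UNIV"
  by (rule holomorphic_sv_on_compose[OF assms(2)])
    (use assms(1) in \<open>auto intro!: holomorphic_on_imp_differentiable_at[OF theta_holomorphic]\<close>)

lemma holomorphic_sv_on_avar: "holomorphic_sv_on (\<lambda>x. avar \<sigma> x i) U"
  unfolding avar_def
  by (rule holomorphic_sv_on_compose[OF holomorphic_sv_on_nth, where g = "\<lambda>t. exp (2 * of_real pi * \<i> * \<sigma> * t)"])
    (auto intro!: derivative_eq_intros simp: field_differentiable_def)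

lemma holomorphic_sv_on_avar_inverse: "holomorphic_sv_on (\<lambda>x. 1 / avar \<sigma> x i) U"
  by (rule holomorphic_sv_on_compose[OF holomorphic_sv_on_avar, where g = "\<lambda>t. 1 / t"])
    (auto intro!: field_differentiable_divide simp: avar_nz)

lemma weight_fun_eq: "weight_fun \<sigma> \<tau> i j 1 1 = fun_of_avar (\<lambda>a. ell_weight q p (a i) (a j) 1 1)"
  by (simp add: weight_fun_def fun_of_avar_def q_eq p_eq)

lemma weight_fun_totally_elliptic:
  fixes i j :: "'r::finite"
  assumes ij: "i \<noteq> j"
  shows "weight_fun \<sigma> \<tau> i j 1 1 \<in> totally_elliptic \<sigma> \<tau>"
proof -
  let ?a = "\<lambda>x. avar \<sigma> x i" and ?b = "\<lambda>x. avar \<sigma> x j"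
  let ?h = "\<lambda>x. theta p (?a x * q) * (theta p (?b x * q ^ 3) * theta p (?a x * q / ?b x))"
  let ?g = "\<lambda>x. q * (theta p (?a x * q ^ 3) * (theta p (?b x * q) * theta p (?a x * (1 / q) / ?b x)))"
  have hol: "holomorphic_sv_on (\<lambda>x. theta p (avar \<sigma> x l * c)) UNIV"
    "holomorphic_sv_on (\<lambda>x. theta p (avar \<sigma> x l * c / avar \<sigma> x m)) UNIV" if "c \<noteq> 0" for l m :: 'r and c
  proof -
    show "holomorphic_sv_on (\<lambda>x. theta p (avar \<sigma> x l * c)) UNIV"
      using that by (intro holomorphic_sv_on_theta holomorphic_sv_on_mult holomorphic_sv_on_avar
          holomorphic_sv_on_const) (auto simp: avar_nz)
    have "holomorphic_sv_on (\<lambda>x. theta p (avar \<sigma> x l * c * (1 / avar \<sigma> x m))) UNIV"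
      using that by (intro holomorphic_sv_on_theta holomorphic_sv_on_mult holomorphic_sv_on_avar
          holomorphic_sv_on_const holomorphic_sv_on_avar_inverse) (auto simp: avar_nz)
    then show "holomorphic_sv_on (\<lambda>x. theta p (avar \<sigma> x l * c / avar \<sigma> x m)) UNIV" by simp
  qed
  have "is_meromorphic (abs_gfun (\<lambda>x. ?g x / ?h x))"
  proof (rule is_meromorphic_quotient)
    show "holomorphic_sv_on ?g UNIV" "holomorphic_sv_on ?h UNIV"
      using q_nz by (intro holomorphic_sv_on_mult holomorphic_sv_on_const hol; simp)+
    have "generically_on UNIV (\<lambda>x. theta p (?a x * q) \<noteq> 0 \<and>
        (theta p (?b x * q ^ 3) \<noteq> 0 \<and> theta p (?a x * q / ?b x) \<noteq> 0))"
      using q_nz ij by (intro generically_on_conj generically_theta_avar) auto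
    then show "generically_on UNIV (\<lambda>x. ?h x \<noteq> 0)" by (rule generically_on_mono) auto
  qed
  moreover have "weight_fun \<sigma> \<tau> i j 1 1 = abs_gfun (\<lambda>x. ?g x / ?h x)"
    unfolding weight_fun_eq fun_of_avar_def ell_weight_1_1 by (simp add: mult_ac)
  moreover have "translate (axis l (1 / \<sigma>)) (weight_fun \<sigma> \<tau> i j 1 1) = weight_fun \<sigma> \<tau> i j 1 1" for l
    unfolding weight_fun_eq fun_of_avar_def translate.abs_eq avar_period_1 ..
  moreover have "translate (axis l (\<tau> / \<sigma>)) (weight_fun \<sigma> \<tau> i j 1 1) = weight_fun \<sigma> \<tau> i j 1 1" for l
  proof -
    have "ell_weight q p (((avar \<sigma> x)(l := p * avar \<sigma> x l)) i) (((avar \<sigma> x)(l := p * avar \<sigma> x l)) j) 1 1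
        = ell_weight q p (avar \<sigma> x i) (avar \<sigma> x j) 1 1" for x
      using ij by (auto simp: ell_weight_p_left ell_weight_p_right avar_nz)
    then show ?thesis
      unfolding weight_fun_eq fun_of_avar_def translate.abs_eq avar_period_2 by simp
  qed
  ultimately show ?thesis by (simp add: totally_elliptic_def)
qed

lemma translate_fun_of_avar: "translate (shift_vec i) (fun_of_avar F) = fun_of_avar (\<lambda>a. F (qshift i a))"
  by (simp add: fun_of_avar_def translate.abs_eq avar_shift_vec)

lemma translate_funpow_fun_of_avar:
  "(translate (shift_vec i) ^^ s) (fun_of_avar F) = fun_of_avar (\<lambda>a. F ((qshift i ^^ s) a))"
  by (induction s arbitrary: F) (simp_all add: translate_fun_of_avar funpow_swap1)

lemma fun_of_avar_mult: "fun_of_avar F * fun_of_avar G = fun_of_avar (\<lambda>a. F a * G a)"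
  by (simp add: fun_of_avar_def times_gfun.abs_eq)

lemma fun_of_avar_one: "fun_of_avar (\<lambda>a. 1) = 1"
  by (simp add: fun_of_avar_def one_gfun.abs_eq)

lemma fun_of_avar_prod: "finite A \<Longrightarrow> (\<Prod>x\<in>A. fun_of_avar (F x)) = fun_of_avar (\<lambda>a. \<Prod>x\<in>A. F x a)"
  by (induction A rule: finite_induct) (simp_all add: fun_of_avar_one fun_of_avar_mult)

lemma fun_of_avar_sum: "finite A \<Longrightarrow> (\<Sum>x\<in>A. fun_of_avar (F x)) = fun_of_avar (\<lambda>a. \<Sum>x\<in>A. F x a)"
proof (induction A rule: finite_induct)
  case empty
  then show ?case by (simp add: fun_of_avar_def zero_gfun.abs_eq)
next
  case (insert x A)
  then show ?case by (simp add: fun_of_avar_def plus_gfun.abs_eq)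
qed

text \<open>\<open>swap_weight\<close> as an element of the field of coefficients, written with
  the operations of the algebra.\<close>

definition swap_fun :: "'r \<Rightarrow> 'r \<Rightarrow> nat \<Rightarrow> 'r::finite gfun" where
  "swap_fun l i m = (\<Prod>s<m. (translate (shift_vec l) ^^ s) (weight_fun \<sigma> \<tau> l i 1 1))"

text \<open>\<open>insertion_coeff\<close> as an element of the field of coefficients.\<close>

fun insertion_fun :: "'r \<Rightarrow> ('r \<Rightarrow> nat) \<Rightarrow> 'r list \<Rightarrow> 'r::finite gfun" where
  "insertion_fun i k [] = 1"
| "insertion_fun i k (l # ls) = (if l = i then 1 else
     swap_fun l i (k l) * (translate (shift_vec l) ^^ k l) (insertion_fun i k ls))"

lemma totally_elliptic_translate_funpow:
  "f \<in> totally_elliptic \<sigma> \<tau> \<Longrightarrow> (translate v ^^ s) f \<in> totally_elliptic \<sigma> \<tau>"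
  by (induction s) (simp_all add: totally_elliptic_translate)

lemma swap_fun_totally_elliptic: "l \<noteq> i \<Longrightarrow> swap_fun l i m \<in> totally_elliptic \<sigma> \<tau>"
  unfolding swap_fun_def
  by (intro totally_elliptic_prod totally_elliptic_translate_funpow weight_fun_totally_elliptic) auto

lemma insertion_fun_totally_elliptic: "insertion_fun i k ls \<in> totally_elliptic \<sigma> \<tau>"
  by (induction ls) (auto intro!: totally_elliptic_one totally_elliptic_mult swap_fun_totally_elliptic
      totally_elliptic_translate_funpow)

lemma swap_fun_eq: "l \<noteq> i \<Longrightarrow> swap_fun l i m = fun_of_avar (\<lambda>a. swap_weight (a l) (a i) m)"
  by (simp add: swap_fun_def swap_weight_def weight_fun_eq translate_funpow_fun_of_avar
      fun_of_avar_prod qshift_funpow)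

lemma insertion_fun_eq: "insertion_fun i k ls = fun_of_avar (insertion_coeff i k ls)"
proof (induction ls)
  case Nil
  then show ?case by (simp add: fun_of_avar_one flip: insertion_coeff.simps(1)[abs_def])
next
  case (Cons l ls)
  show ?case
  proof (cases "l = i")
    case True
    then have "insertion_coeff i k (l # ls) = (\<lambda>a. 1)" by (simp add: fun_eq_iff)
    then show ?thesis using True by (simp add: fun_of_avar_one)
  next
    case False
    then have "insertion_coeff i k (l # ls) =
        (\<lambda>a. swap_weight (a l) (a i) (k l) * insertion_coeff i k ls ((qshift l ^^ k l) a))"
      by (simp add: fun_eq_iff)
    then show ?thesis using False
      by (simp add: Cons.IH swap_fun_eq translate_funpow_fun_of_avar fun_of_avar_mult)
  qed
qed

lemma multinomial_fun_eq:
  fixes k :: "'r::{finite,linorder} \<Rightarrow> nat"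
  shows "multinomial_fun \<sigma> \<tau> k = fun_of_avar (\<lambda>a. ell_multinomial q p a k)"
  by (simp add: multinomial_fun_def fun_of_avar_def q_eq p_eq)

lemma multinomial_fun_zero: "multinomial_fun \<sigma> \<tau> (\<lambda>_ :: 'r::{finite,linorder}. 0) = 1"
proof -
  have "ell_multinomial q p a (\<lambda>_. 0) = 1" for a :: "'r \<Rightarrow> complex"
    by (simp add: ell_multinomial_def ell_poch_def)
  then show ?thesis by (simp add: multinomial_fun_eq fun_of_avar_one)
qed

theorem multinomial_fun_recursion:
  fixes k :: "'r::{finite,linorder} \<Rightarrow> nat"
  assumes th: "ell_poch q p q (sum k UNIV) \<noteq> 0" and pos: "sum k UNIV > 0"
  shows "multinomial_fun \<sigma> \<tau> k = (\<Sum>i\<in>{i. k i > 0}.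
    translate (shift_vec i) (multinomial_fun \<sigma> \<tau> (k(i := k i - 1)))
      * insertion_fun i (k(i := k i - 1)) (sorted_list_of_set UNIV))"
proof -
  have "generically_on UNIV (\<lambda>x :: (complex, 'r) vec. ell_multinomial q p (avar \<sigma> x) k = (\<Sum>i\<in>{i. k i > 0}.
    ell_multinomial q p (qshift i (avar \<sigma> x)) (k(i := k i - 1))
      * insertion_coeff i (k(i := k i - 1)) (sorted_list_of_set UNIV) (avar \<sigma> x)))"
    by (rule generically_on_mono[OF generically_generic])
      (rule ell_multinomial_recursion[OF _ order_refl ell_poch_theta_nonzero[OF th] pos])
  then have "multinomial_fun \<sigma> \<tau> k = fun_of_avar (\<lambda>a. \<Sum>i\<in>{i. k i > 0}.
    ell_multinomial q p (qshift i a) (k(i := k i - 1))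
      * insertion_coeff i (k(i := k i - 1)) (sorted_list_of_set UNIV) a)"
    unfolding multinomial_fun_eq fun_of_avar_def gfun.abs_eq_iff .
  also have "\<dots> = (\<Sum>i\<in>{i. k i > 0}.
    translate (shift_vec i) (multinomial_fun \<sigma> \<tau> (k(i := k i - 1)))
      * insertion_fun i (k(i := k i - 1)) (sorted_list_of_set UNIV))"
    unfolding multinomial_fun_eq insertion_fun_eq translate_fun_of_avar fun_of_avar_mult
    by (rule fun_of_avar_sum[symmetric]) simp
  finally show ?thesis .
qed

lemma ell_poch_nonzero_pred: "ell_poch q p q (Suc n) \<noteq> 0 \<Longrightarrow> ell_poch q p q n \<noteq> 0"
  by (auto simp: ell_poch_Suc)

text \<open>By the recursion the coefficients are obtained from the weights by sums, products
  and translations, all of which preserve total ellipticity.\<close>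

corollary multinomial_fun_totally_elliptic:
  fixes k :: "'r::{finite,linorder} \<Rightarrow> nat"
  assumes "ell_poch q p q (sum k UNIV) \<noteq> 0"
  shows "multinomial_fun \<sigma> \<tau> k \<in> totally_elliptic \<sigma> \<tau>"
  using assms
proof (induction "sum k UNIV" arbitrary: k)
  case 0
  then have "k = (\<lambda>_. 0)" by (simp add: fun_eq_iff)
  then show ?case by (simp add: multinomial_fun_zero totally_elliptic_one)
next
  case (Suc n)
  have "multinomial_fun \<sigma> \<tau> (k(i := k i - 1)) \<in> totally_elliptic \<sigma> \<tau>" if "k i > 0" for i
  proof (rule Suc.hyps(1))
    have "sum (k(i := k i - 1)) (UNIV - {i}) = sum k (UNIV - {i})" by (rule sum.cong) auto
    then show n: "n = sum (k(i := k i - 1)) UNIV"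
      using Suc.hyps(2) that sum.remove[of UNIV i k] sum.remove[of UNIV i "k(i := k i - 1)"] by simp
    show "ell_poch q p q (sum (k(i := k i - 1)) UNIV) \<noteq> 0"
      using Suc.prems Suc.hyps(2) ell_poch_nonzero_pred n by metis
  qed
  moreover have "sum k UNIV > 0" using Suc.hyps(2) by simp
  ultimately show ?case
    unfolding multinomial_fun_recursion[OF Suc.prems \<open>sum k UNIV > 0\<close>]
    by (intro totally_elliptic_sum totally_elliptic_mult totally_elliptic_translate
        insertion_fun_totally_elliptic) auto
qed

end

section \<open>Free algebra, relations and quotient\<close>

lemma keys_uminus_complex: "Poly_Mapping.keys (- P) = Poly_Mapping.keys (P :: 'a \<Rightarrow>\<^sub>0 complex)"
  by (simp add: set_eq_iff in_keys_iff)

lemma carrier_free_algebra: "P \<in> carrier (free_algebra G) \<longleftrightarrow> (\<forall>w\<in>Poly_Mapping.keys P. set w \<subseteq> G)"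
  by (simp add: free_algebra_def)

lemma free_algebra_closed:
  assumes "P \<in> carrier (free_algebra G)" "Q \<in> carrier (free_algebra G)"
  shows "P + Q \<in> carrier (free_algebra G)" "P * Q \<in> carrier (free_algebra G)"
    "- P \<in> carrier (free_algebra G)" "P - Q \<in> carrier (free_algebra G)"
proof -
  have add: "P + Q \<in> carrier (free_algebra G)" if "P \<in> carrier (free_algebra G)" "Q \<in> carrier (free_algebra G)" for P Q
    using that keys_add[of P Q] unfolding carrier_free_algebra by blast
  show "P * Q \<in> carrier (free_algebra G)"
    unfolding carrier_free_algebra
  proof
    fix w assume "w \<in> Poly_Mapping.keys (P * Q)"
    then obtain u v where "u \<in> Poly_Mapping.keys P" "v \<in> Poly_Mapping.keys Q" "w = u + v"
      using keys_mult[of P Q] by blast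
    then show "set w \<subseteq> G"
      using assms unfolding carrier_free_algebra by (auto simp: plus_list_def)
  qed
  have uminus: "- P \<in> carrier (free_algebra G)" if "P \<in> carrier (free_algebra G)" for P
    using that by (simp add: carrier_free_algebra keys_uminus_complex)
  show "P + Q \<in> carrier (free_algebra G)" by (rule add[OF assms])
  show "- P \<in> carrier (free_algebra G)" by (rule uminus[OF assms(1)])
  show "P - Q \<in> carrier (free_algebra G)"
    using add[OF assms(1) uminus[OF assms(2)]] by simp
qed

lemma single_in_free_algebra: "set w \<subseteq> G \<Longrightarrow> Poly_Mapping.single w c \<in> carrier (free_algebra G)"
  by (simp add: carrier_free_algebra)

lemma free_algebra_sel [simp]:
  "x \<otimes>\<^bsub>free_algebra G\<^esub> y = x * y" "x \<oplus>\<^bsub>free_algebra G\<^esub> y = x + y"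
  "\<one>\<^bsub>free_algebra G\<^esub> = 1" "\<zero>\<^bsub>free_algebra G\<^esub> = 0"
  by (simp_all add: free_algebra_def)

lemma free_algebra_ring: "ring (free_algebra G)"
proof (rule ringI)
  have zero: "0 \<in> carrier (free_algebra G)" by (simp add: carrier_free_algebra)
  show "abelian_group (free_algebra G)"
  proof (rule abelian_groupI)
    fix x assume "x \<in> carrier (free_algebra G)"
    then show "\<exists>y\<in>carrier (free_algebra G). y \<oplus>\<^bsub>free_algebra G\<^esub> x = \<zero>\<^bsub>free_algebra G\<^esub>"
      by (intro bexI[of _ "- x"]) (simp_all add: free_algebra_closed(3)[of x G x])
  qed (auto simp: zero free_algebra_closed ac_simps)
  have "1 \<in> carrier (free_algebra G)"
    by (simp add: carrier_free_algebra zero_list_def)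
  then show "Group.monoid (free_algebra G)"
    by (intro Group.monoidI) (auto simp: free_algebra_closed mult.assoc)
qed (auto simp: algebra_simps)

lemma free_algebra_a_minus:
  assumes "x \<in> carrier (free_algebra G)" "y \<in> carrier (free_algebra G)"
  shows "x \<ominus>\<^bsub>free_algebra G\<^esub> y = x - y"
proof -
  interpret ring "free_algebra G" by (rule free_algebra_ring)
  have "\<ominus>\<^bsub>free_algebra G\<^esub> y = - y"
    by (rule minus_equality) (use assms in \<open>auto simp: free_algebra_closed(3)[of y G y]\<close>)
  then show ?thesis by (simp add: a_minus_def)
qed

context elliptic_parameters
begin

lemma Xv_in: "Xv i \<in> carrier (free_algebra (generators \<sigma> \<tau>))"
  unfolding Xv_def by (rule single_in_free_algebra) (simp add: generators_def)

lemma Cf_in: "f \<in> totally_elliptic \<sigma> \<tau> \<Longrightarrow> Cf f \<in> carrier (free_algebra (generators \<sigma> \<tau>))"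
  unfolding Cf_def by (rule single_in_free_algebra) (simp add: generators_def)

lemma relators_in: "relators \<sigma> \<tau> \<subseteq> carrier (free_algebra (generators \<sigma> \<tau>))"
  unfolding relators_def
  by (auto intro!: free_algebra_closed Cf_in Xv_in single_in_free_algebra totally_elliptic_add
      totally_elliptic_mult totally_elliptic_const totally_elliptic_translate weight_fun_totally_elliptic)

lemma relation_ideal: "ideal (relation_ideal \<sigma> \<tau>) (free_algebra (generators \<sigma> \<tau>))"
  unfolding relation_ideal_def by (rule ring.genideal_ideal[OF free_algebra_ring relators_in])

lemma relation_coset_eq:
  assumes "P - Q \<in> relators \<sigma> \<tau>" "P \<in> carrier (free_algebra (generators \<sigma> \<tau>))"
    "Q \<in> carrier (free_algebra (generators \<sigma> \<tau>))"
  shows "relation_ideal \<sigma> \<tau> +>\<^bsub>free_algebra (generators \<sigma> \<tau>)\<^esub> P =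
         relation_ideal \<sigma> \<tau> +>\<^bsub>free_algebra (generators \<sigma> \<tau>)\<^esub> Q"
proof -
  have "P - Q \<in> relation_ideal \<sigma> \<tau>"
    using ring.genideal_self[OF free_algebra_ring relators_in] assms(1) unfolding relation_ideal_def by blast
  then show ?thesis
    using ring.quotient_eq_iff_same_a_r_cos[OF free_algebra_ring relation_ideal assms(2,3)]
    by (simp add: free_algebra_a_minus assms(2,3))
qed

end

section \<open>Normal ordering and the multinomial theorem\<close>

text \<open>What the multinomial theorem needs to know about the algebra: the coefficients form
  a homomorphic image of the field of totally elliptic functions, and the two commutation
  relations hold.\<close>

locale elliptic_commuting_variables = elliptic_parameters + ring A for A (structure) +
  fixes X :: "'r::{finite,linorder} \<Rightarrow> 'a" and c :: "'r gfun \<Rightarrow> 'a"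
  assumes X_closed: "X i \<in> carrier A"
    and c_closed: "f \<in> totally_elliptic \<sigma> \<tau> \<Longrightarrow> c f \<in> carrier A"
    and c_add: "f \<in> totally_elliptic \<sigma> \<tau> \<Longrightarrow> g \<in> totally_elliptic \<sigma> \<tau> \<Longrightarrow> c (f + g) = c f \<oplus> c g"
    and c_mult: "f \<in> totally_elliptic \<sigma> \<tau> \<Longrightarrow> g \<in> totally_elliptic \<sigma> \<tau> \<Longrightarrow> c (f * g) = c f \<otimes> c g"
    and c_one: "c 1 = \<one>"
    and X_X: "i < j \<Longrightarrow> X j \<otimes> X i = c (weight_fun \<sigma> \<tau> i j 1 1) \<otimes> X i \<otimes> X j"
    and X_c: "f \<in> totally_elliptic \<sigma> \<tau> \<Longrightarrow> X i \<otimes> c f = c (translate (shift_vec i) f) \<otimes> X i"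
begin

definition monomial :: "('r \<Rightarrow> nat) \<Rightarrow> 'r list \<Rightarrow> 'a" where
  "monomial k ls = foldr (\<lambda>i m. X i [^] k i \<otimes> m) ls \<one>"

lemma monomial_simps [simp]:
  "monomial k [] = \<one>" "monomial k (l # ls) = X l [^] k l \<otimes> monomial k ls"
  by (simp_all add: monomial_def)

lemma monomial_closed [simp]: "monomial k ls \<in> carrier A"
  by (induction ls) (simp_all add: X_closed)

lemma monomial_upd_other: "i \<notin> set ls \<Longrightarrow> monomial (k(i := m)) ls = monomial k ls"
  by (induction ls) auto

lemma X_pow_c:
  assumes "f \<in> totally_elliptic \<sigma> \<tau>"
  shows "X i [^] m \<otimes> c f = c ((translate (shift_vec i) ^^ m) f) \<otimes> X i [^] m"
  using assms
proof (induction m arbitrary: f)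
  case 0
  then show ?case by (simp add: c_closed)
next
  case (Suc m)
  have t: "translate (shift_vec i) f \<in> totally_elliptic \<sigma> \<tau>"
    by (rule totally_elliptic_translate[OF Suc.prems])
  have "X i [^] Suc m \<otimes> c f = X i [^] m \<otimes> (X i \<otimes> c f)"
    by (simp add: X_closed c_closed Suc.prems m_assoc)
  also have "\<dots> = (X i [^] m \<otimes> c (translate (shift_vec i) f)) \<otimes> X i"
    by (simp add: X_c[OF Suc.prems] X_closed c_closed t m_assoc)
  also have "\<dots> = c ((translate (shift_vec i) ^^ m) (translate (shift_vec i) f)) \<otimes> X i [^] Suc m"
    unfolding Suc.IH[OF t]
    by (simp add: X_closed c_closed totally_elliptic_translate_funpow t m_assoc)
  finally show ?case by (simp add: funpow_swap1)
qed

lemma X_X_pow: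
  assumes li: "l < i"
  shows "X i \<otimes> X l [^] m = c (swap_fun l i m) \<otimes> X l [^] m \<otimes> X i"
proof (induction m)
  case 0
  then show ?case by (simp add: swap_fun_def c_one X_closed)
next
  case (Suc m)
  define w where "w = weight_fun \<sigma> \<tau> l i 1 1"
  define w' where "w' = (translate (shift_vec l) ^^ m) w"
  have cl: "c (swap_fun l i m) \<in> carrier A" "c w \<in> carrier A" "c w' \<in> carrier A"
    and w: "w \<in> totally_elliptic \<sigma> \<tau>" "w' \<in> totally_elliptic \<sigma> \<tau>"
    using li by (auto simp: w_def w'_def intro!: c_closed swap_fun_totally_elliptic
        totally_elliptic_translate_funpow weight_fun_totally_elliptic)
  have "X i \<otimes> X l [^] Suc m = (X i \<otimes> X l [^] m) \<otimes> X l"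
    by (simp add: X_closed m_assoc)
  also have "\<dots> = c (swap_fun l i m) \<otimes> X l [^] m \<otimes> (X i \<otimes> X l)"
    unfolding Suc.IH by (simp add: X_closed cl m_assoc)
  also have "\<dots> = c (swap_fun l i m) \<otimes> (X l [^] m \<otimes> c w) \<otimes> X l \<otimes> X i"
    unfolding X_X[OF li] w_def[symmetric] by (simp add: X_closed cl m_assoc)
  also have "\<dots> = (c (swap_fun l i m) \<otimes> c w') \<otimes> X l [^] Suc m \<otimes> X i"
    unfolding X_pow_c[OF w(1)] w'_def[symmetric] by (simp add: X_closed cl m_assoc)
  also have "c (swap_fun l i m) \<otimes> c w' = c (swap_fun l i (Suc m))"
    using li w(2) by (simp add: c_mult[symmetric] swap_fun_totally_elliptic)
      (simp add: swap_fun_def w'_def w_def)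
  finally show ?case .
qed

text \<open>Letters that come after \<open>X\<^sub>i\<close> in the list are not crossed, so
  only the relations for \<open>l < i\<close> enter.\<close>

lemma X_monomial_insert:
  assumes "sorted_wrt (<) ls" "i \<in> set ls"
  shows "X i \<otimes> monomial k ls = c (insertion_fun i k ls) \<otimes> monomial (k(i := Suc (k i))) ls"
  using assms
proof (induction ls)
  case Nil
  then show ?case by simp
next
  case (Cons l ls)
  show ?case
  proof (cases "l = i")
    case True
    then have "i \<notin> set ls" using Cons.prems(1) by auto
    then have "monomial (k(i := Suc (k i))) (l # ls) = X i [^] Suc (k i) \<otimes> monomial k ls"
      using True by (simp add: monomial_upd_other del: fun_upd_apply) simp
    also have "X i [^] Suc (k i) = X i \<otimes> X i [^] k i" by (rule nat_pow_Suc2[OF X_closed])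
    finally show ?thesis using True by (simp add: c_one X_closed m_assoc)
  next
    case False
    then have li: "i \<in> set ls" "l < i" using Cons.prems by auto
    define M where "M = monomial (k(i := Suc (k i))) ls"
    define e where "e = insertion_fun i k ls"
    define e' where "e' = (translate (shift_vec l) ^^ k l) e"
    have te: "e \<in> totally_elliptic \<sigma> \<tau>" "e' \<in> totally_elliptic \<sigma> \<tau>" "swap_fun l i (k l) \<in> totally_elliptic \<sigma> \<tau>"
      using False by (auto simp: e_def e'_def intro!: insertion_fun_totally_elliptic
          totally_elliptic_translate_funpow swap_fun_totally_elliptic)
    note cl = te[THEN c_closed] X_closed
    have M: "M \<in> carrier A" by (simp add: M_def)
    have IH: "X i \<otimes> monomial k ls = c e \<otimes> M"
      unfolding e_def M_def by (rule Cons.IH) (use Cons.prems li in auto)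
    have "X i \<otimes> monomial k (l # ls) = (X i \<otimes> X l [^] k l) \<otimes> monomial k ls"
      by (simp add: cl m_assoc)
    also have "\<dots> = c (swap_fun l i (k l)) \<otimes> X l [^] k l \<otimes> (X i \<otimes> monomial k ls)"
      unfolding X_X_pow[OF li(2)] by (simp add: cl m_assoc)
    also have "\<dots> = c (swap_fun l i (k l)) \<otimes> (X l [^] k l \<otimes> c e) \<otimes> M"
      unfolding IH by (simp add: cl M m_assoc)
    also have "\<dots> = (c (swap_fun l i (k l)) \<otimes> c e') \<otimes> (X l [^] k l \<otimes> M)"
      unfolding X_pow_c[OF te(1)] e'_def[symmetric] by (simp add: cl M m_assoc)
    also have "c (swap_fun l i (k l)) \<otimes> c e' = c (insertion_fun i k (l # ls))"
      using False te by (simp add: c_mult e'_def e_def)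
    also have "X l [^] k l \<otimes> M = monomial (k(i := Suc (k i))) (l # ls)"
      using False by (simp add: M_def)
    finally show ?thesis .
  qed
qed

lemma finsum_swap:
  assumes "finite I" "finite J" "\<And>i j. i \<in> I \<Longrightarrow> j \<in> J \<Longrightarrow> f i j \<in> carrier A"
  shows "(\<Oplus>i\<in>I. \<Oplus>j\<in>J. f i j) = (\<Oplus>j\<in>J. \<Oplus>i\<in>I. f i j)"
  using assms(1,3)
proof (induction I rule: finite_induct)
  case empty
  then show ?case by (simp add: finsum_zero)
next
  case (insert x I)
  have "(\<Oplus>i\<in>insert x I. \<Oplus>j\<in>J. f i j) = (\<Oplus>j\<in>J. f x j) \<oplus> (\<Oplus>j\<in>J. \<Oplus>i\<in>I. f i j)"
    using insert by (subst finsum_insert) (auto intro!: finsum_closed)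
  also have "\<dots> = (\<Oplus>j\<in>J. f x j \<oplus> (\<Oplus>i\<in>I. f i j))"
    using insert by (intro finsum_addf[symmetric]) (auto intro!: finsum_closed)
  also have "\<dots> = (\<Oplus>j\<in>J. \<Oplus>i\<in>insert x I. f i j)"
    using insert by (intro finsum_cong' refl) (auto intro!: finsum_closed)
  finally show ?case .
qed

lemma c_sum:
  assumes "finite S" "\<And>i. i \<in> S \<Longrightarrow> f i \<in> totally_elliptic \<sigma> \<tau>"
  shows "c (sum f S) = (\<Oplus>i\<in>S. c (f i))"
  using assms
proof (induction S rule: finite_induct)
  case empty
  have z: "0 \<in> totally_elliptic \<sigma> \<tau>" using totally_elliptic_sum[of "{}"] by simp
  have "c 0 \<oplus> c 0 = c 0" using c_add[OF z z] by simp
  then have "c 0 = \<zero>" using c_closed[OF z] by (metis add.r_cancel_one')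
  then show ?case by simp
next
  case (insert x S)
  then show ?case
    by (simp add: c_add totally_elliptic_sum) (subst finsum_insert, auto intro: c_closed)
qed

lemma finite_compositions: "finite {k :: 'r \<Rightarrow> nat. sum k UNIV = n}"
proof (rule finite_subset)
  show "{k :: 'r \<Rightarrow> nat. sum k UNIV = n} \<subseteq> {k. \<forall>i. k i \<in> {..n}}"
  proof (clarsimp)
    fix k :: "'r \<Rightarrow> nat" and i show "k i \<le> sum k UNIV" by (rule member_le_sum) auto
  qed
  show "finite {k :: 'r \<Rightarrow> nat. \<forall>i. k i \<in> {..n}}"
    using finite_PiE[of "UNIV :: 'r set" "\<lambda>_. {..n}"] by (simp add: PiE_def Pi_def extensional_def)
qed

lemma sum_upd: "sum (k(i := m)) UNIV + k i = sum k UNIV + m" for k :: "'r \<Rightarrow> nat"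
proof -
  have "sum (k(i := m)) (UNIV - {i}) = sum k (UNIV - {i})" by (rule sum.cong) auto
  then show ?thesis using sum.remove[of UNIV i k] sum.remove[of UNIV i "k(i := m)"] by simp
qed

text \<open>The sum is reindexed by the exponents of the new monomial, with value 0 for
  exponents that do not come from an insertion of \<open>X\<^sub>i\<close>.\<close>

lemma left_multiply_monomial_sum:
  fixes M :: "('r \<Rightarrow> nat) \<Rightarrow> 'r gfun"
  assumes "\<And>k. sum k UNIV = n \<Longrightarrow> M k \<in> totally_elliptic \<sigma> \<tau>"
  defines "L \<equiv> sorted_list_of_set UNIV"
  shows "X i \<otimes> (\<Oplus>k\<in>{k. sum k UNIV = n}. c (M k) \<otimes> monomial k L) =
    (\<Oplus>k\<in>{k. sum k UNIV = Suc n}. if k i > 0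
       then c (translate (shift_vec i) (M (k(i := k i - 1))) * insertion_fun i (k(i := k i - 1)) L) \<otimes> monomial k L
       else \<zero>)"
proof -
  define h where "h k = c (translate (shift_vec i) (M k) * insertion_fun i k L)" for k
  have te: "translate (shift_vec i) (M k) * insertion_fun i k L \<in> totally_elliptic \<sigma> \<tau>"
    if "sum k UNIV = n" for k :: "'r \<Rightarrow> nat"
    using assms(1)[OF that]
    by (intro totally_elliptic_mult totally_elliptic_translate insertion_fun_totally_elliptic)
  have L: "sorted_wrt (<) L" "i \<in> set L" by (simp_all add: L_def)
  have "X i \<otimes> (\<Oplus>k\<in>{k. sum k UNIV = n}. c (M k) \<otimes> monomial k L) =
      (\<Oplus>k\<in>{k. sum k UNIV = n}. X i \<otimes> (c (M k) \<otimes> monomial k L))"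
    using assms(1) by (intro finsum_rdistr finite_compositions X_closed) (auto intro!: m_closed c_closed)
  also have "\<dots> = (\<Oplus>k\<in>{k. sum k UNIV = n}. h k \<otimes> monomial (k(i := Suc (k i))) L)"
  proof (rule finsum_cong'[OF refl])
    show "(\<lambda>k. h k \<otimes> monomial (k(i := Suc (k i))) L) \<in> {k. sum k UNIV = n} \<rightarrow> carrier A"
      using te by (auto intro!: m_closed c_closed simp: h_def)
    fix k :: "'r \<Rightarrow> nat" assume "k \<in> {k. sum k UNIV = n}"
    then have k: "M k \<in> totally_elliptic \<sigma> \<tau>" using assms(1) by simp
    note te' = totally_elliptic_translate[OF k, of "shift_vec i"] insertion_fun_totally_elliptic[of i k L]
    note cl = te'[THEN c_closed] c_closed[OF k] X_closed
    have "X i \<otimes> (c (M k) \<otimes> monomial k L) = (X i \<otimes> c (M k)) \<otimes> monomial k L"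
      by (simp add: cl m_assoc)
    also have "\<dots> = c (translate (shift_vec i) (M k)) \<otimes> (X i \<otimes> monomial k L)"
      unfolding X_c[OF k] by (simp add: cl m_assoc)
    also have "\<dots> = h k \<otimes> monomial (k(i := Suc (k i))) L"
      unfolding X_monomial_insert[OF L] h_def c_mult[OF te'] by (simp add: cl m_assoc)
    finally show "X i \<otimes> (c (M k) \<otimes> monomial k L) = h k \<otimes> monomial (k(i := Suc (k i))) L" .
  qed
  also have "\<dots> = (\<Oplus>k\<in>{k. sum k UNIV = n}. (\<lambda>k. h (k(i := k i - 1)) \<otimes> monomial k L) (k(i := Suc (k i))))"
    by simp
  also have "\<dots> = (\<Oplus>k\<in>(\<lambda>k. k(i := Suc (k i))) ` {k. sum k UNIV = n}. h (k(i := k i - 1)) \<otimes> monomial k L)"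
  proof (rule finsum_reindex[symmetric])
    show "(\<lambda>k. h (k(i := k i - 1)) \<otimes> monomial k L) \<in> (\<lambda>k. k(i := Suc (k i))) ` {k. sum k UNIV = n} \<rightarrow> carrier A"
      using te by (auto intro!: m_closed c_closed simp: h_def)
    show "inj_on (\<lambda>k. k(i := Suc (k i))) {k. sum k UNIV = n}"
      by (rule inj_onI) (metis fun_upd_same fun_upd_triv fun_upd_upd nat.inject)
  qed
  also have "(\<lambda>k. k(i := Suc (k i))) ` {k. sum k UNIV = n} = {k. sum k UNIV = Suc n \<and> k i > 0}"
  proof (intro equalityI subsetI)
    fix k :: "'r \<Rightarrow> nat" assume "k \<in> (\<lambda>k. k(i := Suc (k i))) ` {k. sum k UNIV = n}"
    then obtain k' where "k = k'(i := Suc (k' i))" "sum k' UNIV = n" by auto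
    then show "k \<in> {k. sum k UNIV = Suc n \<and> k i > 0}" using sum_upd[of k' i "Suc (k' i)"] by simp
  next
    fix k :: "'r \<Rightarrow> nat" assume k: "k \<in> {k. sum k UNIV = Suc n \<and> k i > 0}"
    then have "k = (k(i := k i - 1))(i := Suc ((k(i := k i - 1)) i))" by auto
    moreover have "sum (k(i := k i - 1)) UNIV = n" using k sum_upd[of k i "k i - 1"] by simp
    ultimately show "k \<in> (\<lambda>k. k(i := Suc (k i))) ` {k. sum k UNIV = n}" by blast
  qed
  also have "(\<Oplus>k\<in>{k. sum k UNIV = Suc n \<and> k i > 0}. h (k(i := k i - 1)) \<otimes> monomial k L) =
      (\<Oplus>k\<in>{k. sum k UNIV = Suc n}. if k i > 0 then h (k(i := k i - 1)) \<otimes> monomial k L else \<zero>)"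
  proof (rule add.finprod_mono_neutral_cong_left)
    show "(\<lambda>k. if k i > 0 then h (k(i := k i - 1)) \<otimes> monomial k L else \<zero>) \<in> {k. sum k UNIV = Suc n} \<rightarrow> carrier A"
    proof
      fix k :: "'r \<Rightarrow> nat" assume k: "k \<in> {k. sum k UNIV = Suc n}"
      have "sum (k(i := k i - 1)) UNIV = n" if "k i > 0" using k that sum_upd[of k i "k i - 1"] by simp
      then show "(if k i > 0 then h (k(i := k i - 1)) \<otimes> monomial k L else \<zero>) \<in> carrier A"
        using te by (auto intro!: m_closed c_closed simp: h_def)
    qed
  qed (auto simp: finite_compositions)
  finally show ?thesis by (simp only: h_def)
qed

text \<open>Induction on \<open>n\<close>, with the new factor on the left. Exchanging the sums
  over \<open>i\<close> and over the exponents collects, for each monomial, the right-hand side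
  of \<open>multinomial_fun_recursion\<close>.\<close>

theorem elliptic_multinomial_theorem:
  assumes "ell_poch q p q n \<noteq> 0"
  shows "(\<Oplus>i\<in>UNIV. X i) [^] n =
    (\<Oplus>k\<in>{k. sum k UNIV = n}. c (multinomial_fun \<sigma> \<tau> k) \<otimes> monomial k (sorted_list_of_set UNIV))"
  using assms
proof (induction n)
  case 0
  have "{k :: 'r \<Rightarrow> nat. sum k UNIV = 0} = {\<lambda>_. 0}" by (auto simp: fun_eq_iff)
  moreover have "monomial (\<lambda>_. 0) ls = \<one>" for ls by (induction ls) auto
  ultimately show ?case by (simp add: multinomial_fun_zero c_one)
next
  case (Suc n)
  let ?L = "sorted_list_of_set (UNIV :: 'r set)"
  have pn: "ell_poch q p q n \<noteq> 0" by (rule ell_poch_nonzero_pred[OF Suc.prems])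
  have te: "multinomial_fun \<sigma> \<tau> k \<in> totally_elliptic \<sigma> \<tau>" if "sum k UNIV = n" for k :: "'r \<Rightarrow> nat"
    using multinomial_fun_totally_elliptic[of k] that pn by simp
  define g where "g i k = translate (shift_vec i) (multinomial_fun \<sigma> \<tau> (k(i := k i - 1)))
      * insertion_fun i (k(i := k i - 1)) ?L" for i k
  have g: "g i k \<in> totally_elliptic \<sigma> \<tau>" if "sum k UNIV = Suc n" "k i > 0" for i k
    unfolding g_def using te[of "k(i := k i - 1)"] that sum_upd[of k i "k i - 1"]
    by (intro totally_elliptic_mult totally_elliptic_translate insertion_fun_totally_elliptic) simp
  have gc: "(if k i > 0 then c (g i k) \<otimes> monomial k ?L else \<zero>) \<in> carrier A" if "sum k UNIV = Suc n" for i k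
    using g[OF that] by (auto intro!: m_closed c_closed)
  define P where "P = (\<Oplus>k\<in>{k. sum k UNIV = n}. c (multinomial_fun \<sigma> \<tau> k) \<otimes> monomial k ?L)"
  have P: "P \<in> carrier A" unfolding P_def using te by (intro finsum_closed) (auto intro!: m_closed c_closed)
  have "(\<Oplus>i\<in>UNIV. X i) [^] Suc n = (\<Oplus>i\<in>UNIV. X i) \<otimes> P"
    unfolding P_def Suc.IH[OF pn, symmetric] by (intro nat_pow_Suc2 finsum_closed) (simp add: X_closed)
  also have "\<dots> = (\<Oplus>i\<in>UNIV. X i \<otimes> P)"
    using P by (intro finsum_ldistr) (auto simp: X_closed)
  also have "\<dots> = (\<Oplus>i\<in>UNIV. \<Oplus>k\<in>{k. sum k UNIV = Suc n}. if k i > 0 then c (g i k) \<otimes> monomial k ?L else \<zero>)"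
    unfolding P_def g_def by (simp only: left_multiply_monomial_sum[OF te])
  also have "\<dots> = (\<Oplus>k\<in>{k. sum k UNIV = Suc n}. \<Oplus>i\<in>UNIV. if k i > 0 then c (g i k) \<otimes> monomial k ?L else \<zero>)"
    using gc by (intro finsum_swap finite_compositions) auto
  also have "\<dots> = (\<Oplus>k\<in>{k. sum k UNIV = Suc n}. c (multinomial_fun \<sigma> \<tau> k) \<otimes> monomial k ?L)"
  proof (rule finsum_cong'[OF refl])
    have "multinomial_fun \<sigma> \<tau> k \<in> totally_elliptic \<sigma> \<tau>" if "sum k UNIV = Suc n" for k :: "'r \<Rightarrow> nat"
      using multinomial_fun_totally_elliptic[of k] that Suc.prems by simp
    then show "(\<lambda>k. c (multinomial_fun \<sigma> \<tau> k) \<otimes> monomial k ?L) \<in> {k. sum k UNIV = Suc n} \<rightarrow> carrier A"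
      by (auto intro!: m_closed c_closed)
    fix k :: "'r \<Rightarrow> nat" assume "k \<in> {k. sum k UNIV = Suc n}"
    then have k: "sum k UNIV = Suc n" by simp
    have "(\<Oplus>i\<in>UNIV. if k i > 0 then c (g i k) \<otimes> monomial k ?L else \<zero>) =
        (\<Oplus>i\<in>{i. k i > 0}. c (g i k) \<otimes> monomial k ?L)"
      using g[OF k] by (intro add.finprod_mono_neutral_cong_right) (auto intro!: m_closed c_closed)
    also have "\<dots> = (\<Oplus>i\<in>{i. k i > 0}. c (g i k)) \<otimes> monomial k ?L"
      using g[OF k] by (intro finsum_ldistr[symmetric]) (auto intro!: m_closed c_closed)
    also have "(\<Oplus>i\<in>{i. k i > 0}. c (g i k)) = c (\<Sum>i\<in>{i. k i > 0}. g i k)"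
      using g[OF k] by (intro c_sum[symmetric]) auto
    also have "(\<Sum>i\<in>{i. k i > 0}. g i k) = multinomial_fun \<sigma> \<tau> k"
      unfolding g_def by (rule multinomial_fun_recursion[symmetric]) (use k Suc.prems in auto)
    finally show "(\<Oplus>i\<in>UNIV. if k i > 0 then c (g i k) \<otimes> monomial k ?L else \<zero>) =
        c (multinomial_fun \<sigma> \<tau> k) \<otimes> monomial k ?L" .
  qed
  finally show ?case .
qed

end

text \<open>Every family of relators yields one of the required properties; the constants yield
  the value at 1.\<close>

lemma (in elliptic_parameters) elliptic_algebra_variables:
  "elliptic_commuting_variables \<sigma> \<tau> p q (elliptic_algebra \<sigma> \<tau> :: ('r::{finite,linorder} gen list \<Rightarrow>\<^sub>0 complex) set ring)
     (X_elt \<sigma> \<tau>) (coef_elt \<sigma> \<tau>)"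
proof -
  let ?F = "free_algebra (generators \<sigma> \<tau>) :: ('r gen list \<Rightarrow>\<^sub>0 complex) ring"
  let ?I = "relation_ideal \<sigma> \<tau> :: ('r gen list \<Rightarrow>\<^sub>0 complex) set"
  let ?A = "elliptic_algebra \<sigma> \<tau> :: ('r gen list \<Rightarrow>\<^sub>0 complex) set ring"
  interpret I: ideal ?I ?F by (rule relation_ideal)
  interpret A: ring ?A unfolding elliptic_algebra_def by (rule I.quotient_is_ring)
  have hom: "(\<lambda>P. ?I +>\<^bsub>?F\<^esub> P) \<in> ring_hom ?F ?A"
    unfolding elliptic_algebra_def by (rule I.rcos_ring_hom)
  note hom_mult = ring_hom_mult[OF hom, unfolded free_algebra_sel]
    and hom_add = ring_hom_add[OF hom, unfolded free_algebra_sel]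
    and hom_closed = ring_hom_closed[OF hom]
    and hom_one = ring_hom_one[OF hom, unfolded free_algebra_sel]
  note defs = X_elt_def coef_elt_def
  note mem = free_algebra_closed Xv_in Cf_in totally_elliptic_add totally_elliptic_mult
    totally_elliptic_const totally_elliptic_translate
  show ?thesis
  proof (unfold_locales)
    show "X_elt \<sigma> \<tau> i \<in> carrier ?A" for i unfolding defs by (intro hom_closed mem)
    fix f g :: "'r gfun"
    assume f: "f \<in> totally_elliptic \<sigma> \<tau>"
    show "coef_elt \<sigma> \<tau> f \<in> carrier ?A" unfolding defs by (intro hom_closed mem f)
    have "Xv i * Cf f - Cf (translate (shift_vec i) f) * Xv i \<in> relators \<sigma> \<tau>" for i
      unfolding relators_def shift_vec_def using f by blast
    from relation_coset_eq[OF this] have "?I +>\<^bsub>?F\<^esub> (Xv i * Cf f) =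
        ?I +>\<^bsub>?F\<^esub> (Cf (translate (shift_vec i) f) * Xv i)" for i
      using f by (simp add: mem)
    then show "X_elt \<sigma> \<tau> i \<otimes>\<^bsub>?A\<^esub> coef_elt \<sigma> \<tau> f =
        coef_elt \<sigma> \<tau> (translate (shift_vec i) f) \<otimes>\<^bsub>?A\<^esub> X_elt \<sigma> \<tau> i" for i
      unfolding defs using f by (simp add: hom_mult mem)
    assume g: "g \<in> totally_elliptic \<sigma> \<tau>"
    have "Cf (f + g) - (Cf f + Cf g) \<in> relators \<sigma> \<tau>"
      unfolding relators_def using f g by blast
    from relation_coset_eq[OF this] have "?I +>\<^bsub>?F\<^esub> Cf (f + g) = ?I +>\<^bsub>?F\<^esub> (Cf f + Cf g)"
      using f g by (simp add: mem)
    then show "coef_elt \<sigma> \<tau> (f + g) = coef_elt \<sigma> \<tau> f \<oplus>\<^bsub>?A\<^esub> coef_elt \<sigma> \<tau> g"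
      unfolding defs using f g by (simp add: hom_add mem)
    have "Cf (f * g) - Cf f * Cf g \<in> relators \<sigma> \<tau>"
      unfolding relators_def using f g by blast
    from relation_coset_eq[OF this] have "?I +>\<^bsub>?F\<^esub> Cf (f * g) = ?I +>\<^bsub>?F\<^esub> (Cf f * Cf g)"
      using f g by (simp add: mem)
    then show "coef_elt \<sigma> \<tau> (f * g) = coef_elt \<sigma> \<tau> f \<otimes>\<^bsub>?A\<^esub> coef_elt \<sigma> \<tau> g"
      unfolding defs using f g by (simp add: hom_mult mem)
  next
    have one: "Poly_Mapping.single [] (1::complex) = (1 :: 'r gen list \<Rightarrow>\<^sub>0 complex)"
      by (simp flip: zero_list_def)
    have "Cf (const_gfun 1) - Poly_Mapping.single [] 1 \<in> (relators \<sigma> \<tau> :: ('r gen list \<Rightarrow>\<^sub>0 complex) set)"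
      unfolding relators_def by blast
    from relation_coset_eq[OF this]
    have "?I +>\<^bsub>?F\<^esub> Cf (const_gfun 1) = ?I +>\<^bsub>?F\<^esub> Poly_Mapping.single [] 1"
      by (simp add: mem single_in_free_algebra)
    then show "coef_elt \<sigma> \<tau> (1 :: 'r gfun) = \<one>\<^bsub>?A\<^esub>"
      unfolding defs by (simp add: const_gfun_one one hom_one)
  next
    fix i j :: 'r assume ij: "i < j"
    then have w: "weight_fun \<sigma> \<tau> i j 1 1 \<in> totally_elliptic \<sigma> \<tau>"
      by (intro weight_fun_totally_elliptic) simp
    have "Xv j * Xv i - Cf (weight_fun \<sigma> \<tau> i j 1 1) * Xv i * Xv j \<in> relators \<sigma> \<tau>"
      unfolding relators_def using ij by blast
    from relation_coset_eq[OF this]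
    have "?I +>\<^bsub>?F\<^esub> (Xv j * Xv i) = ?I +>\<^bsub>?F\<^esub> (Cf (weight_fun \<sigma> \<tau> i j 1 1) * Xv i * Xv j)"
      using w by (simp add: mem)
    then show "X_elt \<sigma> \<tau> j \<otimes>\<^bsub>?A\<^esub> X_elt \<sigma> \<tau> i =
        coef_elt \<sigma> \<tau> (weight_fun \<sigma> \<tau> i j 1 1) \<otimes>\<^bsub>?A\<^esub> X_elt \<sigma> \<tau> i \<otimes>\<^bsub>?A\<^esub> X_elt \<sigma> \<tau> j"
      unfolding defs using w by (simp add: hom_mult mem)
  qed
qed

theorem theorem4p1:
  fixes q p \<sigma> \<tau> :: complex and n :: nat
    and A :: "('r::{finite,linorder} gen list \<Rightarrow>\<^sub>0 complex) set ring"
  assumes r: "CARD('r) > 1"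
    and q: "q = exp (2 * of_real pi * \<i> * \<sigma>)" and \<sigma>: "\<sigma> \<noteq> 0"
    and p: "p = exp (2 * of_real pi * \<i> * \<tau>)" and "norm p < 1"
    and defined: "ell_poch q p q n \<noteq> 0"
    and A: "A = elliptic_algebra \<sigma> \<tau>"
  shows "(\<Oplus>\<^bsub>A\<^esub>i\<in>UNIV. X_elt \<sigma> \<tau> i) [^]\<^bsub>A\<^esub> n =
    (\<Oplus>\<^bsub>A\<^esub>k\<in>{k :: 'r \<Rightarrow> nat. sum k UNIV = n}.
       coef_elt \<sigma> \<tau> (multinomial_fun \<sigma> \<tau> k) \<otimes>\<^bsub>A\<^esub> X_monomial \<sigma> \<tau> k)"
proof -
  interpret elliptic_parameters \<sigma> \<tau> p q
    by unfold_locales (use assms in auto)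
  interpret elliptic_commuting_variables \<sigma> \<tau> p q A "X_elt \<sigma> \<tau>" "coef_elt \<sigma> \<tau>"
    unfolding A by (rule elliptic_algebra_variables)
  have mono: "X_monomial \<sigma> \<tau> k = monomial k (sorted_list_of_set UNIV)" for k :: "'r \<Rightarrow> nat"
    unfolding X_monomial_def monomial_def A[symmetric] ..
  show ?thesis unfolding mono by (rule elliptic_multinomial_theorem[OF defined])
qed

end
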